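(* Let $(X,\|\cdot\|)$ be a separable (VI)-polyhedral normed space with property ($\Delta$). Then $X$ admits a (IV)-polyhedral equivalent norm, which can be chosen to approximate $\|\cdot\|$. Moreover, the norm $\|\cdot\|$ can be approximated by norms that are $C^\infty$-smooth and LFC, and it can be approximated by analytic norms.
   Context: All normed spaces are real. For a normed space $X$, $B_X$ and $S_X$ denote its closed unit ball and unit sphere, and $X^*$ its topological dual. $\operatorname{ext} C$ is the set of extreme points of a convex set $C$. For $x\in S_X$ let $\mathcal D(x)=\{f\in S_{X^*}: f(x)=1\}$. For $A\subseteq X^*$, $A'$ denotes the set of all $w^*$-cluster (accumulation) points of $A$, i.e. those $f$ each of whose $w^*$-neighbourhoods contains a point of $A$ different from $f$. Property ($\Delta$): for every $x\in S_X$ the set $\operatorname{ext}\mathcal D(x)$ is finite. (VI)-polyhedral: every $x\in S_X$ has a neighbourhood $V$ such that for every $y\in V\cap S_X$ the segment $[x,y]$ is contained in $S_X$. (IV)-polyhedral: $f(x)<1$ for every $x\in S_X$ and $f\in(\operatorname{ext}B_{X^*})'$. The norm $\|\cdot\|$ is approximated by norms with a property (P) if for every $\varepsilon>0$ there is an equivalent norm $|||\cdot|||$ with (P) such that $(1-\varepsilon)\|x\|\le|||x|||\le(1+\varepsilon)\|x\|$ for all $x\in X$. A norm is $C^\infty$-smooth (respectively analytic) if it is $C^\infty$-smooth (respectively real analytic) on $X\setminus\{0\}$. A norm $\|\cdot\|$ is LFC if for each $x\in S_X$ there exist a neighbourhood $U$ of $x$ and $f_1,\dots,f_n\in X^*$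 such that $\|y\|=\|z\|$ for all $y,z\in U$ with $f_k(y)=f_k(z)$ for all $k=1,\dots,n$. *)

theory Defs
  imports "HOL-Analysis.Analysis"
begin

section \<open>Equivalent norms\<close>

text \<open>The original norm is the \<^term>\<open>norm\<close> of the type class, and an equivalent norm is a function
  \<^term>\<open>N\<close> on the same type. As equivalent norms have the same topology and the same dual, all of
  them share the dual space \<open>'a \<Rightarrow>\<^sub>L real\<close>; only the dual norm depends on \<^term>\<open>N\<close>.\<close>

definition equivalent_norm :: "('a::real_normed_vector \<Rightarrow> real) \<Rightarrow> bool" where
  "equivalent_norm N \<longleftrightarrow>
     (\<forall>x. N x = 0 \<longleftrightarrow> x = 0) \<and>
     (\<forall>a x. N (a *\<^sub>R x) = \<bar>a\<bar> * N x) \<and>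
     (\<forall>x y. N (x + y) \<le> N x + N y) \<and>
     (\<exists>c>0. \<exists>C>0. \<forall>x. c * norm x \<le> N x \<and> N x \<le> C * norm x)"

definition approximated_by :: "(('a::real_normed_vector \<Rightarrow> real) \<Rightarrow> bool) \<Rightarrow> bool" where
  "approximated_by P \<longleftrightarrow>
     (\<forall>\<epsilon>>0. \<exists>N. equivalent_norm N \<and> P N \<and>
        (\<forall>x. (1 - \<epsilon>) * norm x \<le> N x \<and> N x \<le> (1 + \<epsilon>) * norm x))"

definition unit_sphere :: "('a::real_normed_vector \<Rightarrow> real) \<Rightarrow> 'a set" where
  "unit_sphere N = {x. N x = 1}"

definition dual_norm :: "('a::real_normed_vector \<Rightarrow> real) \<Rightarrow> ('a \<Rightarrow>\<^sub>L real) \<Rightarrow> real" where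
  "dual_norm N f = (SUP x\<in>{x. N x \<le> 1}. \<bar>blinfun_apply f x\<bar>)"

lemma dual_norm_norm: "dual_norm norm f = norm f"
proof (rule antisym)
  have bound: "\<bar>blinfun_apply f x\<bar> \<le> norm f" if "norm x \<le> 1" for x
    using norm_blinfun[of f x] mult_left_mono[OF that norm_ge_zero[of f]] by simp
  show "dual_norm norm f \<le> norm f"
    unfolding dual_norm_def
    by (rule cSUP_least) (use bound in \<open>auto intro: exI[of _ 0]\<close>)
  have bdd: "bdd_above ((\<lambda>x. \<bar>blinfun_apply f x\<bar>) ` {x. norm x \<le> 1})"
    using bound by (intro bdd_aboveI[of _ "norm f"]) auto
  have upper: "\<bar>blinfun_apply f x\<bar> \<le> dual_norm norm f" if "norm x \<le> 1" for x
    unfolding dual_norm_def using that by (intro cSUP_upper bdd) auto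
  show "norm f \<le> dual_norm norm f"
  proof (rule norm_blinfun_bound)
    show "0 \<le> dual_norm norm f" using upper[of 0] by simp
  next
    fix x show "norm (blinfun_apply f x) \<le> dual_norm norm f * norm x"
    proof (cases "x = 0")
      case False
      then show ?thesis
        using upper[of "x /\<^sub>R norm x"]
        by (simp add: blinfun.scaleR_right abs_mult divide_simps mult.commute)
    qed simp
  qed
qed

definition dual_ball :: "('a::real_normed_vector \<Rightarrow> real) \<Rightarrow> ('a \<Rightarrow>\<^sub>L real) set" where
  "dual_ball N = {f. dual_norm N f \<le> 1}"

definition ext :: "'a::real_vector set \<Rightarrow> 'a set" where
  "ext C = {x. x extreme_point_of C}"

section \<open>Polyhedrality and property (\<open>\<Delta>\<close>)\<close>

definition duality_set :: "('a::real_normed_vector \<Rightarrow> real) \<Rightarrow> 'a \<Rightarrow> ('a \<Rightarrow>\<^sub>L real) set" where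
  "duality_set N x = {f. dual_norm N f = 1 \<and> blinfun_apply f x = 1}"

definition property_Delta :: "('a::real_normed_vector \<Rightarrow> real) \<Rightarrow> bool" where
  "property_Delta N \<longleftrightarrow> (\<forall>x\<in>unit_sphere N. finite (ext (duality_set N x)))"

definition VI_polyhedral :: "('a::real_normed_vector \<Rightarrow> real) \<Rightarrow> bool" where
  "VI_polyhedral N \<longleftrightarrow>
     (\<forall>x\<in>unit_sphere N. \<exists>V. open V \<and> x \<in> V \<and>
        (\<forall>y \<in> V \<inter> unit_sphere N. closed_segment x y \<subseteq> unit_sphere N))"

text \<open>For real-valued functionals the topology \<^term>\<open>strong_operator_topology\<close> is the topology of
  pointwise convergence on the dual, i.e. the weak-star topology.\<close>

definition IV_polyhedral :: "('a::real_normed_vector \<Rightarrow> real) \<Rightarrow> bool" where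
  "IV_polyhedral N \<longleftrightarrow>
     (\<forall>x\<in>unit_sphere N. \<forall>f \<in> strong_operator_topology derived_set_of ext (dual_ball N).
        blinfun_apply f x < 1)"

section \<open>Smoothness\<close>

definition LFC :: "('a::real_normed_vector \<Rightarrow> real) \<Rightarrow> bool" where
  "LFC N \<longleftrightarrow>
     (\<forall>x\<in>unit_sphere N. \<exists>U F. open U \<and> x \<in> U \<and> finite (F :: ('a \<Rightarrow>\<^sub>L real) set) \<and>
        (\<forall>y\<in>U. \<forall>z\<in>U. (\<forall>f\<in>F. blinfun_apply f y = blinfun_apply f z) \<longrightarrow> N y = N z))"

text \<open>An \<open>n\<close>-linear form is a function on lists, of which only the values at lists of length \<open>n\<close> are
  relevant.\<close>

definition bounded_multilinear :: "nat \<Rightarrow> ('a::real_normed_vector list \<Rightarrow> real) \<Rightarrow> bool" where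
  "bounded_multilinear n L \<longleftrightarrow>
     (\<forall>vs i. length vs = n \<longrightarrow> i < n \<longrightarrow> linear (\<lambda>u. L (vs[i := u]))) \<and>
     (\<exists>C. \<forall>vs. length vs = n \<longrightarrow> \<bar>L vs\<bar> \<le> C * prod_list (map norm vs))"

text \<open>Existence of Frechet derivatives of all orders on an open set \<^term>\<open>U\<close>. Here \<open>D n x\<close> is the \<open>n\<close>-th
  derivative at \<open>x\<close> as a bounded \<open>n\<close>-linear form, and the last condition says that the map
  \<open>x \<mapsto> D n x\<close> is Frechet differentiable at \<open>x\<close> for the operator norm of \<open>n\<close>-linear forms,
  with derivative \<open>h \<mapsto> D (n + 1) x (h, \<dots>)\<close>.\<close>

definition C_infinity_on :: "'a set \<Rightarrow> ('a::real_normed_vector \<Rightarrow> real) \<Rightarrow> bool" where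
  "C_infinity_on U f \<longleftrightarrow>
     (\<exists>D :: nat \<Rightarrow> 'a \<Rightarrow> 'a list \<Rightarrow> real.
        (\<forall>x\<in>U. D 0 x [] = f x) \<and>
        (\<forall>n. \<forall>x\<in>U. bounded_multilinear n (D n x)) \<and>
        (\<forall>n. \<forall>x\<in>U. \<forall>\<epsilon>>0. \<forall>\<^sub>F h in nhds 0. \<forall>vs. length vs = n \<longrightarrow>
           \<bar>D n (x + h) vs - D n x vs - D (Suc n) x (h # vs)\<bar>
             \<le> \<epsilon> * norm h * prod_list (map norm vs)))"

text \<open>Around each point of the open set \<^term>\<open>U\<close> the function is the sum of a power series of continuous
  homogeneous polynomials \<open>h \<mapsto> L n (h, \<dots>, h)\<close>, converging uniformly on some ball.\<close>

definition real_analytic_on :: "'a set \<Rightarrow> ('a::real_normed_vector \<Rightarrow> real) \<Rightarrow> bool" where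
  "real_analytic_on U f \<longleftrightarrow>
     (\<forall>x\<in>U. \<exists>r>0. \<exists>L :: nat \<Rightarrow> 'a list \<Rightarrow> real.
        (\<forall>n. bounded_multilinear n (L n)) \<and>
        uniform_limit (ball 0 r) (\<lambda>m h. \<Sum>n<m. L n (replicate n h)) (\<lambda>h. f (x + h)) sequentially)"

definition C_infinity_norm :: "('a::real_normed_vector \<Rightarrow> real) \<Rightarrow> bool" where
  "C_infinity_norm N \<longleftrightarrow> C_infinity_on (UNIV - {0}) N"

definition analytic_norm :: "('a::real_normed_vector \<Rightarrow> real) \<Rightarrow> bool" where
  "analytic_norm N \<longleftrightarrow> real_analytic_on (UNIV - {0}) N"

end

(* Near a point x of the sphere the segments [x, y] lie in the sphere, so some functional in D(x)
   attains the norm at y, and an extreme one can be chosen. As ext D(x) is finite and the sphere is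
   Lindelof, there is a sequence f_n in the dual unit ball such that every x satisfies
   |f_n(x)| = ||x|| for some n. Put g_n = (1 + e_n) f_n with e_n > 0 decreasing to 0: then
   ||x|| < sup |g_n(x)| for x \<noteq> 0, while only finitely many g_n exceed the norm noticeably.

   (IV): the norm sup |g_n|, since extreme points of its dual ball other than the +-g_n with n < m have
   norm at most 1 + e_m, so that accumulation points have norm at most 1.
   Smooth and LFC: the gauge of {Phi \<le> 1} for Phi = sum of b_n(g_n), where b_n is smooth, convex, zero
   on [-1, 1] and larger than 1 outside a slightly larger interval; the sum is locally finite on the
   open unit ball, which contains {Phi \<le> 1}.
   Analytic: N = lim N_n with N_{n+1} = (N_n^p + |g_{n+1}|^p)^(1/p) for p = p_{n+1} = 2 p_n. Here
   N_n^{p_n} is a polynomial, and N is N_k times a rapidly converging product on a neighbourhood of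
   any x \<noteq> 0, for k large. *)

theory Submission
  imports Defs
begin

section \<open>Extreme points from iterated directional derivatives and a countable boundary\<close>

text \<open>A norming sequence alone would not do, since its weak-star cluster points may attain the
  norm. The weights 1 + e_n break the tie: at x an attaining index n has the margin e_n ||x||, while
  all but finitely many weighted functionals exceed ||x|| by at most any given fraction of that
  margin. This gap is spent three times: on the strict inequality in (IV), on reaching level 1 of
  Phi inside the open ball, and on making the late terms negligible against N_k^p near x. Two
  further obstacles shape the proof. The gauge is defined only implicitly, so its gradient formula
  contains the gauge itself; all orders of differentiability come from a class of functions that
  contains the gauge and is closed under partial derivatives. The analytic norm involves infinitely
  many factors, whose expansions must converge on one common ball; therefore power series carry an
  explicit submultiplicative absolute norm, and an invariant keeps the radius from shrinking along
  the product.\<close>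

definition sublinear :: "('a::real_vector \<Rightarrow> real) \<Rightarrow> bool" where
  "sublinear p \<longleftrightarrow> (\<forall>x y. p (x + y) \<le> p x + p y) \<and> (\<forall>t x. 0 \<le> t \<longrightarrow> p (t *\<^sub>R x) = t * p x)"

lemma sublinear_add: "sublinear p \<Longrightarrow> p (x + y) \<le> p x + p y"
  and sublinear_scaleR: "sublinear p \<Longrightarrow> 0 \<le> t \<Longrightarrow> p (t *\<^sub>R x) = t * p x"
  by (auto simp: sublinear_def)

lemma sublinear_zero: "sublinear p \<Longrightarrow> p 0 = 0"
  using sublinear_scaleR[of p 0 0] by simp

lemma sublinear_minus: "sublinear p \<Longrightarrow> - p (- x) \<le> p x"
  using sublinear_add[of p x "- x"] sublinear_zero[of p] by simp

text \<open>The directional derivative of \<^term>\<open>p\<close> at \<^term>\<open>u\<close>, which is the support function of the face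
  of \<open>{f. f \<le> p}\<close> on which the evaluation at \<^term>\<open>u\<close> is maximal.\<close>

definition face_support :: "('a::real_vector \<Rightarrow> real) \<Rightarrow> 'a \<Rightarrow> 'a \<Rightarrow> real" where
  "face_support p u y = (INF t\<in>{0..}. p (y + t *\<^sub>R u) - t * p u)"

context
  fixes p :: "'a::real_vector \<Rightarrow> real"
  assumes p: "sublinear p"
begin

lemma face_support_lower: "t \<ge> 0 \<Longrightarrow> - p (- y) \<le> p (y + t *\<^sub>R u) - t * p u"
  using sublinear_add[OF p, of "y + t *\<^sub>R u" "- y"] sublinear_scaleR[OF p, of t u] by simp

lemma face_support_le: "t \<ge> 0 \<Longrightarrow> face_support p u y \<le> p (y + t *\<^sub>R u) - t * p u"
  unfolding face_support_def
  by (rule cINF_lower) (use face_support_lower in \<open>auto intro!: bdd_belowI2\<close>)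

lemma face_support_greatest:
  "(\<And>t. t \<ge> 0 \<Longrightarrow> c \<le> p (y + t *\<^sub>R u) - t * p u) \<Longrightarrow> c \<le> face_support p u y"
  unfolding face_support_def by (rule cINF_greatest) auto

lemma face_support_le_self: "face_support p u y \<le> p y"
  using face_support_le[of 0 u y] by simp

text \<open>The parameter \<open>t = 1\<close> cancels the argument. With
  \<open>sublinear_minus\<close> this makes the new support function linear along \<open>u\<close>,
  in accordance with \<open>u\<close> being constant on the face.\<close>

lemma face_support_uminus_le: "face_support p u (- u) \<le> - p u"
  using face_support_le[of 1 u "- u"] sublinear_zero[OF p] by simp

text \<open>A linear \<open>g\<close> satisfies \<open>g y = g (y + t u) - t g u\<close> for every
  t, so attaining the maximum at \<open>u\<close> is all it takes to remain dominated. Thus members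
  of a face survive the passage to its support function.\<close>

lemma linear_le_face_support:
  assumes "linear g" "\<And>y. g y \<le> p y" "g u = p u"
  shows "g y \<le> face_support p u y"
proof (rule face_support_greatest)
  fix t :: real
  have "g y = g (y + t *\<^sub>R u) - t * g u"
    using assms(1) by (simp add: linear_add linear_scale)
  then show "g y \<le> p (y + t *\<^sub>R u) - t * p u"
    using assms(2)[of "y + t *\<^sub>R u"] assms(3) by simp
qed

lemma sublinear_face_support: "sublinear (face_support p u)"
  unfolding sublinear_def
proof (intro conjI allI impI)
  fix y z
  \<comment> \<open>The parameters of the two summands add up to an admissible parameter
    \<open>t + s\<close> for the sum; the infima are then taken one variable at a time.\<close>
  have "face_support p u (y + z) - (p (z + s *\<^sub>R u) - s * p u) \<le> p (y + t *\<^sub>R u) - t * p u"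
    if "s \<ge> 0" "t \<ge> 0" for s t
    using face_support_le[of "t + s" u "y + z"] sublinear_add[OF p, of "y + t *\<^sub>R u" "z + s *\<^sub>R u"] that
    by (simp add: algebra_simps)
  then have "face_support p u (y + z) - (p (z + s *\<^sub>R u) - s * p u) \<le> face_support p u y"
    if "s \<ge> 0" for s
    using that face_support_greatest by blast
  then have "face_support p u (y + z) - face_support p u y \<le> face_support p u z"
    by (intro face_support_greatest) (smt (verit))
  then show "face_support p u (y + z) \<le> face_support p u y + face_support p u z"
    by simp
next
  fix t :: real and y
  have le: "face_support p u (t *\<^sub>R y) \<le> t * face_support p u y" if "t > 0" for t y
  proof -
    have "face_support p u (t *\<^sub>R y) / t \<le> p (y + s *\<^sub>R u) - s * p u" if "s \<ge> 0" for s
      using face_support_le[of "t * s" u "t *\<^sub>R y"] sublinear_scaleR[OF p, of t "y + s *\<^sub>R u"] that \<open>t > 0\<close>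
      by (simp add: scaleR_add_right field_simps)
    then have "face_support p u (t *\<^sub>R y) / t \<le> face_support p u y"
      using face_support_greatest by blast
    then show ?thesis using that by (simp add: field_simps)
  qed
  have zero: "face_support p u 0 = 0"
    using face_support_le_self[of u 0] face_support_greatest[of 0 0 u] sublinear_zero[OF p]
      sublinear_scaleR[OF p] by force
  assume "t \<ge> 0"
  show "face_support p u (t *\<^sub>R y) = t * face_support p u y"
  proof (cases "t = 0")
    case False
    with \<open>t \<ge> 0\<close> show ?thesis
      using le[of t y] le[of "inverse t" "t *\<^sub>R y"] by (simp add: field_simps)
  qed (simp add: zero)
qed

end

lemma sublinear_norm: "sublinear (norm :: 'a::real_normed_vector \<Rightarrow> real)"
  by (simp add: sublinear_def norm_triangle_ineq)

section \<open>Lexicographic maximisation along a sequence\<close>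

text \<open>This is the support function of those functionals of norm at most 1 that successively
  maximise \<open>s 0\<close>, ..., \<open>s (n - 1)\<close>, each among the survivors of the
  earlier stages.\<close>

primrec iterated_face :: "(nat \<Rightarrow> 'a::real_normed_vector) \<Rightarrow> nat \<Rightarrow> 'a \<Rightarrow> real" where
  "iterated_face s 0 = norm"
| "iterated_face s (Suc n) = face_support (iterated_face s n) (s n)"

lemma sublinear_iterated_face: "sublinear (iterated_face s n)"
  by (induction n) (simp_all add: sublinear_norm sublinear_face_support)

lemma iterated_face_Suc_le: "iterated_face s (Suc n) y \<le> iterated_face s n y"
  by (simp add: face_support_le_self sublinear_iterated_face)

lemma iterated_face_antimono: "m \<le> n \<Longrightarrow> iterated_face s n y \<le> iterated_face s m y"
  by (rule lift_Suc_antimono_le[of "\<lambda>n. iterated_face s n y"]) (auto simp: iterated_face_Suc_le simp del: iterated_face.simps)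

lemma iterated_face_le_norm: "iterated_face s n y \<le> norm y"
  using iterated_face_antimono[of 0 n s y] by simp

lemma iterated_face_ge_norm: "- norm y \<le> iterated_face s n y"
  using sublinear_minus[OF sublinear_iterated_face, of s n y] iterated_face_le_norm[of s n "- y"]
  by simp

definition lex_face :: "(nat \<Rightarrow> 'a::real_normed_vector) \<Rightarrow> 'a \<Rightarrow> real" where
  "lex_face s y = (INF n. iterated_face s n y)"

context
  fixes s :: "nat \<Rightarrow> 'a::real_normed_vector"
begin

lemma bdd_below_iterated_face: "bdd_below (range (\<lambda>n. iterated_face s n y))"
  using iterated_face_ge_norm by (intro bdd_belowI2) auto

lemma lex_face_le: "lex_face s y \<le> iterated_face s n y"
  unfolding lex_face_def by (rule cINF_lower[OF bdd_below_iterated_face]) auto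

lemma lex_face_greatest: "(\<And>n. c \<le> iterated_face s n y) \<Longrightarrow> c \<le> lex_face s y"
  unfolding lex_face_def by (rule cINF_greatest) auto

lemma lex_face_tendsto: "(\<lambda>n. iterated_face s n y) \<longlonglongrightarrow> lex_face s y"
  unfolding lex_face_def
  by (rule LIMSEQ_decseq_INF[OF bdd_below_iterated_face])
     (auto simp: decseq_def iterated_face_antimono)

lemma sublinear_lex_face: "sublinear (lex_face s)"
  unfolding sublinear_def
proof (intro conjI allI impI)
  show "lex_face s (x + y) \<le> lex_face s x + lex_face s y" for x y
    by (rule LIMSEQ_le[OF lex_face_tendsto tendsto_add[OF lex_face_tendsto lex_face_tendsto]])
       (use sublinear_add[OF sublinear_iterated_face] in blast)
  show "lex_face s (t *\<^sub>R x) = t * lex_face s x" if "t \<ge> 0" for t x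
    using LIMSEQ_unique[OF lex_face_tendsto[of "t *\<^sub>R x"]]
      tendsto_mult_left[OF lex_face_tendsto[of x], of t]
    by (simp add: sublinear_scaleR[OF sublinear_iterated_face that])
qed

lemma lex_face_le_norm: "lex_face s y \<le> norm y"
  using lex_face_le[of y 0] by simp

lemma lex_face_lipschitz: "\<bar>lex_face s y - lex_face s z\<bar> \<le> norm (y - z)"
  using sublinear_add[OF sublinear_lex_face, of "y - z" z] sublinear_add[OF sublinear_lex_face, of "z - y" y]
    lex_face_le_norm[of "y - z"] lex_face_le_norm[of "z - y"] by (simp add: norm_minus_commute)

text \<open>Stage \<open>Suc n\<close> pushes the value at \<open>- s n\<close> down to minus the
  value at \<open>s n\<close>, and sublinearity leaves no room for a further decrease. So the value
  at \<open>s n\<close> is frozen from stage n on.\<close>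

lemma lex_face_at: "lex_face s (s n) = iterated_face s n (s n)"
  and lex_face_uminus_at: "lex_face s (- s n) = - lex_face s (s n)"
proof -
  have "lex_face s (- s n) \<le> - iterated_face s n (s n)"
    using lex_face_le[of "- s n" "Suc n"] face_support_uminus_le[OF sublinear_iterated_face, of s n "s n"]
    by simp
  with lex_face_le[of "s n" n] sublinear_minus[OF sublinear_lex_face, of "s n"]
  show "lex_face s (s n) = iterated_face s n (s n)" "lex_face s (- s n) = - lex_face s (s n)"
    by linarith+
qed

text \<open>Both signs of \<open>s n\<close> being exact makes addition exact when one summand is a
  member of the sequence. Density and the Lipschitz bound extend this to all vectors, so the nested
  faces have shrunk to one functional.\<close>

lemma linear_lex_face:
  assumes dense: "closure (range s) = UNIV"
  shows "linear (lex_face s)"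
proof -
  let ?L = "lex_face s"
  have cL: "continuous_on UNIV ?L"
    by (rule lipschitz_on_continuous_on[of 1])
       (auto intro!: lipschitz_onI simp: dist_real_def lex_face_lipschitz dist_norm)
  have at: "?L (s n + z) = ?L (s n) + ?L z" for n z
    using sublinear_add[OF sublinear_lex_face, of "s n" z]
      sublinear_add[OF sublinear_lex_face, of "s n + z" "- s n"] lex_face_uminus_at[of n] by simp
  have add: "?L (w + z) = ?L w + ?L z" for w z
  proof -
    have "closed {w. ?L (w + z) = ?L w + ?L z}"
      by (intro closed_Collect_eq continuous_intros continuous_on_compose2[OF cL]) auto
    then have "closure (range s) \<subseteq> {w. ?L (w + z) = ?L w + ?L z}"
      by (intro closure_minimal) (auto simp: at)
    then show ?thesis by (auto simp: dense)
  qed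
  have neg: "?L (- w) = - ?L w" for w
    using add[of w "- w"] sublinear_zero[OF sublinear_lex_face] by simp
  show ?thesis
  proof (rule linearI)
    show "?L (t *\<^sub>R w) = t *\<^sub>R ?L w" for t w
      using sublinear_scaleR[OF sublinear_lex_face, of t w] sublinear_scaleR[OF sublinear_lex_face, of "- t" "- w"]
      by (cases "t \<ge> 0") (auto simp: neg)
  qed (rule add)
qed

end

text \<open>Maximising lexicographically along a dense sequence that starts with \<open>x\<close> and \<open>y\<close> singles out an
  extreme point, which replaces the Hahn-Banach and Krein-Milman theorems.\<close>

lemma ext_duality_set_attains:
  fixes x y :: "'a::real_normed_vector"
  assumes sep: "separable_space (euclidean :: 'a topology)"
    and x: "norm x = 1" and y: "norm y = 1"
    and seg: "closed_segment x y \<subseteq> unit_sphere norm"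
  obtains f where "f \<in> ext (duality_set norm x)" "blinfun_apply f y = 1"
proof -
  obtain C :: "'a set" where C: "countable C" "closure C = UNIV"
    using sep by (auto simp: separable_space_def)
  then have "C \<noteq> {}" by auto
  define d where "d = from_nat_into C"
  have d: "range d = C"
    unfolding d_def by (rule range_from_nat_into[OF \<open>C \<noteq> {}\<close> C(1)])
  define s where "s n = (case n of 0 \<Rightarrow> x | Suc 0 \<Rightarrow> y | Suc (Suc m) \<Rightarrow> d m)" for n
  have "range d \<subseteq> range s"
  proof
    fix z assume "z \<in> range d"
    then obtain m where "z = d m" by auto
    then have "z = s (Suc (Suc m))" by (simp add: s_def)
    then show "z \<in> range s" by blast
  qed
  then have dense: "closure (range s) = UNIV"
    using closure_mono C d by blast
  let ?L = "lex_face s"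
  note lin = linear_lex_face[OF dense]
  have bd: "\<bar>?L z\<bar> \<le> norm z" for z
    using lex_face_lipschitz[of s z 0] sublinear_zero[OF sublinear_lex_face, of s] by simp
  have "bounded_linear ?L"
    using lin bd by (intro bounded_linear_intro[of _ 1]) (auto simp: linear_add linear_scale)
  then obtain f where f: "blinfun_apply f = ?L"
    using bounded_linear_Blinfun_apply by blast
  have fx: "f x = 1"
    using lex_face_at[of s 0] x by (simp add: f s_def)
  \<comment> \<open>Up to the factor \<open>1 + t\<close>, the vector \<open>y + t x\<close> is the
    point of the segment with weight \<open>1 / (1 + t)\<close> at \<open>y\<close>. The segment
    lying in the sphere thus makes the norm additive on it, so that maximising at \<open>x\<close>
    first costs nothing at \<open>y\<close>.\<close>
  have "1 \<le> face_support norm x y"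
  proof (rule face_support_greatest[OF sublinear_norm])
    fix t :: real assume t: "t \<ge> 0"
    have "(1 - 1 / (1 + t)) *\<^sub>R x + (1 / (1 + t)) *\<^sub>R y \<in> closed_segment x y"
      using t by (auto simp: in_segment intro!: exI[of _ "1 / (1 + t)"])
    with seg have "norm ((1 - 1 / (1 + t)) *\<^sub>R x + (1 / (1 + t)) *\<^sub>R y) = 1"
      by (auto simp: unit_sphere_def)
    moreover have "y + t *\<^sub>R x = (1 + t) *\<^sub>R ((1 - 1 / (1 + t)) *\<^sub>R x + (1 / (1 + t)) *\<^sub>R y)"
    proof -
      have "(1 + t) * (1 - 1 / (1 + t)) = t" "(1 + t) * (1 / (1 + t)) = 1"
        using t by (simp_all add: field_simps)
      then show ?thesis
        by (simp only: scaleR_add_right scaleR_scaleR) simp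
    qed
    ultimately have "norm (y + t *\<^sub>R x) = 1 + t"
      using t by (simp del: scaleR_add_right)
    then show "1 \<le> norm (y + t *\<^sub>R x) - t * norm x" by (simp add: x)
  qed
  then have fy: "f y = 1"
    using lex_face_at[of s 1] lex_face_le_norm[of s y] y by (simp add: f s_def)
  have "norm f \<le> 1"
    using bd by (intro norm_blinfun_bound) (auto simp: f)
  moreover have "1 \<le> norm f"
    using norm_blinfun[of f x] fx x by simp
  ultimately have f_mem: "f \<in> duality_set norm x"
    by (simp add: duality_set_def dual_norm_norm fx)
  have "f \<notin> open_segment g h" if g: "g \<in> duality_set norm x" and h: "h \<in> duality_set norm x" for g h
  proof
    assume "f \<in> open_segment g h"
    then obtain u where u: "g \<noteq> h" "0 < u" "u < 1" "f = (1 - u) *\<^sub>R g + u *\<^sub>R h"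
      by (auto simp: in_segment)
    have fu: "f z = (1 - u) * g z + u * h z" for z
      by (simp add: u(4) blinfun.bilinear_simps)
    \<comment> \<open>A proper convex combination attains the maximum over a face only if both ends
      do. Hence \<open>g\<close> and \<open>h\<close> pass every stage together with
      \<open>f\<close>.\<close>
    have le: "\<forall>z. g z \<le> iterated_face s n z \<and> h z \<le> iterated_face s n z" for n
    proof (induction n)
      case 0
      have "k z \<le> norm z" if "norm k = 1" for k :: "'a \<Rightarrow>\<^sub>L real" and z
        using norm_blinfun[of k z] that by simp
      then show ?case using g h by (simp add: duality_set_def dual_norm_norm)
    next
      case (Suc n)
      let ?p = "iterated_face s n (s n)"
      have "(1 - u) * (?p - g (s n)) + u * (?p - h (s n)) = 0"
        using lex_face_at[of s n] fu[of "s n"] by (simp add: f algebra_simps)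
      moreover have "(1 - u) * (?p - g (s n)) \<ge> 0" "u * (?p - h (s n)) \<ge> 0"
        using Suc u(2,3) by simp_all
      ultimately have "g (s n) = ?p" "h (s n) = ?p"
        using u(2,3) by (smt (verit) mult_eq_0_iff)+
      then show ?case
        using Suc by (auto intro!: linear_le_face_support sublinear_iterated_face
            simp: linear_iff blinfun.bilinear_simps)
    qed
    \<comment> \<open>Domination by a linear functional is equality, as both signs of the argument
      may be inserted.\<close>
    have eq: "k = f" if "\<And>z. k z \<le> f z" for k :: "'a \<Rightarrow>\<^sub>L real"
    proof (rule blinfun_eqI)
      show "k z = f z" for z
        using that[of z] that[of "- z"] by (simp add: blinfun.bilinear_simps)
    qed
    have "g z \<le> f z" "h z \<le> f z" for z
      unfolding f using le by (intro lex_face_greatest; simp)+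
    then show False using eq u(1) by metis
  qed
  with f_mem have "f \<in> ext (duality_set norm x)"
    by (auto simp: ext_def extreme_point_of_def)
  with fy that show thesis by blast
qed

lemma countable_boundary:
  assumes sep: "separable_space (euclidean :: 'a::real_normed_vector topology)"
    and VI: "VI_polyhedral (norm :: 'a::real_normed_vector \<Rightarrow> real)"
    and Delta: "property_Delta (norm :: 'a::real_normed_vector \<Rightarrow> real)"
  obtains f :: "nat \<Rightarrow> 'a::real_normed_vector \<Rightarrow>\<^sub>L real"
  where "\<And>n x. \<bar>f n x\<bar> \<le> norm x" "\<And>x. \<exists>n. \<bar>f n x\<bar> = norm x"
proof -
  let ?S = "unit_sphere (norm :: 'a \<Rightarrow> real)"
  obtain V where V: "\<And>x. x \<in> ?S \<Longrightarrow> open (V x) \<and> x \<in> V x \<and>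
        (\<forall>y \<in> V x \<inter> ?S. closed_segment x y \<subseteq> ?S)"
    using VI unfolding VI_polyhedral_def by metis
  obtain C :: "'a set" where C: "countable C" "closure C = UNIV"
    using sep by (auto simp: separable_space_def)
  \<comment> \<open>Instead of the Lindelof theorem: among the countably many balls with centre in a
    dense set and radius \<open>1 / (k + 1)\<close>, those inside some \<open>V x\<close> are kept,
    with one point \<open>x\<close> chosen for each.\<close>
  define I where "I = {(c, k) \<in> C \<times> (UNIV :: nat set). \<exists>x\<in>?S. ball c (1 / real (Suc k)) \<subseteq> V x}"
  have "countable I"
    by (rule countable_subset[of _ "C \<times> UNIV"]) (auto simp: I_def C)
  have "\<forall>i\<in>I. \<exists>x. x \<in> ?S \<and> ball (fst i) (1 / real (Suc (snd i))) \<subseteq> V x"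
    by (auto simp: I_def)
  then obtain \<xi> where \<xi>: "\<And>i. i \<in> I \<Longrightarrow> \<xi> i \<in> ?S \<and> ball (fst i) (1 / real (Suc (snd i))) \<subseteq> V (\<xi> i)"
    by metis
  define X where "X = \<xi> ` I"
  have X: "countable X" "X \<subseteq> ?S"
    using \<xi> \<open>countable I\<close> by (auto simp: X_def)
  have cover: "\<exists>x\<in>X. y \<in> V x" if y: "y \<in> ?S" for y
  proof -
    obtain e where e: "e > 0" "ball y e \<subseteq> V y"
      using V[OF y] by (auto simp: open_contains_ball)
    obtain k where k: "1 / real (Suc k) < e / 2"
      using nat_approx_posE[of "e / 2"] e by auto
    obtain c where c: "c \<in> C" "dist c y < 1 / real (Suc k)"
      using C(2) closure_approachable[of y C]
      by (metis UNIV_I of_nat_0_less_iff zero_less_Suc zero_less_divide_1_iff)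
    have "ball c (1 / real (Suc k)) \<subseteq> ball y e"
    proof
      fix z assume "z \<in> ball c (1 / real (Suc k))"
      then show "z \<in> ball y e"
        using dist_triangle[of y z c] c(2) k by (simp add: dist_commute)
    qed
    with e have "ball c (1 / real (Suc k)) \<subseteq> V y" by auto
    with c y have I: "(c, k) \<in> I" by (auto simp: I_def)
    have "y \<in> ball c (1 / real (Suc k))"
      using c(2) by simp
    then have "y \<in> V (\<xi> (c, k))"
      using \<xi>[OF I] by auto
    then show ?thesis
      using I by (auto simp: X_def)
  qed
  \<comment> \<open>Inserting 0 makes the set non-empty, hence enumerable by a total sequence, even
    when there are no unit vectors at all.\<close>
  define B where "B = insert 0 (\<Union>x\<in>X. ext (duality_set norm x))"
  have "countable B"
    using Delta X(2) unfolding B_def property_Delta_def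
    by (intro countable_insert countable_UN[OF X(1)] countable_finite) auto
  define f where "f = from_nat_into B"
  have f: "range f = B"
    unfolding f_def by (rule range_from_nat_into[OF _ \<open>countable B\<close>]) (simp add: B_def)
  show thesis
  proof
    fix n x
    have "f n \<in> B" using f by auto
    then have "norm (f n) \<le> 1"
      by (auto simp: B_def ext_def extreme_point_of_def duality_set_def dual_norm_norm)
    then show "\<bar>f n x\<bar> \<le> norm x"
      using norm_blinfun[of "f n" x] mult_right_mono[of "norm (f n)" 1 "norm x"] by simp
  next
    fix x :: 'a
    show "\<exists>n. \<bar>f n x\<bar> = norm x"
    proof (cases "x = 0")
      case False
      define y where "y = x /\<^sub>R norm x"
      have y: "norm y = 1" "x = norm x *\<^sub>R y" using False by (simp_all add: y_def)
      then obtain z where z: "z \<in> X" "y \<in> V z"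
        using cover by (auto simp: unit_sphere_def)
      moreover have "norm z = 1" using z X by (auto simp: unit_sphere_def)
      moreover have "closed_segment z y \<subseteq> ?S"
        using V[of z] z y X by (auto simp: unit_sphere_def)
      ultimately obtain g where "g \<in> ext (duality_set norm z)" "g y = 1"
        using ext_duality_set_attains[OF sep, of z y] y by blast
      moreover then have "g \<in> range f" using z by (auto simp: f B_def)
      ultimately obtain n where "f n y = 1" by auto
      then have "f n x = norm x" by (subst y(2)) (simp add: blinfun.scaleR_right)
      then show ?thesis by (intro exI[of _ n]) simp
    qed (simp add: blinfun.bilinear_simps)
  qed
qed

section \<open>(IV)-polyhedral norms\<close>

text \<open>Helly's theorem on the line. Inserting 0 provides the supremum for an empty
  \<open>L\<close> and the lower bound at the same time.\<close>

lemma ex_between_bounds: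
  fixes L U :: "real set"
  assumes "\<And>l u. l \<in> L \<Longrightarrow> u \<in> U \<Longrightarrow> l \<le> u" "\<And>l. l \<in> L \<Longrightarrow> l \<le> 1" "\<And>u. u \<in> U \<Longrightarrow> 0 \<le> u"
  obtains c where "0 \<le> c" "c \<le> 1" "\<And>l. l \<in> L \<Longrightarrow> l \<le> c" "\<And>u. u \<in> U \<Longrightarrow> c \<le> u"
proof
  let ?c = "Sup (insert 0 L)"
  have bdd: "bdd_above (insert 0 L)"
    using assms(2) by (intro bdd_aboveI[of _ 1]) auto
  show "0 \<le> ?c" by (rule cSup_upper[OF _ bdd]) auto
  show "?c \<le> 1" by (rule cSup_least) (use assms in auto)
  show "l \<le> ?c" if "l \<in> L" for l by (rule cSup_upper[OF _ bdd]) (use that in auto)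
  show "?c \<le> u" if "u \<in> U" for u by (rule cSup_least) (use assms that in auto)
qed

text \<open>The conditions on \<open>c\<close> given by the single \<open>x\<close> are affine and, by sublinearity, pairwise
  compatible in \<open>[0, 1]\<close>, hence have a common solution there.\<close>

lemma le_max_imp_le_convex_combination:
  fixes h g q :: "'a::real_vector \<Rightarrow> real"
  assumes h: "linear h" and g: "linear g" and q: "sublinear q"
    and le: "\<And>x. h x \<le> max (g x) (q x)"
  obtains c where "0 \<le> c" "c \<le> 1" "\<And>x. h x - c * g x \<le> (1 - c) * q x"
proof -
  \<comment> \<open>The required inequality reads \<open>h x - q x \<le> c * (g x - q x)\<close>;
    dividing by the difference bounds \<open>c\<close> from above or from below according to its
    sign.\<close>
  define U where "U = (\<lambda>x. (q x - h x) / (q x - g x)) ` {x. g x < q x}"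
  define L where "L = (\<lambda>x. (h x - q x) / (g x - q x)) ` {x. q x < g x}"
  have "l \<le> u" if lL: "l \<in> L" and uU: "u \<in> U" for l u
  proof -
    obtain y where y: "q y < g y" "l = (h y - q y) / (g y - q y)" using lL by (auto simp: L_def)
    obtain x where x: "g x < q x" "u = (q x - h x) / (q x - g x)" using uU by (auto simp: U_def)
    \<comment> \<open>With these weights \<open>g\<close> and the sum of the values of
      \<open>q\<close> coincide at \<open>s x + t y\<close>, so sublinearity gives
      \<open>q \<le> g\<close> there and the hypothesis reduces to \<open>h \<le> g\<close>.\<close>
    define s t where "s = g y - q y" and "t = q x - g x"
    have st: "s > 0" "t > 0" using x y by (auto simp: s_def t_def)
    have "q (s *\<^sub>R x + t *\<^sub>R y) \<le> s * q x + t * q y"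
      using sublinear_add[OF q, of "s *\<^sub>R x" "t *\<^sub>R y"] st by (simp add: sublinear_scaleR[OF q])
    also have "\<dots> = s * g x + t * g y"
      by (simp add: s_def t_def algebra_simps)
    finally have "h (s *\<^sub>R x + t *\<^sub>R y) \<le> g (s *\<^sub>R x + t *\<^sub>R y)"
      using le[of "s *\<^sub>R x + t *\<^sub>R y"] by (simp add: linear_add[OF g] linear_scale[OF g])
    then have "s * h x + t * h y \<le> s * g x + t * g y"
      by (simp add: linear_add[OF g] linear_scale[OF g] linear_add[OF h] linear_scale[OF h])
    moreover have "s * g x + t * g y = s * q x + t * q y"
      by (simp add: s_def t_def algebra_simps)
    ultimately have "(h y - q y) * t \<le> (q x - h x) * s"
      by (simp add: algebra_simps)
    then show ?thesis
      unfolding x(2) y(2) s_def[symmetric] t_def[symmetric] using st by (simp add: field_simps)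
  qed
  moreover have "l \<le> 1" if lL: "l \<in> L" for l
  proof -
    obtain y where y: "q y < g y" "l = (h y - q y) / (g y - q y)" using lL by (auto simp: L_def)
    then show ?thesis using le[of y] by simp
  qed
  moreover have "0 \<le> u" if uU: "u \<in> U" for u
  proof -
    obtain x where x: "g x < q x" "u = (q x - h x) / (q x - g x)" using uU by (auto simp: U_def)
    then show ?thesis using le[of x] by simp
  qed
  ultimately obtain c where c: "0 \<le> c" "c \<le> 1" "\<And>l. l \<in> L \<Longrightarrow> l \<le> c" "\<And>u. u \<in> U \<Longrightarrow> c \<le> u"
    using ex_between_bounds[of L U] by blast
  show thesis
  proof (rule that[OF c(1,2)])
    fix x
    consider "g x < q x" | "q x < g x" | "q x = g x" by linarith
    then show "h x - c * g x \<le> (1 - c) * q x"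
    proof cases
      case 1
      then have "c \<le> (q x - h x) / (q x - g x)"
        by (intro c(4)) (auto simp: U_def)
      with 1 show ?thesis by (simp add: field_simps)
    next
      case 2
      then have "(h x - q x) / (g x - q x) \<le> c"
        by (intro c(3)) (auto simp: L_def)
      with 2 show ?thesis by (simp add: field_simps)
    next
      case 3
      then show ?thesis using le[of x] by (simp add: field_simps)
    qed
  qed
qed

text \<open>For \<open>0 < c < 1\<close> the functional \<open>h\<close> is a convex combination of
  \<open>g\<close> and some \<open>k\<close> below \<open>q\<close>, both in \<open>C\<close>, and
  extremality makes them equal. This removes one functional at a time from a maximum, in place of
  Milman's theorem and weak-star compactness.\<close>

lemma extreme_point_le_max:
  fixes h g :: "'a::real_normed_vector \<Rightarrow>\<^sub>L real"
  assumes h: "h extreme_point_of C" and C: "C = {k. \<forall>x. blinfun_apply k x \<le> N x}"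
    and g: "g \<in> C" and q: "sublinear q" "\<And>x. q x \<le> N x"
    and le: "\<And>x. h x \<le> max (g x) (q x)"
  shows "h = g \<or> (\<forall>x. h x \<le> q x)"
proof -
  have lin: "linear (blinfun_apply k)" for k :: "'a \<Rightarrow>\<^sub>L real"
    by (simp add: linear_iff blinfun.bilinear_simps)
  obtain c where c: "0 \<le> c" "c \<le> 1" "\<And>x. h x - c * g x \<le> (1 - c) * q x"
    using le_max_imp_le_convex_combination[OF lin lin q(1) le] by blast
  consider "c = 0" | "c = 1" | "0 < c" "c < 1" using c by linarith
  then show ?thesis
  proof cases
    case 1
    then show ?thesis using c by simp
  next
    case 2
    then have "h x \<le> g x" for x using c(3)[of x] by simp
    from this this[of "- x" for x] have "h = g"
      by (intro blinfun_eqI antisym) (simp_all add: blinfun.bilinear_simps)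
    then show ?thesis ..
  next
    case 3
    define k where "k = (1 / (1 - c)) *\<^sub>R (h - c *\<^sub>R g)"
    have "k x = (h x - c * g x) / (1 - c)" for x
      by (simp add: k_def blinfun.bilinear_simps)
    then have k: "k x \<le> q x" for x
      using c(3)[of x] 3 by (simp add: pos_divide_le_eq mult.commute)
    have "k \<in> C" using k q(2) order_trans unfolding C by blast
    then have "h \<notin> open_segment k g" using h g by (auto simp: extreme_point_of_def)
    moreover have hk: "h = (1 - c) *\<^sub>R k + c *\<^sub>R g" using 3 by (simp add: k_def)
    ultimately have "k = g" using 3 by (auto simp: in_segment)
    with hk have "h = k" by (simp flip: scaleR_add_left)
    then show ?thesis using k by simp
  qed
qed

lemma dual_ball_eq:
  assumes "equivalent_norm N"
  shows "dual_ball N = {k. \<forall>x. blinfun_apply k x \<le> N x}"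
proof -
  obtain c where c: "c > 0" "\<And>x. c * norm x \<le> N x"
    and N: "\<And>a x. N (a *\<^sub>R x) = \<bar>a\<bar> * N x" "\<And>x. N x = 0 \<longleftrightarrow> x = 0"
    using assms unfolding equivalent_norm_def by blast
  have N_ge: "N x \<ge> 0" for x
    using c(2)[of x] c(1) by (smt (verit) mult_nonneg_nonneg norm_ge_zero)
  have "dual_norm N k \<le> 1 \<longleftrightarrow> (\<forall>x. k x \<le> N x)" for k
  proof
    assume le: "dual_norm N k \<le> 1"
    have bdd: "bdd_above ((\<lambda>x. \<bar>k x\<bar>) ` {x. N x \<le> 1})"
    proof (rule bdd_aboveI2)
      fix x assume "x \<in> {x. N x \<le> 1}"
      then have "norm x \<le> 1 / c" using c(1) c(2)[of x] by (simp add: field_simps)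
      then show "\<bar>k x\<bar> \<le> norm k * (1 / c)"
        using norm_blinfun[of k x] mult_left_mono[of "norm x" "1 / c" "norm k"] by simp
    qed
    show "\<forall>x. k x \<le> N x"
    proof
      fix x
      show "k x \<le> N x"
      proof (cases "x = 0")
        case False
        then have pos: "N x > 0" using N(2) N_ge[of x] by (metis less_eq_real_def)
        have "\<bar>k ((1 / N x) *\<^sub>R x)\<bar> \<le> dual_norm N k"
          unfolding dual_norm_def using pos
          by (intro cSUP_upper[OF _ bdd]) (simp add: N(1))
        then have "\<bar>k x\<bar> \<le> N x * dual_norm N k"
          using pos by (simp add: blinfun.bilinear_simps abs_mult field_simps)
        also have "\<dots> \<le> N x * 1"
          using le pos by (intro mult_left_mono) auto
        finally show ?thesis by simp
      qed (simp add: blinfun.bilinear_simps N_ge)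
    qed
  next
    assume le: "\<forall>x. k x \<le> N x"
    have "\<bar>k x\<bar> \<le> 1" if "N x \<le> 1" for x
      using le[rule_format, of x] le[rule_format, of "- x"] N(1)[of "-1" x] that
      by (simp add: blinfun.bilinear_simps abs_le_iff)
    moreover have "{x. N x \<le> 1} \<noteq> {}"
      using N(2)[of 0] by (metis (mono_tags) empty_iff mem_Collect_eq zero_le_one)
    ultimately show "dual_norm N k \<le> 1"
      unfolding dual_norm_def by (intro cSUP_least) simp_all
  qed
  then show ?thesis by (simp add: dual_ball_def)
qed

section \<open>The weighted functionals and their tail norms\<close>

locale boundary =
  fixes f :: "nat \<Rightarrow> 'a::real_normed_vector \<Rightarrow>\<^sub>L real" and \<delta> :: real
  assumes f_le: "\<bar>f n x\<bar> \<le> norm x" and f_attains: "\<exists>n. \<bar>f n x\<bar> = norm x"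
    and \<delta>_pos: "\<delta> > 0"
begin

text \<open>The start \<open>\<delta>\<close> of this decreasing sequence bounds the distortion of
  the norm; its limit 0 keeps the late functionals close to the original dual ball.\<close>

definition e :: "nat \<Rightarrow> real" where "e n = \<delta> / real (Suc n)"

definition g :: "nat \<Rightarrow> 'a \<Rightarrow>\<^sub>L real" where "g n = (1 + e n) *\<^sub>R f n"

lemma e_pos: "e n > 0"
  using \<delta>_pos by (simp add: e_def)

lemma e_antimono: "m \<le> n \<Longrightarrow> e n \<le> e m"
  using \<delta>_pos by (simp add: e_def field_simps)

lemma e_le: "e n \<le> \<delta>"
  using e_antimono[of 0 n] by (simp add: e_def)

lemma e_tendsto_0: "e \<longlonglongrightarrow> 0"
  unfolding e_def using LIMSEQ_Suc[OF lim_const_over_n[of \<delta>]] by simp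

lemma abs_g: "\<bar>g n x\<bar> = (1 + e n) * \<bar>f n x\<bar>"
  using e_pos[of n] by (simp add: g_def blinfun.bilinear_simps abs_mult)

lemma abs_g_le: "\<bar>g n x\<bar> \<le> (1 + e n) * norm x"
  using f_le[of n x] e_pos[of n] by (simp add: abs_g)

lemma abs_g_le_bound: "\<bar>g n x\<bar> \<le> (1 + \<delta>) * norm x"
  using abs_g_le[of n x] mult_right_mono[of "1 + e n" "1 + \<delta>" "norm x"] e_le[of n] by simp

lemma g_attains:
  obtains n where "\<bar>g n x\<bar> = (1 + e n) * norm x"
  using f_attains[of x] abs_g by metis

text \<open>Index 0 gives the new norm itself; larger \<open>m\<close> bound what is left of the
  extreme points once the first \<open>m\<close> functionals and their negatives are
  discarded.\<close>

definition tail_norm :: "nat \<Rightarrow> 'a \<Rightarrow> real" where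
  "tail_norm m x = (SUP n. \<bar>g (m + n) x\<bar>)"

lemma tail_norm_upper: "\<bar>g (m + n) x\<bar> \<le> tail_norm m x"
  unfolding tail_norm_def using abs_g_le_bound
  by (intro cSUP_upper bdd_aboveI2[of _ _ "(1 + \<delta>) * norm x"]) auto

lemma tail_norm_least: "(\<And>n. \<bar>g (m + n) x\<bar> \<le> c) \<Longrightarrow> tail_norm m x \<le> c"
  unfolding tail_norm_def by (rule cSUP_least) auto

lemma tail_norm_le: "tail_norm m x \<le> (1 + e m) * norm x"
proof (rule tail_norm_least)
  show "\<bar>g (m + n) x\<bar> \<le> (1 + e m) * norm x" for n
    using abs_g_le[of "m + n" x] mult_right_mono[of "1 + e (m + n)" "1 + e m" "norm x"]
      e_antimono[of m "m + n"] by simp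
qed

lemma tail_norm_le_zero: "tail_norm m x \<le> tail_norm 0 x"
  by (rule tail_norm_least) (metis add_0 tail_norm_upper)

text \<open>The two signs are listed separately because \<open>extreme_point_le_max\<close> removes
  a single linear functional.\<close>

lemma tail_norm_le_max: "tail_norm m x \<le> max (g m x) (max (- g m x) (tail_norm (Suc m) x))"
proof (rule tail_norm_least)
  show "\<bar>g (m + n) x\<bar> \<le> max (g m x) (max (- g m x) (tail_norm (Suc m) x))" for n
    using tail_norm_upper[of "Suc m" "n - 1" x] by (cases n) auto
qed

lemma tail_norm_scaleR: "tail_norm m (a *\<^sub>R x) = \<bar>a\<bar> * tail_norm m x"
proof -
  have le: "tail_norm m (a *\<^sub>R x) \<le> \<bar>a\<bar> * tail_norm m x" for a x
    by (rule tail_norm_least)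
       (simp add: blinfun.bilinear_simps abs_mult mult_left_mono tail_norm_upper)
  show ?thesis
  proof (cases "a = 0")
    case True
    then show ?thesis using le[of 0 x] tail_norm_upper[of m 0 0] by (simp add: blinfun.bilinear_simps)
  next
    case False
    then show ?thesis using le[of a x] le[of "inverse a" "a *\<^sub>R x"] by (simp add: abs_mult field_simps)
  qed
qed

lemma sublinear_tail_norm: "sublinear (tail_norm m)"
  unfolding sublinear_def
proof (intro conjI allI impI)
  show "tail_norm m (x + y) \<le> tail_norm m x + tail_norm m y" for x y
  proof (rule tail_norm_least)
    show "\<bar>g (m + n) (x + y)\<bar> \<le> tail_norm m x + tail_norm m y" for n
      using tail_norm_upper[of m n x] tail_norm_upper[of m n y]
      by (simp add: blinfun.bilinear_simps)
  qed
qed (simp add: tail_norm_scaleR)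

lemma norm_less_tail_norm: "x \<noteq> 0 \<Longrightarrow> norm x < tail_norm 0 x"
proof -
  assume x: "x \<noteq> 0"
  obtain n where "\<bar>g n x\<bar> = (1 + e n) * norm x" by (rule g_attains)
  with tail_norm_upper[of 0 n x] have "(1 + e n) * norm x \<le> tail_norm 0 x" by simp
  moreover have "e n * norm x > 0" using x e_pos by simp
  ultimately show ?thesis by (simp add: algebra_simps)
qed

lemma norm_le_tail_norm: "norm x \<le> tail_norm 0 x"
  using norm_less_tail_norm[of x] tail_norm_upper[of 0 0 0]
  by (cases "x = 0") (auto simp: blinfun.bilinear_simps)

lemma equivalent_norm_tail_norm: "equivalent_norm (tail_norm 0)"
  unfolding equivalent_norm_def
proof (intro conjI allI)
  show "tail_norm 0 x = 0 \<longleftrightarrow> x = 0" for x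
    using norm_less_tail_norm[of x] norm_ge_zero[of x] tail_norm_scaleR[of 0 0 x] by fastforce
  show "\<exists>c>0. \<exists>C>0. \<forall>x. c * norm x \<le> tail_norm 0 x \<and> tail_norm 0 x \<le> C * norm x"
    using norm_le_tail_norm tail_norm_le[of 0] e_pos[of 0]
    by (intro exI[of _ 1] exI[of _ "1 + e 0"] conjI) auto
qed (auto simp: tail_norm_scaleR sublinear_add[OF sublinear_tail_norm])

text \<open>Each index is peeled off in two rounds, \<open>g m\<close> and then
  \<open>- g m\<close>. An extreme point different from both must lie below what remains, the next
  tail.\<close>

lemma ext_dual_ball_tail_norm:
  assumes "h \<in> ext (dual_ball (tail_norm 0))" "\<And>n. n < m \<Longrightarrow> h \<noteq> g n \<and> h \<noteq> - g n"
  shows "h x \<le> tail_norm m x"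
  using assms(2)
proof (induction m arbitrary: x)
  case 0
  then show ?case
    using assms(1) by (auto simp: ext_def extreme_point_of_def dual_ball_eq[OF equivalent_norm_tail_norm])
next
  case (Suc m)
  let ?C = "{k. \<forall>x. blinfun_apply k x \<le> tail_norm 0 x}"
  have h: "h extreme_point_of ?C"
    using assms(1) by (simp add: ext_def dual_ball_eq[OF equivalent_norm_tail_norm])
  have g_abs: "\<bar>g m x\<bar> \<le> tail_norm 0 x" for x
    using tail_norm_upper[of 0 m x] by simp
  then have g: "g m \<in> ?C" "- g m \<in> ?C"
    by (auto simp: blinfun.bilinear_simps abs_le_iff)
  \<comment> \<open>In the first round the negative functional is kept inside the sublinear
    remainder.\<close>
  let ?q = "\<lambda>x. max (- g m x) (tail_norm (Suc m) x)"
  have q: "sublinear ?q"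
    unfolding sublinear_def
  proof (intro conjI allI impI)
    show "?q (x + y) \<le> ?q x + ?q y" for x y
      using sublinear_add[OF sublinear_tail_norm, of "Suc m" x y]
      unfolding blinfun.add_right by linarith
    show "?q (t *\<^sub>R x) = t * ?q x" if "0 \<le> t" for t x
      using that by (simp add: blinfun.bilinear_simps tail_norm_scaleR max_mult_distrib_left)
  qed
  have "h x \<le> max (g m x) (?q x)" for x
    using Suc.IH[of x] Suc.prems tail_norm_le_max[of m x] by force
  moreover have "?q x \<le> tail_norm 0 x" for x
    using g_abs[of x] tail_norm_le_zero[of "Suc m" x] by auto
  ultimately have "\<forall>x. h x \<le> ?q x"
    using extreme_point_le_max[OF h refl g(1) q] Suc.prems by blast
  then have "h x \<le> max ((- g m) x) (tail_norm (Suc m) x)" for x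
    by (simp add: blinfun.bilinear_simps)
  then show ?case
    using extreme_point_le_max[OF h refl g(2) sublinear_tail_norm tail_norm_le_zero, of "Suc m"] Suc.prems
    by blast
qed

lemma IV_polyhedral_tail_norm: "IV_polyhedral (tail_norm 0)"
  unfolding IV_polyhedral_def
proof (intro ballI)
  fix x and k :: "'a \<Rightarrow>\<^sub>L real"
  let ?T = "strong_operator_topology :: ('a \<Rightarrow>\<^sub>L real) topology"
  assume x: "x \<in> unit_sphere (tail_norm 0)"
    and k: "k \<in> ?T derived_set_of ext (dual_ball (tail_norm 0))"
  have eval_open: "openin ?T {h. blinfun_apply h z \<in> W}" if "open W" for z W
    using openin_continuous_map_preimage[OF strong_operator_topology_continuous_evaluation[of z], of W] that
    by (simp add: strong_operator_topology_topspace)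
  \<comment> \<open>Points are closed for pointwise convergence, so finitely many functionals may be
    cut out of a neighbourhood of \<open>k\<close>.\<close>
  have ne_open: "openin ?T {h. h \<noteq> h'}" for h'
  proof -
    have "{h. h \<noteq> h'} = (\<Union>z. {h. blinfun_apply h z \<in> - {blinfun_apply h' z}})"
      by (simp add: set_eq_iff) (metis blinfun_eqI)
    also have "openin ?T \<dots>"
    proof (rule openin_Union)
      fix W assume "W \<in> range (\<lambda>z. {h. blinfun_apply h z \<in> - {blinfun_apply h' z}})"
      then obtain z where "W = {h. blinfun_apply h z \<in> - {blinfun_apply h' z}}" by blast
      then show "openin ?T W" using eval_open[of "- {h' z}" z] by (simp add: open_Compl)
    qed
    finally show ?thesis .
  qed
  have cofinite_open: "openin ?T (- F)" if "finite F" for F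
    using that
  proof induction
    case empty
    show ?case using openin_topspace[of ?T] by (simp add: strong_operator_topology_topspace)
  next
    case (insert h' F)
    have "- insert h' F = {h. h \<noteq> h'} \<inter> - F" by auto
    then show ?case using ne_open insert by (simp add: openin_Int)
  qed
  have "k x \<le> (1 + e m) * norm x" for m
  proof (rule field_le_epsilon)
    fix \<eta> :: real assume "\<eta> > 0"
    \<comment> \<open>The point \<open>k\<close> is spared, as it must stay in its own
      neighbourhood; if it is one of the discarded functionals, \<open>h \<noteq> k\<close> takes
      care of it.\<close>
    define F where "F = ((g ` {..<m} \<union> (\<lambda>n. - g n) ` {..<m}) - {k})"
    define O' where "O' = {h. blinfun_apply h x \<in> {k x - \<eta><..}} \<inter> - F"
    have "openin ?T O'"
      unfolding O'_def by (intro openin_Int eval_open cofinite_open) (auto simp: F_def)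
    moreover have "k \<in> O'"
      using \<open>\<eta> > 0\<close> by (auto simp: O'_def F_def)
    ultimately obtain h where h: "h \<noteq> k" "h \<in> ext (dual_ball (tail_norm 0))" "h \<in> O'"
      using k unfolding in_derived_set_of by blast
    have "h \<notin> F" using h(3) by (auto simp: O'_def)
    then have "h x \<le> tail_norm m x"
      using h(1) by (intro ext_dual_ball_tail_norm[OF h(2)]) (auto simp: F_def)
    moreover have "k x - \<eta> < h x" using h(3) by (simp add: O'_def)
    ultimately show "k x \<le> (1 + e m) * norm x + \<eta>" using tail_norm_le[of m x] by simp
  qed
  moreover have "(\<lambda>m. (1 + e m) * norm x) \<longlonglongrightarrow> (1 + 0) * norm x"
    by (intro tendsto_intros e_tendsto_0)
  ultimately have "k x \<le> norm x"
    by (intro LIMSEQ_le_const) auto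
  also have "\<dots> < 1"
  proof -
    have "x \<noteq> 0" using x norm_le_tail_norm[of 0] tail_norm_le[of 0 0] by (auto simp: unit_sphere_def)
    then show ?thesis using norm_less_tail_norm[of x] x by (simp add: unit_sphere_def)
  qed
  finally show "k x < 1" .
qed

end

section \<open>Functions with derivatives of all orders\<close>

text \<open>The functions generated from \<open>S\<close> are closed under partial derivatives with respect to a fixed
  finite set \<open>F\<close> of functionals, once those of the members of \<open>S\<close> belong to them.\<close>

inductive generated ::
  "'a set \<Rightarrow> ('a::real_normed_vector \<Rightarrow>\<^sub>L real) set \<Rightarrow> ('a \<Rightarrow> real) set \<Rightarrow> ('a \<Rightarrow> real) \<Rightarrow> bool"
  for U F S where
  base: "s \<in> S \<Longrightarrow> generated U F S s"
| const: "generated U F S (\<lambda>x. c)"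
| functional: "l \<in> F \<Longrightarrow> generated U F S (blinfun_apply l)"
| add: "generated U F S u \<Longrightarrow> generated U F S v \<Longrightarrow> generated U F S (\<lambda>x. u x + v x)"
| mult: "generated U F S u \<Longrightarrow> generated U F S v \<Longrightarrow> generated U F S (\<lambda>x. u x * v x)"
| inverse: "generated U F S u \<Longrightarrow> (\<And>x. x \<in> U \<Longrightarrow> u x \<noteq> 0) \<Longrightarrow> generated U F S (\<lambda>x. inverse (u x))"
| smooth: "generated U F S u \<Longrightarrow> (\<And>k t. (\<phi> k has_real_derivative \<phi> (Suc k) t) (at t)) \<Longrightarrow>
    generated U F S (\<lambda>x. \<phi> k (u x))"

lemma generated_sum:
  "(\<And>i. i \<in> I \<Longrightarrow> generated U F S (u i)) \<Longrightarrow> generated U F S (\<lambda>x. \<Sum>i\<in>I. u i x)"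
  by (induction I rule: infinite_finite_induct) (auto intro: generated.intros)

text \<open>The sum, product, reciprocal and chain rules produce coefficients built by the same
  rules; for \<open>smooth\<close> it matters that the whole sequence \<open>\<phi>\<close> of
  successive derivatives is given. The coefficients need not be unique, since \<open>F\<close> may
  be linearly dependent.\<close>

lemma generated_partial_derivatives:
  assumes fin: "finite F"
    and base: "\<And>s. s \<in> S \<Longrightarrow> \<exists>c. (\<forall>l\<in>F. generated U F S (c l)) \<and>
       (\<forall>x\<in>U. (s has_derivative (\<lambda>h. \<Sum>l\<in>F. c l x * blinfun_apply l h)) (at x))"
    and u: "generated U F S u"
  shows "\<exists>c. (\<forall>l\<in>F. generated U F S (c l)) \<and>
    (\<forall>x\<in>U. (u has_derivative (\<lambda>h. \<Sum>l\<in>F. c l x * blinfun_apply l h)) (at x))"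
  using u
proof induction
  case (base s)
  then show ?case by (rule assms(2))
next
  case (const a)
  show ?case
    by (rule exI[of _ "\<lambda>l x. 0"]) (auto intro!: generated.const)
next
  case (functional l)
  have "(\<Sum>l'\<in>F. (if l' = l then 1 else 0) * blinfun_apply l' h) = l h" for h
    using functional fin by (simp add: if_distrib[of "\<lambda>t. t * _"] sum.delta cong: if_cong)
  then show ?case
    by (intro exI[of _ "\<lambda>l' x. if l' = l then 1 else 0"])
       (auto intro!: generated.const bounded_linear_imp_has_derivative blinfun.bounded_linear_right)
next
  case (add u v)
  then obtain c d where
    c: "\<forall>l\<in>F. generated U F S (c l)" "\<forall>x\<in>U. (u has_derivative (\<lambda>h. \<Sum>l\<in>F. c l x * blinfun_apply l h)) (at x)" and
    d: "\<forall>l\<in>F. generated U F S (d l)" "\<forall>x\<in>U. (v has_derivative (\<lambda>h. \<Sum>l\<in>F. d l x * blinfun_apply l h)) (at x)"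
    by blast
  show ?case
  proof (intro exI[of _ "\<lambda>l x. c l x + d l x"] conjI ballI)
    show "((\<lambda>x. u x + v x) has_derivative (\<lambda>h. \<Sum>l\<in>F. (c l x + d l x) * blinfun_apply l h)) (at x)" if "x \<in> U" for x
      using has_derivative_add[OF c(2)[rule_format, OF that] d(2)[rule_format, OF that]]
      by (simp add: sum.distrib distrib_right)
  qed (use c d in \<open>auto intro: generated.add\<close>)
next
  case (mult u v)
  then obtain c d where
    c: "\<forall>l\<in>F. generated U F S (c l)" "\<forall>x\<in>U. (u has_derivative (\<lambda>h. \<Sum>l\<in>F. c l x * blinfun_apply l h)) (at x)" and
    d: "\<forall>l\<in>F. generated U F S (d l)" "\<forall>x\<in>U. (v has_derivative (\<lambda>h. \<Sum>l\<in>F. d l x * blinfun_apply l h)) (at x)"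
    by blast
  show ?case
  proof (intro exI[of _ "\<lambda>l x. u x * d l x + c l x * v x"] conjI ballI)
    show "((\<lambda>x. u x * v x) has_derivative (\<lambda>h. \<Sum>l\<in>F. (u x * d l x + c l x * v x) * blinfun_apply l h)) (at x)"
      if "x \<in> U" for x
      using has_derivative_mult[OF c(2)[rule_format, OF that] d(2)[rule_format, OF that]]
      by (simp add: sum.distrib algebra_simps sum_distrib_left)
  qed (use c d mult in \<open>auto intro!: generated.add generated.mult\<close>)
next
  case (inverse u)
  then obtain c where
    c: "\<forall>l\<in>F. generated U F S (c l)" "\<forall>x\<in>U. (u has_derivative (\<lambda>h. \<Sum>l\<in>F. c l x * blinfun_apply l h)) (at x)"
    by blast
  show ?case
  proof (intro exI[of _ "\<lambda>l x. (- 1) * (inverse (u x) * inverse (u x)) * c l x"] conjI ballI)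
    show "((\<lambda>x. inverse (u x)) has_derivative (\<lambda>h. \<Sum>l\<in>F. (- 1) * (inverse (u x) * inverse (u x)) * c l x * blinfun_apply l h)) (at x)"
      if "x \<in> U" for x
      using Deriv.has_derivative_inverse[OF inverse.hyps(2)[OF that] c(2)[rule_format, OF that]]
      by (simp add: sum_distrib_left sum_distrib_right sum_negf algebra_simps)
  qed (intro generated.mult generated.const generated.inverse; use c inverse in blast)
next
  case (smooth u \<phi> k)
  then obtain c where
    c: "\<forall>l\<in>F. generated U F S (c l)" "\<forall>x\<in>U. (u has_derivative (\<lambda>h. \<Sum>l\<in>F. c l x * blinfun_apply l h)) (at x)"
    by blast
  show ?case
  proof (intro exI[of _ "\<lambda>l x. \<phi> (Suc k) (u x) * c l x"] conjI ballI)
    show "((\<lambda>x. \<phi> k (u x)) has_derivative (\<lambda>h. \<Sum>l\<in>F. \<phi> (Suc k) (u x) * c l x * blinfun_apply l h)) (at x)"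
      if "x \<in> U" for x
      using has_derivative_compose[OF c(2)[rule_format, OF that],
          OF smooth.hyps(2)[of k "u x", unfolded has_field_derivative_def]]
      by (simp add: sum_distrib_left mult.assoc)
  next
    show "generated U F S (\<lambda>x. \<phi> (Suc k) (u x) * c l x)" if "l \<in> F" for l
      using generated.smooth[of U F S u \<phi> "Suc k", OF smooth.hyps] c(1) that by (intro generated.mult) auto
  qed
qed

text \<open>The higher derivatives of \<open>u\<close> for a system \<open>P\<close> of partial derivatives; the first vector of the list
  is the one in whose direction the first derivative is taken.\<close>

fun iterated_derivative ::
  "('a::real_normed_vector \<Rightarrow>\<^sub>L real) set \<Rightarrow> (('a \<Rightarrow> real) \<Rightarrow> ('a \<Rightarrow>\<^sub>L real) \<Rightarrow> 'a \<Rightarrow> real) \<Rightarrow>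
    ('a \<Rightarrow> real) \<Rightarrow> 'a \<Rightarrow> 'a list \<Rightarrow> real" where
  "iterated_derivative F P u x [] = u x"
| "iterated_derivative F P u x (v # vs) = (\<Sum>l\<in>F. blinfun_apply l v * iterated_derivative F P (P u l) x vs)"

lemma abs_blinfun_le: "\<bar>blinfun_apply l v\<bar> \<le> norm l * norm v" for l :: "'a::real_normed_vector \<Rightarrow>\<^sub>L real"
  using norm_blinfun[of l v] by simp

lemma prod_list_rev: "prod_list (rev xs) = prod_list (xs :: real list)"
  by (induction xs) (simp_all add: mult.commute)

lemma prod_list_map_norm_nonneg: "0 \<le> prod_list (map norm vs)"
  by (induction vs) simp_all

section \<open>Frechet estimates for iterated partial derivatives\<close>

context
  fixes U :: "'a::real_normed_vector set" and F :: "('a \<Rightarrow>\<^sub>L real) set"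
    and A :: "('a \<Rightarrow> real) set" and P
  assumes fin: "finite F"
    and P_mem: "\<And>u l. u \<in> A \<Longrightarrow> l \<in> F \<Longrightarrow> P u l \<in> A"
    and P_deriv: "\<And>u x. u \<in> A \<Longrightarrow> x \<in> U \<Longrightarrow> (u has_derivative (\<lambda>h. \<Sum>l\<in>F. P u l x * blinfun_apply l h)) (at x)"
begin

lemma iterated_derivative_bound:
  "\<exists>C\<ge>0. \<forall>vs. length vs = n \<longrightarrow> \<bar>iterated_derivative F P u x vs\<bar> \<le> C * prod_list (map norm vs)"
proof (induction n arbitrary: u)
  case 0
  show ?case by (auto intro: exI[of _ "\<bar>u x\<bar>"])
next
  case (Suc n)
  have "\<forall>l. \<exists>C\<ge>0. \<forall>vs. length vs = n \<longrightarrow>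
      \<bar>iterated_derivative F P (P u l) x vs\<bar> \<le> C * prod_list (map norm vs)"
    using Suc by blast
  then obtain C where C: "\<And>l. C l \<ge> 0"
    "\<And>l vs. length vs = n \<Longrightarrow> \<bar>iterated_derivative F P (P u l) x vs\<bar> \<le> C l * prod_list (map norm vs)"
    by metis
  show ?case
  proof (intro exI[of _ "\<Sum>l\<in>F. norm l * C l"] conjI allI impI)
    show "0 \<le> (\<Sum>l\<in>F. norm l * C l)" using C(1) by (intro sum_nonneg) simp
    fix ws :: "'a list" assume "length ws = Suc n"
    then obtain v vs where ws: "ws = v # vs" "length vs = n" by (cases ws) auto
    have "\<bar>\<Sum>l\<in>F. blinfun_apply l v * iterated_derivative F P (P u l) x vs\<bar>
        \<le> (\<Sum>l\<in>F. (norm l * norm v) * (C l * prod_list (map norm vs)))"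
      using C ws(2) abs_blinfun_le[of _ v]
      by (intro order.trans[OF sum_abs] sum_mono) (auto simp: abs_mult intro!: mult_mono)
    then show "\<bar>iterated_derivative F P u x ws\<bar> \<le> (\<Sum>l\<in>F. norm l * C l) * prod_list (map norm ws)"
      by (simp add: ws sum_distrib_left sum_distrib_right algebra_simps)
  qed
qed

lemma linear_iterated_derivative:
  "i < length vs \<Longrightarrow> linear (\<lambda>w. iterated_derivative F P u x (vs[i := w]))"
proof (induction vs arbitrary: u i)
  case (Cons v vs)
  show ?case
  proof (cases i)
    case 0
    then show ?thesis
      by (auto simp: linear_iff blinfun.bilinear_simps distrib_right sum.distrib sum_distrib_left mult.assoc)
  next
    case (Suc j)
    then have "linear (\<lambda>w. iterated_derivative F P (P u l) x (vs[j := w]))" for l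
      using Cons by simp
    then show ?thesis
      unfolding Suc by (auto simp: linear_iff distrib_left sum.distrib sum_distrib_left mult.left_commute)
  qed
qed simp

text \<open>The recursion takes derivatives in the order of the list, so a further derivative
  appends its direction, whereas \<open>C_infinity_on\<close> prepends it. Reversing the list
  reconciles the two.\<close>

lemma bounded_multilinear_iterated_derivative:
  "bounded_multilinear n (\<lambda>vs. iterated_derivative F P u x (rev vs))"
  unfolding bounded_multilinear_def
proof (intro conjI allI impI)
  show "linear (\<lambda>w. iterated_derivative F P u x (rev (vs[i := w])))" if "length vs = n" "i < n" for vs i
    using linear_iterated_derivative[of "n - 1 - i" "rev vs"] that by (simp add: rev_update)
  show "\<exists>C. \<forall>vs. length vs = n \<longrightarrow> \<bar>iterated_derivative F P u x (rev vs)\<bar> \<le> C * prod_list (map norm vs)"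
    using iterated_derivative_bound[of n u x] by (metis length_rev prod_list_rev rev_map)
qed

text \<open>The first vector enters only through the factors \<open>l v\<close>, which do not depend
  on the point. The estimate for the partial derivatives therefore carries over, uniformly in all
  vectors.\<close>

lemma iterated_derivative_differentiable:
  assumes "x \<in> U" "u \<in> A" "\<epsilon> > 0"
  shows "\<forall>\<^sub>F h in nhds 0. \<forall>vs. length vs = n \<longrightarrow>
     \<bar>iterated_derivative F P u (x + h) vs - iterated_derivative F P u x vs -
       iterated_derivative F P u x (vs @ [h])\<bar> \<le> \<epsilon> * norm h * prod_list (map norm vs)"
  using assms(2,3)
proof (induction n arbitrary: u \<epsilon>)
  case 0
  have "\<forall>\<^sub>F y in at x. norm (u y - u x - (\<Sum>l\<in>F. P u l x * blinfun_apply l (y - x))) \<le> \<epsilon> * norm (y - x)"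
    using P_deriv[OF 0(1) assms(1)] \<open>\<epsilon> > 0\<close> unfolding has_derivative_within_alt2 by blast
  then have *: "\<forall>\<^sub>F y in nhds x. norm (u y - u x - (\<Sum>l\<in>F. P u l x * blinfun_apply l (y - x))) \<le> \<epsilon> * norm (y - x)"
    unfolding eventually_at_filter by eventually_elim (auto simp: blinfun.bilinear_simps)
  have "\<forall>\<^sub>F h in nhds 0. norm (u (x + h) - u x - (\<Sum>l\<in>F. P u l x * blinfun_apply l h)) \<le> \<epsilon> * norm h"
  proof -
    have "nhds (0 :: 'a) = filtermap (\<lambda>y. y - x) (nhds x)" by (simp add: filtermap_nhds_shift)
    with * show ?thesis by (simp add: eventually_filtermap)
  qed
  then show ?case
    by eventually_elim (simp add: mult.commute)
next
  case (Suc n)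
  \<comment> \<open>The sum of the norms is the factor lost in the step; adding 1 keeps the divisor
    positive when it vanishes.\<close>
  define \<epsilon>' where "\<epsilon>' = \<epsilon> / (1 + (\<Sum>l\<in>F. norm l))"
  have pos: "1 + (\<Sum>l\<in>F. norm l) > 0"
    by (simp add: add_pos_nonneg sum_nonneg)
  then have "\<epsilon>' > 0" using Suc.prems by (simp add: \<epsilon>'_def)
  have le: "(\<Sum>l\<in>F. norm l) * \<epsilon>' \<le> \<epsilon>"
    using pos Suc.prems by (simp add: \<epsilon>'_def field_simps)
  have "\<forall>\<^sub>F h in nhds 0. \<forall>l\<in>F. \<forall>vs. length vs = n \<longrightarrow>
     \<bar>iterated_derivative F P (P u l) (x + h) vs - iterated_derivative F P (P u l) x vs -
       iterated_derivative F P (P u l) x (vs @ [h])\<bar> \<le> \<epsilon>' * norm h * prod_list (map norm vs)"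
    using Suc.IH[OF _ \<open>\<epsilon>' > 0\<close>] P_mem Suc.prems(1) fin by (intro eventually_ball_finite) auto
  then show ?case
  proof eventually_elim
    case (elim h)
    show ?case
    proof (intro allI impI)
      fix ws :: "'a list" assume "length ws = Suc n"
      then obtain v vs where ws: "ws = v # vs" "length vs = n" by (cases ws) auto
      let ?R = "\<lambda>l. iterated_derivative F P (P u l) (x + h) vs - iterated_derivative F P (P u l) x vs -
       iterated_derivative F P (P u l) x (vs @ [h])"
      have "\<bar>\<Sum>l\<in>F. blinfun_apply l v * ?R l\<bar> \<le> (\<Sum>l\<in>F. (norm l * norm v) * (\<epsilon>' * norm h * prod_list (map norm vs)))"
        using elim ws(2) abs_blinfun_le[of _ v]
        by (intro order.trans[OF sum_abs] sum_mono) (auto simp: abs_mult intro!: mult_mono)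
      also have "\<dots> = ((\<Sum>l\<in>F. norm l) * \<epsilon>') * (norm h * prod_list (map norm ws))"
        by (simp add: ws sum_distrib_left sum_distrib_right algebra_simps)
      also have "\<dots> \<le> \<epsilon> * (norm h * prod_list (map norm ws))"
        using le by (intro mult_right_mono mult_nonneg_nonneg prod_list_map_norm_nonneg) auto
      finally show "\<bar>iterated_derivative F P u (x + h) ws - iterated_derivative F P u x ws -
       iterated_derivative F P u x (ws @ [h])\<bar> \<le> \<epsilon> * norm h * prod_list (map norm ws)"
        by (simp add: ws right_diff_distrib sum_subtractf mult.assoc)
    qed
  qed
qed

lemma C_infinity_on_iterated_derivative:
  assumes "u \<in> A"
  shows "C_infinity_on U u"
  unfolding C_infinity_on_def
proof (intro exI[of _ "\<lambda>n x vs. iterated_derivative F P u x (rev vs)"] conjI allI ballI impI)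
  fix n x and \<epsilon> :: real assume "x \<in> U" "\<epsilon> > 0"
  from iterated_derivative_differentiable[OF this(1) assms this(2), of n]
  show "\<forall>\<^sub>F h in nhds 0. \<forall>vs. length vs = n \<longrightarrow>
     \<bar>iterated_derivative F P u (x + h) (rev vs) - iterated_derivative F P u x (rev vs) -
       iterated_derivative F P u x (rev (h # vs))\<bar> \<le> \<epsilon> * norm h * prod_list (map norm vs)"
  proof eventually_elim
    case (elim h)
    show ?case
    proof (intro allI impI)
      fix vs :: "'a list" assume "length vs = n"
      with elim[rule_format, of "rev vs"] show "\<bar>iterated_derivative F P u (x + h) (rev vs) - iterated_derivative F P u x (rev vs) -
       iterated_derivative F P u x (rev (h # vs))\<bar> \<le> \<epsilon> * norm h * prod_list (map norm vs)"
        by (simp add: rev_map[symmetric] prod_list_rev)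
    qed
  qed
qed (auto intro: bounded_multilinear_iterated_derivative)

end

text \<open>The partial derivatives of a base function may involve that function again, as they do
  for one defined implicitly. A choice of partial derivatives within the class supplies the system
  \<open>P\<close>.\<close>

lemma C_infinity_on_generated:
  assumes "finite F"
    and "\<And>s. s \<in> S \<Longrightarrow> \<exists>c. (\<forall>l\<in>F. generated U F S (c l)) \<and>
       (\<forall>x\<in>U. (s has_derivative (\<lambda>h. \<Sum>l\<in>F. c l x * blinfun_apply l h)) (at x))"
    and "generated U F S u"
  shows "C_infinity_on U u"
proof -
  have "\<exists>P. \<forall>u. generated U F S u \<longrightarrow> (\<forall>l\<in>F. generated U F S (P u l)) \<and>
    (\<forall>x\<in>U. (u has_derivative (\<lambda>h. \<Sum>l\<in>F. P u l x * blinfun_apply l h)) (at x))"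
  proof (intro choice allI)
    fix u
    show "\<exists>P. generated U F S u \<longrightarrow> (\<forall>l\<in>F. generated U F S (P l)) \<and>
      (\<forall>x\<in>U. (u has_derivative (\<lambda>h. \<Sum>l\<in>F. P l x * blinfun_apply l h)) (at x))"
      using generated_partial_derivatives[OF assms(1,2), of u] by (cases "generated U F S u") auto
  qed
  then obtain P where P: "\<And>u. generated U F S u \<Longrightarrow> (\<forall>l\<in>F. generated U F S (P u l)) \<and>
    (\<forall>x\<in>U. (u has_derivative (\<lambda>h. \<Sum>l\<in>F. P u l x * blinfun_apply l h)) (at x))"
    by blast
  show ?thesis
  proof (rule C_infinity_on_iterated_derivative[of F "Collect (generated U F S)" P U])
    show "finite F" by (rule assms(1))
    show "P u l \<in> Collect (generated U F S)" if "u \<in> Collect (generated U F S)" "l \<in> F" for u l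
      using P[of u] that by simp
    show "(u has_derivative (\<lambda>h. \<Sum>l\<in>F. P u l x * blinfun_apply l h)) (at x)"
      if "u \<in> Collect (generated U F S)" "x \<in> U" for u x
      using P[of u] that by simp
    show "u \<in> Collect (generated U F S)" using assms(3) by simp
  qed
qed

text \<open>The local derivatives can be patched together because higher derivatives are unique.\<close>

lemma C_infinity_on_local:
  assumes "\<And>x. x \<in> U \<Longrightarrow> \<exists>W. open W \<and> x \<in> W \<and> C_infinity_on W f"
  shows "C_infinity_on U f"
proof -
  define is_deriv where "is_deriv W D \<longleftrightarrow> (\<forall>x\<in>W. D 0 x [] = f x) \<and>
      (\<forall>n. \<forall>x\<in>W. bounded_multilinear n (D n x)) \<and>
      (\<forall>n. \<forall>x\<in>W. \<forall>\<epsilon>>0. \<forall>\<^sub>F h in nhds 0. \<forall>vs. length vs = n \<longrightarrow>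
         \<bar>D n (x + h) vs - D n x vs - D (Suc n) x (h # vs)\<bar> \<le> \<epsilon> * norm h * prod_list (map norm vs))"
    for W and D :: "nat \<Rightarrow> 'a \<Rightarrow> 'a list \<Rightarrow> real"
  \<comment> \<open>Restricting to a line turns the Frechet condition into an ordinary derivative,
    for which uniqueness is available.\<close>
  have deriv: "((\<lambda>t. D n (x + t *\<^sub>R h) vs) has_real_derivative D (Suc n) x (h # vs)) (at 0)"
    if D: "is_deriv W D" and x: "x \<in> W" and len: "length vs = n" for W D n x h vs
  proof -
    have "bounded_multilinear (Suc n) (D (Suc n) x)"
      using D x unfolding is_deriv_def by blast
    then have lin: "linear (\<lambda>u. D (Suc n) x (u # vs))"
      using len unfolding bounded_multilinear_def
      by (elim conjE allE[of _ "undefined # vs"] allE[of _ 0]) simp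
    have "((\<lambda>t. D n (x + t *\<^sub>R h) vs) has_derivative (\<lambda>t. D (Suc n) x (h # vs) * t)) (at 0)"
      unfolding has_derivative_within_alt2
    proof (intro conjI allI impI)
      show "bounded_linear (\<lambda>t. D (Suc n) x (h # vs) * t)" by (rule bounded_linear_mult_right)
      fix \<epsilon> :: real assume "\<epsilon> > 0"
      define c where "c = norm h * prod_list (map norm vs) + 1"
      have c: "c > 0" using prod_list_map_norm_nonneg[of vs] by (simp add: c_def add_nonneg_pos)
      have "\<forall>\<^sub>F k in nhds 0. \<bar>D n (x + k) vs - D n x vs - D (Suc n) x (k # vs)\<bar>
          \<le> \<epsilon> / c * norm k * prod_list (map norm vs)"
      proof -
        have "\<forall>\<^sub>F k in nhds 0. \<forall>vs. length vs = n \<longrightarrow>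
         \<bar>D n (x + k) vs - D n x vs - D (Suc n) x (k # vs)\<bar> \<le> \<epsilon> / c * norm k * prod_list (map norm vs)"
          using D x divide_pos_pos[OF \<open>\<epsilon> > 0\<close> c] unfolding is_deriv_def by blast
        then show ?thesis by eventually_elim (use len in blast)
      qed
      moreover have "filterlim (\<lambda>t::real. t *\<^sub>R h) (nhds 0) (at 0)"
        by (rule tendsto_eq_intros refl)+ simp
      ultimately have "\<forall>\<^sub>F t in at 0. \<bar>D n (x + t *\<^sub>R h) vs - D n x vs - D (Suc n) x (t *\<^sub>R h # vs)\<bar>
          \<le> \<epsilon> / c * norm (t *\<^sub>R h) * prod_list (map norm vs)"
        unfolding filterlim_iff by blast
      then show "\<forall>\<^sub>F t in at 0. norm (D n (x + t *\<^sub>R h) vs - D n (x + 0 *\<^sub>R h) vs - D (Suc n) x (h # vs) * (t - 0))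
          \<le> \<epsilon> * norm (t - 0)"
      proof eventually_elim
        case (elim t)
        have "\<epsilon> / c * norm (t *\<^sub>R h) * prod_list (map norm vs)
            = (\<epsilon> * \<bar>t\<bar>) * ((norm h * prod_list (map norm vs)) / c)"
          by simp
        also have "\<dots> \<le> (\<epsilon> * \<bar>t\<bar>) * 1"
          using \<open>\<epsilon> > 0\<close> c by (intro mult_left_mono) (simp_all add: c_def)
        finally show ?case
          using elim linear_scale[OF lin, of t h] by (simp add: mult.commute)
      qed
    qed
    then show ?thesis by (simp add: has_field_derivative_def)
  qed
  \<comment> \<open>The n-th derivatives agree on the open intersection by induction, hence along
    short segments through \<open>x\<close>, and so do their directional derivatives at
    \<open>x\<close>.\<close>
  have unique: "D n x vs = D' n x vs"
    if "is_deriv W D" "is_deriv W' D'" "open W" "open W'" "x \<in> W" "x \<in> W'" "length vs = n"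
    for W W' D D' n x vs
    using that(5-7)
  proof (induction n arbitrary: x vs)
    case 0
    then show ?case using that(1,2) by (simp add: is_deriv_def)
  next
    case (Suc n)
    then obtain h ws where vs: "vs = h # ws" "length ws = n" by (cases vs) auto
    have "filterlim (\<lambda>t::real. x + t *\<^sub>R h) (nhds x) (nhds 0)"
      by (rule tendsto_eq_intros filterlim_ident refl)+ simp
    moreover have "\<forall>\<^sub>F y in nhds x. y \<in> W \<inter> W'"
      using that(3,4) Suc.prems by (intro eventually_nhds_in_open) auto
    ultimately have "\<forall>\<^sub>F t in nhds 0. x + t *\<^sub>R h \<in> W \<inter> W'"
      unfolding filterlim_iff by blast
    then have "\<forall>\<^sub>F t in nhds 0. D n (x + t *\<^sub>R h) ws = D' n (x + t *\<^sub>R h) ws"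
      by eventually_elim (use Suc.IH vs(2) in auto)
    then have "((\<lambda>t. D' n (x + t *\<^sub>R h) ws) has_real_derivative D (Suc n) x (h # ws)) (at 0)"
      using deriv[OF that(1) Suc.prems(1) vs(2), of h]
      by (subst DERIV_cong_ev[OF refl _ refl, symmetric]) auto
    then show ?case
      unfolding vs(1) by (rule DERIV_unique[OF _ deriv[OF that(2) Suc.prems(2) vs(2)]])
  qed
  have is_deriv_ex: "\<exists>D. is_deriv W D" if "C_infinity_on W f" for W
    using that unfolding C_infinity_on_def is_deriv_def .
  have "\<forall>x\<in>U. \<exists>W. open W \<and> x \<in> W \<and> (\<exists>D. is_deriv W D)"
    using assms is_deriv_ex by meson
  then obtain W where W: "\<forall>x\<in>U. open (W x) \<and> x \<in> W x \<and> (\<exists>D. is_deriv (W x) D)"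
    by (rule bchoice[THEN exE])
  then have "\<forall>x\<in>U. \<exists>D. is_deriv (W x) D" by simp
  then obtain D where "\<forall>x\<in>U. is_deriv (W x) (D x)"
    by (rule bchoice[THEN exE])
  with W have WD: "\<And>x. x \<in> U \<Longrightarrow> open (W x) \<and> x \<in> W x \<and> is_deriv (W x) (D x)"
    by simp
  have nbhd: "\<forall>\<^sub>F h in nhds 0. x + h \<in> W x" if "x \<in> U" for x
  proof -
    have "filterlim (\<lambda>h. x + h) (nhds x) (nhds 0)"
      by (rule tendsto_eq_intros filterlim_ident refl)+ simp
    moreover have "\<forall>\<^sub>F y in nhds x. y \<in> W x"
      using WD[OF that] by (intro eventually_nhds_in_open) auto
    ultimately show ?thesis unfolding filterlim_iff by blast
  qed
  \<comment> \<open>The points \<open>x + h\<close> of the differentiability condition may leave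
    \<open>U\<close>; at such points the derivatives of some chart covering them are used, and by
    uniqueness the choice is immaterial.\<close>
  define E where "E n y = (if y \<in> U then D y n y else D (SOME x. x \<in> U \<and> y \<in> W x) n y)" for n y
  have E: "E n y vs = D x n y vs" if "x \<in> U" "y \<in> W x" "length vs = n" for n x y vs
  proof (cases "y \<in> U")
    case True
    then show ?thesis
      using unique[of "W y" "D y" "W x" "D x" y vs n] WD[OF True] WD[OF that(1)] that
      by (simp add: E_def)
  next
    case False
    define z where "z = (SOME x. x \<in> U \<and> y \<in> W x)"
    have "z \<in> U \<and> y \<in> W z" unfolding z_def by (rule someI[of _ x]) (use that in auto)
    then show ?thesis
      using unique[of "W z" "D z" "W x" "D x" y vs n] WD[of z] WD[OF that(1)] that False
      by (simp add: E_def z_def)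
  qed
  show ?thesis
    unfolding C_infinity_on_def
  proof (intro exI[of _ E] conjI ballI allI impI)
    fix x assume x: "x \<in> U"
    show "E 0 x [] = f x"
      using WD[OF x] x by (simp add: E_def is_deriv_def)
    show "bounded_multilinear n (E n x)" for n
      using WD[OF x] x by (simp add: E_def is_deriv_def)
    fix n and \<epsilon> :: real assume "\<epsilon> > 0"
    then have "\<forall>\<^sub>F h in nhds 0. \<forall>vs. length vs = n \<longrightarrow>
         \<bar>D x n (x + h) vs - D x n x vs - D x (Suc n) x (h # vs)\<bar> \<le> \<epsilon> * norm h * prod_list (map norm vs)"
      using WD[OF x] unfolding is_deriv_def by blast
    with nbhd[OF x] show "\<forall>\<^sub>F h in nhds 0. \<forall>vs. length vs = n \<longrightarrow>
         \<bar>E n (x + h) vs - E n x vs - E (Suc n) x (h # vs)\<bar> \<le> \<epsilon> * norm h * prod_list (map norm vs)"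
    proof eventually_elim
      case (elim h)
      have "x \<in> W x" using WD[OF x] by simp
      then have "E n (x + h) vs = D x n (x + h) vs" "E n x vs = D x n x vs"
        "E (Suc n) x (h # vs) = D x (Suc n) x (h # vs)" if "length vs = n" for vs
        using that E[OF x, of _ _ n] E[OF x, of _ _ "Suc n"] elim(1) by simp_all
      with elim(2) show ?case by simp
    qed
  qed
qed

section \<open>Norms as gauges of convex functions\<close>

definition flat :: "real poly \<Rightarrow> real \<Rightarrow> real" where
  "flat p t = (if t \<le> 0 then 0 else poly p (1 / t) * exp (- (1 / t)))"

lemma tendsto_poly_mult_exp_uminus: "((\<lambda>s. poly p s * exp (- s)) \<longlongrightarrow> 0) at_top"
  for p :: "real poly"
proof -
  have "((\<lambda>s. \<Sum>i\<le>degree p. coeff p i * (s ^ i / exp s)) \<longlongrightarrow> (\<Sum>i\<le>degree p. coeff p i * 0)) at_top"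
    by (intro tendsto_intros tendsto_power_div_exp_0)
  then show ?thesis
    by (simp add: poly_altdef exp_minus sum_distrib_right divide_inverse mult.assoc)
qed

lemma tendsto_flat: "(flat p \<longlongrightarrow> 0) (at 0)"
proof -
  have "((\<lambda>t. poly p (inverse t) * exp (- inverse t)) \<longlongrightarrow> 0) (at_right 0)"
    by (rule filterlim_compose[OF tendsto_poly_mult_exp_uminus filterlim_inverse_at_top_right])
  moreover have "\<forall>\<^sub>F t in at_right 0. poly p (inverse t) * exp (- inverse t) = flat p t"
    by (auto simp: eventually_at_filter flat_def inverse_eq_divide)
  ultimately have "(flat p \<longlongrightarrow> 0) (at_right 0)"
    by (rule Lim_transform_eventually)
  moreover have "(flat p \<longlongrightarrow> 0) (at_left 0)"
    by (rule Lim_transform_eventually[OF tendsto_const]) (auto simp: eventually_at_filter flat_def)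
  ultimately show ?thesis
    by (rule filterlim_split_at[rotated])
qed

text \<open>With s = 1 / t the derivative of p(s) exp(-s) is s^2 (p(s) - p'(s)) exp(-s), so the
  family is closed under differentiation.\<close>

lemma DERIV_flat: "(flat p has_real_derivative flat (monom 1 2 * (p - pderiv p)) t) (at t)"
proof -
  consider "t < 0" | "t = 0" | "t > 0" by linarith
  then show ?thesis
  proof cases
    case 1
    have "((\<lambda>t. 0) has_real_derivative 0) (at t)" by simp
    moreover have "\<forall>\<^sub>F x in nhds t. flat p x = 0"
      using eventually_nhds_in_open[OF open_lessThan[of 0], of t] 1
      by (auto elim!: eventually_mono simp: flat_def)
    ultimately show ?thesis
      using 1 by (subst DERIV_cong_ev[OF refl _ refl]) (auto simp: flat_def)
  next
    case 2
    \<comment> \<open>Dividing by \<open>h\<close> multiplies the polynomial in \<open>1 / h\<close>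
      by its variable, so the difference quotient at 0 is again a member of the family and tends to
      0.\<close>
    have "(flat p h - flat p 0) / h = flat (pCons 0 p) h" for h
      by (simp add: flat_def)
    then show ?thesis
      using 2 tendsto_flat[of "pCons 0 p"] by (simp add: DERIV_def flat_def[of _ 0])
  next
    case 3
    have "((\<lambda>t. poly p (1 / t) * exp (- (1 / t))) has_real_derivative
        flat (monom 1 2 * (p - pderiv p)) t) (at t)"
      using 3 by (auto intro!: derivative_eq_intros DERIV_chain2[OF poly_DERIV]
          simp: flat_def poly_monom power2_eq_square algebra_simps)
    moreover have "\<forall>\<^sub>F x in nhds t. flat p x = poly p (1 / x) * exp (- (1 / x))"
      using eventually_nhds_in_open[OF open_greaterThan[of 0], of t] 3
      by (auto elim!: eventually_mono simp: flat_def)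
    ultimately show ?thesis
      by (subst DERIV_cong_ev[OF refl _ refl])
  qed
qed

text \<open>The start is the first derivative (1 + 1 / t) exp(-1 / t) of t exp(-1 / t); from there
  on the rule of \<open>DERIV_flat\<close> is iterated.\<close>

primrec bend_poly :: "nat \<Rightarrow> real poly" where
  "bend_poly 0 = [:1, 1:]"
| "bend_poly (Suc k) = monom 1 2 * (bend_poly k - pderiv (bend_poly k))"

text \<open>The \<open>k\<close>-th derivative of the convex function \<open>t exp (- 1 / t)\<close>, continued by \<open>0\<close> to \<open>t \<le> 0\<close>.\<close>

definition bend :: "nat \<Rightarrow> real \<Rightarrow> real" where
  "bend k t = (case k of 0 \<Rightarrow> t * flat 1 t | Suc j \<Rightarrow> flat (bend_poly j) t)"

lemma DERIV_bend: "(bend k has_real_derivative bend (Suc k) t) (at t)"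
proof (cases k)
  case 0
  have "((\<lambda>t. t * flat 1 t) has_real_derivative 1 * flat 1 t + flat (monom 1 2 * (1 - pderiv 1)) t * t) (at t)"
    by (rule DERIV_mult[OF DERIV_ident DERIV_flat])
  moreover have "1 * flat 1 t + flat (monom 1 2 * (1 - pderiv 1)) t * t = flat [:1, 1:] t"
    by (simp add: flat_def poly_monom power2_eq_square field_simps)
  ultimately show ?thesis using 0 by (simp add: bend_def[abs_def])
next
  case (Suc j)
  then show ?thesis using DERIV_flat[of "bend_poly j" t] by (simp add: bend_def[abs_def])
qed

lemma bend_eq_0: "t \<le> 0 \<Longrightarrow> bend k t = 0"
  by (auto simp: bend_def flat_def split: nat.split)

lemma bend_pos: "t > 0 \<Longrightarrow> bend 0 t > 0"
  by (simp add: bend_def flat_def)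

lemma bend_nonneg: "bend 0 t \<ge> 0"
  using bend_eq_0[of t 0] bend_pos[of t] by linarith

lemma bend_mono: "s \<le> t \<Longrightarrow> bend 0 s \<le> bend 0 t"
proof (rule DERIV_nonneg_imp_nondecreasing[where f = "bend 0"])
  show "\<exists>y. (bend 0 has_real_derivative y) (at x) \<and> 0 \<le> y" for x
    using DERIV_bend[of 0 x] by (intro exI[of _ "bend 1 x"]) (auto simp: bend_def flat_def)
qed

text \<open>With s = 1 / t the second derivative is s^3 exp(-s). The extra factor t is there for
  this purpose: exp(-1 / t) itself is concave for large t.\<close>

lemma convex_bend: "convex_on UNIV (bend 0)"
proof -
  have "(bend 0 has_real_derivative bend 1 x) (at x)" for x
    using DERIV_bend[of 0] by simp
  moreover have "(bend 1 has_real_derivative bend 2 x) (at x)" for x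
    using DERIV_bend[of 1] by (simp add: numeral_2_eq_2)
  moreover have "bend 2 x \<ge> 0" for x
    by (auto simp: bend_def flat_def numeral_2_eq_2 poly_monom pderiv_pCons)
  ultimately show ?thesis
    by (intro f''_ge0_imp_convex) auto
qed

section \<open>The Minkowski gauge of a convex sublevel set\<close>

text \<open>Convexity and continuity are available only on the open unit ball. By
  \<open>escape\<close> every ray reaches level 1 strictly inside that ball, so the behaviour of
  \<open>\<Phi>\<close> near its boundary never matters.\<close>

locale gauge_function =
  fixes \<Phi> :: "'a::real_normed_vector \<Rightarrow> real" and \<rho> :: real
  assumes convex: "convex_on (ball 0 1) \<Phi>"
    and sym: "\<Phi> (- x) = \<Phi> x"
    and small: "norm x \<le> \<rho> \<Longrightarrow> \<Phi> x = 0"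
    and \<rho>: "0 < \<rho>" "\<rho> < 1"
    and cont: "continuous_on (ball 0 1) \<Phi>"
    and escape: "x \<noteq> 0 \<Longrightarrow> \<exists>t>0. t * norm x < 1 \<and> 1 < \<Phi> (t *\<^sub>R x)"
begin

text \<open>This is the gauge of the set where \<open>\<Phi>\<close> is at most 1, described by the
  equation on its boundary, which suits differentiation; \<open>norm x < s\<close> selects the
  solution inside the ball.\<close>

definition \<mu> :: "'a \<Rightarrow> real" where
  "\<mu> x = (if x = 0 then 0 else THE s. norm x < s \<and> \<Phi> (x /\<^sub>R s) = 1)"

lemma \<Phi>_0: "\<Phi> 0 = 0"
  using small[of 0] \<rho> by simp

lemma \<Phi>_scaleR_le:
  assumes "norm x < 1" "0 \<le> c" "c \<le> 1"
  shows "\<Phi> (c *\<^sub>R x) \<le> c * \<Phi> x"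
  using convex_onD[OF convex, of c 0 x] assms by (simp add: \<Phi>_0)

text \<open>Since \<open>\<Phi> 0 = 0\<close>, convexity keeps \<open>\<Phi>\<close> below its
  chords from the origin. Along a ray it therefore exceeds 1 strictly beyond the point where it
  equals 1, which makes the gauge well defined.\<close>

lemma \<Phi>_less:
  assumes "norm x < s" "s < t" "\<Phi> (x /\<^sub>R t) = 1"
  shows "\<Phi> (x /\<^sub>R s) > 1"
proof -
  have "s > 0" using assms(1) norm_ge_zero[of x] by linarith
  have "\<Phi> ((s / t) *\<^sub>R (x /\<^sub>R s)) \<le> s / t * \<Phi> (x /\<^sub>R s)"
    using assms(1,2) \<open>s > 0\<close> by (intro \<Phi>_scaleR_le) (auto simp: field_simps)
  also have "(s / t) *\<^sub>R (x /\<^sub>R s) = x /\<^sub>R t"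
    using \<open>s > 0\<close> by (simp add: field_simps)
  finally have "t \<le> s * \<Phi> (x /\<^sub>R s)"
    using assms(2,3) \<open>s > 0\<close> by (simp add: field_simps)
  then have "s * 1 < s * \<Phi> (x /\<^sub>R s)" using assms(2) by simp
  then show ?thesis using \<open>s > 0\<close> by (simp only: mult_less_cancel_left_pos)
qed

lemma \<mu>_unique:
  assumes "x \<noteq> 0" "norm x < s" "\<Phi> (x /\<^sub>R s) = 1"
  shows "\<mu> x = s"
proof -
  have "(THE s. norm x < s \<and> \<Phi> (x /\<^sub>R s) = 1) = s"
  proof (rule the_equality)
    fix t assume t: "norm x < t \<and> \<Phi> (x /\<^sub>R t) = 1"
    then show "t = s"
      using assms \<Phi>_less[of x s t] \<Phi>_less[of x t s] by (metis less_irrefl linorder_neqE_linordered_idom)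
  qed (use assms in simp)
  with assms(1) show ?thesis by (simp add: \<mu>_def)
qed

lemma \<mu>_spec:
  assumes "x \<noteq> 0"
  shows norm_less_\<mu>: "norm x < \<mu> x" and \<Phi>_\<mu>: "\<Phi> (x /\<^sub>R \<mu> x) = 1"
proof -
  obtain t where t: "t > 0" "t * norm x < 1" "1 < \<Phi> (t *\<^sub>R x)"
    using escape[OF assms] by blast
  have "\<exists>r\<ge>0. r \<le> t \<and> \<Phi> (r *\<^sub>R x) = 1"
  proof (rule IVT')
    show "\<Phi> (0 *\<^sub>R x) \<le> 1" "1 \<le> \<Phi> (t *\<^sub>R x)" "0 \<le> t" using t by (simp_all add: \<Phi>_0)
    have "norm (r *\<^sub>R x) < 1" if "r \<in> {0..t}" for r
      using mult_right_mono[of r t "norm x"] that t(2) by simp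
    then show "continuous_on {0..t} (\<lambda>r. \<Phi> (r *\<^sub>R x))"
      by (intro continuous_on_compose2[OF cont]) (auto intro!: continuous_intros)
  qed
  then obtain r where r: "r \<ge> 0" "r \<le> t" "\<Phi> (r *\<^sub>R x) = 1" by blast
  then have "r > 0" using \<Phi>_0 by (cases "r = 0") auto
  moreover have "r * norm x < 1"
    using mult_right_mono[of r t "norm x"] r(2) t(2) by simp
  ultimately have "norm x < 1 / r" "\<Phi> (x /\<^sub>R (1 / r)) = 1"
    using r(3) by (auto simp: field_simps)
  with \<mu>_unique[OF assms, of "1 / r"] show "norm x < \<mu> x" "\<Phi> (x /\<^sub>R \<mu> x) = 1" by auto
qed

lemma \<mu>_0: "\<mu> 0 = 0"
  by (simp add: \<mu>_def)

lemma \<mu>_le_iff: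
  assumes "norm x < s"
  shows "\<mu> x \<le> s \<longleftrightarrow> \<Phi> (x /\<^sub>R s) \<le> 1"
proof (cases "x = 0")
  case True
  then show ?thesis using assms by (simp add: \<Phi>_0 \<mu>_0)
next
  case False
  show ?thesis
  proof
    assume le: "\<mu> x \<le> s"
    have pos: "0 < \<mu> x" using norm_less_\<mu>[OF False] norm_ge_zero[of x] by linarith
    have "\<Phi> ((\<mu> x / s) *\<^sub>R (x /\<^sub>R \<mu> x)) \<le> \<mu> x / s * \<Phi> (x /\<^sub>R \<mu> x)"
      using norm_less_\<mu>[OF False] le pos by (intro \<Phi>_scaleR_le) (auto simp: field_simps)
    also have "\<dots> \<le> 1" using \<Phi>_\<mu>[OF False] le pos by simp
    finally show "\<Phi> (x /\<^sub>R s) \<le> 1" using pos by (simp add: field_simps)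
  next
    assume "\<Phi> (x /\<^sub>R s) \<le> 1"
    then show "\<mu> x \<le> s"
      using \<Phi>_less[OF assms _ \<Phi>_\<mu>[OF False]] by force
  qed
qed

lemma norm_le_\<mu>: "norm x \<le> \<mu> x"
  using norm_less_\<mu>[of x] by (cases "x = 0") (auto simp: \<mu>_0)

lemma \<mu>_pos: "x \<noteq> 0 \<Longrightarrow> \<mu> x > 0"
  using norm_less_\<mu>[of x] norm_ge_zero[of x] by linarith

lemma \<mu>_le: "\<mu> x \<le> norm x / \<rho>"
proof (cases "x = 0")
  case False
  then have "norm x < norm x / \<rho>" using \<rho> by (simp add: field_simps)
  moreover have "\<Phi> (x /\<^sub>R (norm x / \<rho>)) = 0"
    using False \<rho> by (intro small) (simp add: field_simps)
  ultimately show ?thesis using \<mu>_le_iff[of x "norm x / \<rho>"] by simp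
qed (simp add: \<mu>_0)

lemma \<mu>_scaleR: "\<mu> (a *\<^sub>R x) = \<bar>a\<bar> * \<mu> x"
proof (cases "a = 0 \<or> x = 0")
  case False
  have "\<Phi> ((a *\<^sub>R x) /\<^sub>R (\<bar>a\<bar> * \<mu> x)) = 1"
  proof (cases "a > 0")
    case True
    then show ?thesis using \<Phi>_\<mu>[of x] False by (simp add: field_simps)
  next
    case a: False
    then have "(a *\<^sub>R x) /\<^sub>R (\<bar>a\<bar> * \<mu> x) = - (x /\<^sub>R \<mu> x)"
      using False by (simp add: field_simps)
    then show ?thesis using \<Phi>_\<mu>[of x] False by (simp only: sym) simp
  qed
  then show ?thesis
    using False norm_less_\<mu>[of x] by (intro \<mu>_unique) auto
qed (auto simp: \<mu>_0)

lemma \<mu>_triangle: "\<mu> (x + y) \<le> \<mu> x + \<mu> y"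
proof (cases "x = 0 \<or> y = 0")
  case False
  let ?s = "\<mu> x" and ?t = "\<mu> y"
  have st: "norm x < ?s" "norm y < ?t" "?s > 0" "?t > 0"
    using norm_less_\<mu> \<mu>_pos False by auto
  have "\<Phi> ((1 - ?t / (?s + ?t)) *\<^sub>R (x /\<^sub>R ?s) + (?t / (?s + ?t)) *\<^sub>R (y /\<^sub>R ?t))
      \<le> (1 - ?t / (?s + ?t)) * \<Phi> (x /\<^sub>R ?s) + (?t / (?s + ?t)) * \<Phi> (y /\<^sub>R ?t)"
    using st by (intro convex_onD[OF convex]) (auto simp: field_simps)
  also have "\<dots> = 1" using \<Phi>_\<mu> False by simp
  also have "1 - ?t / (?s + ?t) = ?s / (?s + ?t)" using st by (simp add: field_simps)
  also have "(?s / (?s + ?t)) *\<^sub>R (x /\<^sub>R ?s) + (?t / (?s + ?t)) *\<^sub>R (y /\<^sub>R ?t) = (x + y) /\<^sub>R (?s + ?t)"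
  proof -
    have "?s / (?s + ?t) * inverse ?s = inverse (?s + ?t)" "?t / (?s + ?t) * inverse ?t = inverse (?s + ?t)"
      using st by (simp_all add: divide_inverse)
    then show ?thesis by (simp only: scaleR_scaleR scaleR_add_right)
  qed
  finally show ?thesis
    using st norm_triangle_ineq[of x y] by (subst \<mu>_le_iff) auto
qed (auto simp: \<mu>_0)

lemma equivalent_norm_\<mu>: "equivalent_norm \<mu>"
  unfolding equivalent_norm_def
proof (intro conjI allI)
  show "\<mu> x = 0 \<longleftrightarrow> x = 0" for x using \<mu>_pos[of x] by (cases "x = 0") (auto simp: \<mu>_0)
  show "\<exists>c>0. \<exists>C>0. \<forall>x. c * norm x \<le> \<mu> x \<and> \<mu> x \<le> C * norm x"
    using norm_le_\<mu> \<mu>_le \<rho> by (intro exI[of _ 1] exI[of _ "1 / \<rho>"] conjI) auto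
qed (rule \<mu>_scaleR \<mu>_triangle)+

lemma continuous_on_\<mu>: "continuous_on A \<mu>"
proof (rule continuous_on_subset[OF lipschitz_on_continuous_on])
  show "(1 / \<rho>)-lipschitz_on UNIV \<mu>"
  proof (rule lipschitz_onI)
    fix x y
    have "\<mu> x - \<mu> y \<le> norm (x - y) / \<rho>" "\<mu> y - \<mu> x \<le> norm (x - y) / \<rho>"
      using \<mu>_triangle[of "x - y" y] \<mu>_triangle[of "y - x" x] \<mu>_le[of "x - y"] \<mu>_le[of "y - x"]
      by (simp_all add: norm_minus_commute)
    then show "dist (\<mu> x) (\<mu> y) \<le> 1 / \<rho> * dist x y"
      by (simp add: dist_real_def dist_norm abs_le_iff)
  qed (use \<rho> in simp)
qed simp

lemma \<Phi>_subgradient: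
  assumes "(\<Phi> has_derivative \<Phi>') (at z)" "norm z < 1" "norm w < 1"
  shows "\<Phi> z + \<Phi>' (w - z) \<le> \<Phi> w"
proof -
  interpret \<Phi>': bounded_linear \<Phi>' by (rule has_derivative_bounded_linear[OF assms(1)])
  have *: "((\<lambda>t. \<Phi> (z + t *\<^sub>R (w - z))) has_derivative (\<lambda>t. \<Phi>' (t *\<^sub>R (w - z)))) (at 0)"
    by (rule has_derivative_compose[of "\<lambda>t. z + t *\<^sub>R (w - z)" "\<lambda>t. t *\<^sub>R (w - z)" 0 UNIV \<Phi> \<Phi>'])
       (auto intro!: derivative_eq_intros assms)
  have "((\<lambda>t. \<Phi> (z + t *\<^sub>R (w - z))) has_real_derivative \<Phi>' (w - z)) (at 0)"
  proof -
    have "(\<lambda>t. \<Phi>' (t *\<^sub>R (w - z))) = (*) (\<Phi>' (w - z))" by (auto simp: fun_eq_iff \<Phi>'.scaleR)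
    then show ?thesis using * by (simp add: has_field_derivative_def)
  qed
  then have "((\<lambda>t. (\<Phi> (z + t *\<^sub>R (w - z)) - \<Phi> z) / t) \<longlongrightarrow> \<Phi>' (w - z)) (at_right 0)"
    by (auto simp: DERIV_def intro: tendsto_within_subset)
  moreover have "\<forall>\<^sub>F t in at_right 0. (\<Phi> (z + t *\<^sub>R (w - z)) - \<Phi> z) / t \<le> \<Phi> w - \<Phi> z"
  proof -
    have "(\<Phi> (z + t *\<^sub>R (w - z)) - \<Phi> z) / t \<le> \<Phi> w - \<Phi> z" if "0 < t" "t < 1" for t
    proof -
      have "z + t *\<^sub>R (w - z) = (1 - t) *\<^sub>R z + t *\<^sub>R w" by (simp add: algebra_simps)
      then show ?thesis
        using convex_onD[OF convex, of t z w] assms that by (simp add: field_simps)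
    qed
    then show ?thesis
      unfolding eventually_at_right_field by (intro exI[of _ 1]) auto
  qed
  ultimately have "\<Phi>' (w - z) \<le> \<Phi> w - \<Phi> z"
    by (intro tendsto_upperbound) auto
  then show ?thesis by simp
qed

lemma norm_scaled_less_1: "x \<noteq> 0 \<Longrightarrow> norm (x /\<^sub>R \<mu> x) < 1"
  using norm_less_\<mu>[of x] \<mu>_pos[of x] by (simp add: field_simps)

text \<open>The subgradient inequality compared with the origin yields
  \<open>1 - \<Phi>' z \<le> 0\<close>. This transversality permits the division in the gradient
  formula.\<close>

lemma \<Phi>_derivative_ge_1:
  assumes "(\<Phi> has_derivative \<Phi>') (at (x /\<^sub>R \<mu> x))" "x \<noteq> 0"
  shows "\<Phi>' (x /\<^sub>R \<mu> x) \<ge> 1"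
proof -
  interpret \<Phi>': bounded_linear \<Phi>' by (rule has_derivative_bounded_linear[OF assms(1)])
  show ?thesis
    using \<Phi>_subgradient[OF assms(1) norm_scaled_less_1[OF assms(2)], of 0] \<Phi>_\<mu>[OF assms(2)]
    by (simp add: \<Phi>_0 linear_neg[OF \<Phi>'.linear_axioms])
qed

text \<open>By convexity of \<open>\<Phi>\<close> the claimed derivative is a linear lower bound for \<open>\<mu>\<close> with equality at \<open>x\<close>,
  so that only an upper estimate is needed for the implicitly defined function \<open>\<mu>\<close>.\<close>

lemma has_derivative_\<mu>:
  assumes \<Phi>': "(\<Phi> has_derivative \<Phi>') (at (x /\<^sub>R \<mu> x))" and x: "x \<noteq> 0"
  shows "(\<mu> has_derivative (\<lambda>v. \<Phi>' v / \<Phi>' (x /\<^sub>R \<mu> x))) (at x)"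
proof -
  let ?z = "x /\<^sub>R \<mu> x"
  define l where "l v = \<Phi>' v / \<Phi>' ?z" for v
  interpret \<Phi>': bounded_linear \<Phi>' by (rule has_derivative_bounded_linear[OF \<Phi>'])
  have pos: "\<Phi>' ?z \<ge> 1" by (rule \<Phi>_derivative_ge_1[OF \<Phi>' x])
  have "bounded_linear l"
    unfolding l_def by (rule bounded_linear_compose[OF bounded_linear_divide \<Phi>'.bounded_linear_axioms])
  then interpret l: bounded_linear l .
  obtain K where K: "K > 0" "\<And>v. \<bar>l v\<bar> \<le> norm v * K"
    using l.pos_bounded by auto
  have "\<Phi>' x = \<mu> x * \<Phi>' ?z"
    using \<mu>_pos[OF x] by (simp add: \<Phi>'.scaleR)
  then have lx: "l x = \<mu> x"
    using pos by (simp add: l_def)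
  \<comment> \<open>Both normalised points lie on level 1, so the subgradient inequality makes
    \<open>\<Phi>'\<close> non-positive on their difference.\<close>
  have lower: "l y \<le> \<mu> y" if "y \<noteq> 0" for y
  proof -
    have "\<Phi>' (y /\<^sub>R \<mu> y - ?z) \<le> 0"
      using \<Phi>_subgradient[OF \<Phi>' norm_scaled_less_1[OF x] norm_scaled_less_1[OF that]]
        \<Phi>_\<mu>[OF x] \<Phi>_\<mu>[OF that] by linarith
    then have "\<Phi>' y / \<mu> y \<le> \<Phi>' ?z"
      by (simp add: \<Phi>'.diff \<Phi>'.scaleR divide_inverse mult.commute)
    then show ?thesis using \<mu>_pos[OF that] pos by (simp add: l_def field_simps)
  qed
  have "(\<mu> has_derivative l) (at x)"
    unfolding has_derivative_within_alt2
  proof (intro conjI allI impI)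
    show "bounded_linear l" by fact
    fix \<epsilon> :: real assume "\<epsilon> > 0"
    \<comment> \<open>The factor \<open>1 + K + \<epsilon>\<close> bounds how far
      \<open>y /\<^sub>R s y\<close> moves relative to \<open>norm (y - x)\<close>, up to
      \<open>s y\<close>. With this \<open>\<eta>\<close> the first-order error of
      \<open>\<Phi>\<close> is at most what the surplus \<open>\<epsilon> * norm (y - x)\<close> in
      \<open>s y\<close> gains.\<close>
    define \<eta> where "\<eta> = \<Phi>' ?z * \<epsilon> / (1 + K + \<epsilon>)"
    have "\<eta> > 0" using \<open>\<epsilon> > 0\<close> K(1) pos by (simp add: \<eta>_def)
    have "\<forall>\<^sub>F w in at ?z. norm (\<Phi> w - \<Phi> ?z - \<Phi>' (w - ?z)) \<le> \<eta> * norm (w - ?z)"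
      using \<Phi>' \<open>\<eta> > 0\<close> unfolding has_derivative_within_alt2 by blast
    then have near: "\<forall>\<^sub>F w in nhds ?z. norm (\<Phi> w - \<Phi> ?z - \<Phi>' (w - ?z)) \<le> \<eta> * norm (w - ?z)"
      unfolding eventually_at_filter by eventually_elim auto
    \<comment> \<open>A trial value slightly above the tangent: proving
      \<open>\<Phi> (y /\<^sub>R s y) \<le> 1\<close> gives the upper estimate
      \<open>\<mu> y \<le> s y\<close>.\<close>
    define s where "s y = l y + \<epsilon> * norm (y - x)" for y
    have s_tendsto: "(s \<longlongrightarrow> \<mu> x) (at x)"
      unfolding s_def[abs_def] by (auto intro!: tendsto_eq_intros l.tendsto simp: lx)
    have "((\<lambda>y. y /\<^sub>R s y) \<longlongrightarrow> ?z) (at x)"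
      using s_tendsto \<mu>_pos[OF x] by (intro tendsto_intros) auto
    with near have "\<forall>\<^sub>F y in at x. norm (\<Phi> (y /\<^sub>R s y) - \<Phi> ?z - \<Phi>' (y /\<^sub>R s y - ?z)) \<le> \<eta> * norm (y /\<^sub>R s y - ?z)"
      unfolding filterlim_iff by blast
    moreover have "\<forall>\<^sub>F y in at x. norm y < s y"
    proof -
      have "((\<lambda>y. s y - norm y) \<longlongrightarrow> \<mu> x - norm x) (at x)"
        by (intro tendsto_intros s_tendsto)
      then have "\<forall>\<^sub>F y in at x. 0 < s y - norm y"
        using norm_less_\<mu>[OF x] by (intro order_tendstoD) auto
      then show ?thesis by eventually_elim simp
    qed
    moreover have "\<forall>\<^sub>F y in at x. y \<noteq> 0"
      using x by (intro eventually_neq_at_within) 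
    ultimately show "\<forall>\<^sub>F y in at x. norm (\<mu> y - \<mu> x - l (y - x)) \<le> \<epsilon> * norm (y - x)"
    proof eventually_elim
      case (elim y)
      have s: "s y > 0" using elim(2) norm_ge_zero[of y] by linarith
      have "norm (y /\<^sub>R s y - ?z) = norm (y - s y *\<^sub>R ?z) / s y"
      proof -
        have "y /\<^sub>R s y - ?z = (y - s y *\<^sub>R ?z) /\<^sub>R s y"
          using s by (simp add: scaleR_diff_right)
        then show ?thesis using s by (simp add: divide_inverse mult.commute)
      qed
      also have "y - s y *\<^sub>R ?z = (y - x) - (s y - \<mu> x) *\<^sub>R ?z"
      proof -
        have "\<mu> x *\<^sub>R ?z = x" using \<mu>_pos[OF x] by simp
        then show ?thesis by (simp only: scaleR_diff_left) simp
      qed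
      also have "norm \<dots> \<le> norm (y - x) + \<bar>s y - \<mu> x\<bar> * norm ?z"
        by (metis norm_scaleR norm_triangle_ineq4)
      also have "\<dots> \<le> norm (y - x) + (norm (y - x) * K + \<epsilon> * norm (y - x)) * 1"
      proof (intro add_left_mono mult_mono)
        have "s y - \<mu> x = l (y - x) + \<epsilon> * norm (y - x)" by (simp add: s_def l.diff lx)
        also have "\<bar>\<dots>\<bar> \<le> norm (y - x) * K + \<epsilon> * norm (y - x)"
        proof -
          have "0 \<le> \<epsilon> * norm (y - x)" using \<open>\<epsilon> > 0\<close> by simp
          then show ?thesis using K(2)[of "y - x"] unfolding abs_le_iff by linarith
        qed
        finally show "\<bar>s y - \<mu> x\<bar> \<le> norm (y - x) * K + \<epsilon> * norm (y - x)" .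
      qed (use norm_scaled_less_1[OF x] K \<open>\<epsilon> > 0\<close> in auto)
      also have "\<dots> = (1 + K + \<epsilon>) * norm (y - x)" by (simp add: algebra_simps)
      finally have "norm (y /\<^sub>R s y - ?z) \<le> (1 + K + \<epsilon>) * norm (y - x) / s y"
        using s by (simp add: divide_right_mono)
      then have "\<eta> * norm (y /\<^sub>R s y - ?z) \<le> \<eta> * ((1 + K + \<epsilon>) * norm (y - x) / s y)"
        using \<open>\<eta> > 0\<close> by (intro mult_left_mono) auto
      also have "\<dots> = \<Phi>' ?z * \<epsilon> * norm (y - x) / s y"
        using K(1) \<open>\<epsilon> > 0\<close> by (simp add: \<eta>_def)
      finally have R: "\<eta> * norm (y /\<^sub>R s y - ?z) \<le> \<Phi>' ?z * \<epsilon> * norm (y - x) / s y" .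
      have "\<Phi>' (y /\<^sub>R s y - ?z) = \<Phi>' ?z * (l y / s y - 1)"
        using pos by (simp add: \<Phi>'.diff \<Phi>'.scaleR[of _ y] l_def divide_inverse algebra_simps)
      also have "l y / s y - 1 = - (\<epsilon> * norm (y - x) / s y)"
        using s by (simp add: s_def field_simps)
      finally have "\<Phi> (y /\<^sub>R s y) \<le> 1"
        using elim(1) R \<Phi>_\<mu>[OF x] by (simp add: abs_le_iff)
      then have "\<mu> y \<le> s y" using elim(2) by (simp add: \<mu>_le_iff)
      moreover have "l y \<le> \<mu> y" by (rule lower[OF elim(3)])
      ultimately show ?case
        by (simp add: s_def l.diff lx abs_le_iff)
    qed
  qed
  then show ?thesis by (simp add: l_def[abs_def])
qed

end

section \<open>Smooth norms that locally depend on finitely many functionals\<close>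

context boundary
begin

section \<open>The locally finite sum of bowls\<close>

text \<open>Scaled so that a bowl has value at least 2 from \<open>1 + e n / 2\<close> on, halfway
  between the end of its flat part and the largest value that \<open>g n\<close> may approach on the
  open unit ball.\<close>

definition height :: "nat \<Rightarrow> real" where "height n = 2 / bend 0 (e n / 2)"

definition bowl :: "nat \<Rightarrow> real \<Rightarrow> real" where
  "bowl n t = height n * (bend 0 (t - 1) + bend 0 (- t - 1))"

definition bowl' :: "nat \<Rightarrow> real \<Rightarrow> real" where
  "bowl' n t = height n * (bend 1 (t - 1) + (- 1) * bend 1 (- t - 1))"

definition \<Phi> :: "'a \<Rightarrow> real" where "\<Phi> z = (\<Sum>n. bowl n (g n z))"

lemma height_pos: "height n > 0"
  using e_pos[of n] by (simp add: height_def bend_pos)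

lemma bowl_nonneg: "bowl n t \<ge> 0"
  using height_pos[of n] by (simp add: bowl_def bend_nonneg)

lemma bowl_eq_0: "\<bar>t\<bar> \<le> 1 \<Longrightarrow> bowl n t = 0"
  by (auto simp: bowl_def bend_eq_0)

lemma bowl_even: "bowl n (- t) = bowl n t"
  by (simp add: bowl_def add.commute)

lemma bowl_ge_2:
  assumes "\<bar>t\<bar> \<ge> 1 + e n / 2"
  shows "bowl n t \<ge> 2"
proof -
  have "bend 0 (e n / 2) \<le> bend 0 (t - 1) + bend 0 (- t - 1)"
    using assms bend_mono[of "e n / 2" "t - 1"] bend_mono[of "e n / 2" "- t - 1"]
      bend_nonneg[of "t - 1"] bend_nonneg[of "- t - 1"] by (cases "t \<ge> 0") auto
  then have "height n * bend 0 (e n / 2) \<le> bowl n t"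
    unfolding bowl_def using height_pos[of n] by (intro mult_left_mono) auto
  moreover have "height n * bend 0 (e n / 2) = 2"
    using bend_pos[of "e n / 2"] e_pos[of n] by (simp add: height_def)
  ultimately show ?thesis by simp
qed

lemma DERIV_bowl: "(bowl n has_real_derivative bowl' n t) (at t)"
proof -
  have "((\<lambda>t. bend 0 (t - 1)) has_real_derivative bend 1 (t - 1) * 1) (at t)"
    by (rule DERIV_chain2[of "bend 0"]) (use DERIV_bend[of 0] in \<open>auto intro!: derivative_eq_intros\<close>)
  moreover have "((\<lambda>t. bend 0 (- t - 1)) has_real_derivative bend 1 (- t - 1) * (- 1)) (at t)"
    by (rule DERIV_chain2[of "bend 0"]) (use DERIV_bend[of 0] in \<open>auto intro!: derivative_eq_intros\<close>)
  ultimately have "((\<lambda>t. height n * (bend 0 (t - 1) + bend 0 (- t - 1))) has_real_derivative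
      height n * (bend 1 (t - 1) * 1 + bend 1 (- t - 1) * (- 1))) (at t)"
    by (intro DERIV_cmult DERIV_add)
  then show ?thesis by (simp add: bowl_def[abs_def] bowl'_def)
qed

lemma convex_bowl: "0 \<le> c \<Longrightarrow> c \<le> 1 \<Longrightarrow> bowl n ((1 - c) * s + c * t) \<le> (1 - c) * bowl n s + c * bowl n t"
proof -
  assume c: "0 \<le> c" "c \<le> 1"
  have "bend 0 ((1 - c) *\<^sub>R (s - 1) + c *\<^sub>R (t - 1)) \<le> (1 - c) * bend 0 (s - 1) + c * bend 0 (t - 1)"
    "bend 0 ((1 - c) *\<^sub>R (- s - 1) + c *\<^sub>R (- t - 1)) \<le> (1 - c) * bend 0 (- s - 1) + c * bend 0 (- t - 1)"
    using c by (intro convex_onD[OF convex_bend]; simp)+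
  moreover have "(1 - c) *\<^sub>R (s - 1) + c *\<^sub>R (t - 1) = (1 - c) * s + c * t - 1"
    "(1 - c) *\<^sub>R (- s - 1) + c *\<^sub>R (- t - 1) = - ((1 - c) * s + c * t) - 1"
    by (simp_all add: algebra_simps)
  ultimately have "bend 0 ((1 - c) * s + c * t - 1) + bend 0 (- ((1 - c) * s + c * t) - 1)
     \<le> ((1 - c) * bend 0 (s - 1) + c * bend 0 (t - 1)) + ((1 - c) * bend 0 (- s - 1) + c * bend 0 (- t - 1))"
    by simp
  then have "bowl n ((1 - c) * s + c * t)
     \<le> height n * (((1 - c) * bend 0 (s - 1) + c * bend 0 (t - 1)) + ((1 - c) * bend 0 (- s - 1) + c * bend 0 (- t - 1)))"
    unfolding bowl_def using height_pos[of n] by (intro mult_left_mono) auto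
  then show ?thesis by (simp add: bowl_def algebra_simps)
qed

text \<open>As \<open>e\<close> tends to 0, the products \<open>(1 + e n) * r\<close> eventually
  drop below 1, and from that index on the whole ball of radius \<open>r\<close> is mapped into the
  flat parts.\<close>

lemma \<Phi>_locally_finite:
  assumes "0 \<le> r" "r < 1"
  shows "\<exists>m. (\<forall>z. norm z \<le> r \<longrightarrow> \<Phi> z = (\<Sum>n<m. bowl n (g n z))) \<and>
    (\<forall>z n. norm z \<le> r \<longrightarrow> n \<ge> m \<longrightarrow> bowl n (g n z) = 0)"
proof -
  have "(\<lambda>n. (1 + e n) * r) \<longlonglongrightarrow> (1 + 0) * r"
    by (intro tendsto_intros e_tendsto_0)
  then have "\<forall>\<^sub>F n in sequentially. (1 + e n) * r < 1"
    using assms by (intro order_tendstoD) auto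
  then obtain m where m: "\<And>n. n \<ge> m \<Longrightarrow> (1 + e n) * r < 1"
    by (auto simp: eventually_sequentially)
  have zero: "bowl n (g n z) = 0" if "norm z \<le> r" "n \<ge> m" for z n
  proof (rule bowl_eq_0)
    have "(1 + e n) * norm z \<le> (1 + e n) * r"
      using that(1) e_pos[of n] by (intro mult_left_mono) auto
    then show "\<bar>g n z\<bar> \<le> 1" using abs_g_le[of n z] m[OF that(2)] by linarith
  qed
  have "\<Phi> z = (\<Sum>n<m. bowl n (g n z))" if "norm z \<le> r" for z
    unfolding \<Phi>_def using zero[OF that] by (intro suminf_finite) auto
  with zero show ?thesis by blast
qed

lemma has_derivative_\<Phi>:
  assumes "\<And>z. norm z \<le> r \<Longrightarrow> \<Phi> z = (\<Sum>n<m. bowl n (g n z))" "norm z < r"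
  shows "(\<Phi> has_derivative (\<lambda>v. \<Sum>n<m. bowl' n (g n z) * g n v)) (at z)"
proof -
  have "((\<lambda>z. bowl n (g n z)) has_derivative (\<lambda>v. bowl' n (g n z) * g n v)) (at z)" for n
    by (rule has_derivative_compose[of "g n" "g n" z UNIV "bowl n" "(*) (bowl' n (g n z))"])
       (auto intro!: bounded_linear_imp_has_derivative blinfun.bounded_linear_right
          DERIV_bowl simp flip: has_field_derivative_def)
  then have "((\<lambda>z. \<Sum>n<m. bowl n (g n z)) has_derivative (\<lambda>v. \<Sum>n<m. bowl' n (g n z) * g n v)) (at z)"
    by (intro has_derivative_sum)
  moreover have "\<forall>\<^sub>F w in nhds z. w \<in> ball 0 r"
    using assms(2) by (intro eventually_nhds_in_open) auto
  then have "\<forall>\<^sub>F w in nhds z. (\<Sum>n<m. bowl n (g n w)) = \<Phi> w"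
    by eventually_elim (use assms(1) in auto)
  ultimately show ?thesis
    using assms by (elim has_derivative_transform_eventually) (auto simp: eventually_at_filter elim: eventually_mono)
qed

sublocale gauge: gauge_function \<Phi> "1 / (1 + \<delta>)"
proof
  show "convex_on (ball 0 1) \<Phi>"
  proof (rule convex_onI)
    fix c :: real and x y :: 'a assume c: "0 < c" "c < 1" and xy: "x \<in> ball 0 1" "y \<in> ball 0 1"
    define r where "r = max (norm x) (norm y)"
    have r: "0 \<le> r" "r < 1" "norm x \<le> r" "norm y \<le> r"
      using xy by (auto simp: r_def max_def)
    obtain m where m: "\<forall>z. norm z \<le> r \<longrightarrow> \<Phi> z = (\<Sum>n<m. bowl n (g n z))"
      using \<Phi>_locally_finite[OF r(1,2)] by blast
    have "norm ((1 - c) *\<^sub>R x + c *\<^sub>R y) \<le> r"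
      using convexD_alt[OF convex_cball[of 0 r], of x y c] r c by simp
    then have "\<Phi> ((1 - c) *\<^sub>R x + c *\<^sub>R y) = (\<Sum>n<m. bowl n ((1 - c) * g n x + c * g n y))"
      by (simp add: m blinfun.bilinear_simps)
    also have "\<dots> \<le> (\<Sum>n<m. (1 - c) * bowl n (g n x) + c * bowl n (g n y))"
      using c by (intro sum_mono convex_bowl) auto
    also have "\<dots> = (1 - c) * \<Phi> x + c * \<Phi> y"
      by (simp add: m r sum.distrib sum_distrib_left)
    finally show "\<Phi> ((1 - c) *\<^sub>R x + c *\<^sub>R y) \<le> (1 - c) * \<Phi> x + c * \<Phi> y" .
  qed (rule convex_ball)
  show "\<Phi> (- x) = \<Phi> x" for x
    by (simp add: \<Phi>_def blinfun.bilinear_simps bowl_even)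
  show "\<Phi> x = 0" if "norm x \<le> 1 / (1 + \<delta>)" for x
  proof -
    have "\<bar>g n x\<bar> \<le> 1" for n
      using abs_g_le_bound[of n x] that \<delta>_pos by (simp add: field_simps)
    then show ?thesis by (simp add: \<Phi>_def bowl_eq_0)
  qed
  show "0 < 1 / (1 + \<delta>)" "1 / (1 + \<delta>) < 1" using \<delta>_pos by simp_all
  show "continuous_on (ball 0 1) \<Phi>"
  proof (rule continuous_at_imp_continuous_on, rule ballI)
    fix x :: 'a assume "x \<in> ball 0 1"
    then obtain r where r: "norm x < r" "r < 1" using dense[of "norm x" 1] by auto
    have "0 \<le> r" using r norm_ge_zero[of x] by linarith
    then obtain m where "\<forall>z. norm z \<le> r \<longrightarrow> \<Phi> z = (\<Sum>n<m. bowl n (g n z))"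
      using \<Phi>_locally_finite[OF _ r(2)] by blast
    then have "\<And>z. norm z \<le> r \<Longrightarrow> \<Phi> z = (\<Sum>n<m. bowl n (g n z))" by blast
    from has_derivative_\<Phi>[OF this r(1)] show "isCont \<Phi> x"
      by (rule has_derivative_continuous)
  qed
  fix x :: 'a assume x: "x \<noteq> 0"
  obtain n where n: "\<bar>g n x\<bar> = (1 + e n) * norm x" by (rule g_attains)
  \<comment> \<open>The factor \<open>t\<close> below gives \<open>t x\<close> norm q < 1 while
    \<open>g n\<close> has absolute value \<open>1 + e n / 2\<close> there, so a single bowl already
    exceeds level 1.\<close>
  define q where "q = (1 + e n / 2) / (1 + e n)"
  have q: "0 < q" "q < 1" "q * (1 + e n) = 1 + e n / 2"
    using e_pos[of n] by (simp_all add: q_def)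
  define t where "t = q / norm x"
  have t: "t > 0" "t * norm x < 1" "t * \<bar>g n x\<bar> = 1 + e n / 2"
    using x q by (simp_all add: t_def n)
  have "norm (t *\<^sub>R x) < 1" using t by simp
  then obtain m where m: "\<Phi> (t *\<^sub>R x) = (\<Sum>n<m. bowl n (g n (t *\<^sub>R x)))"
    "\<And>n. n \<ge> m \<Longrightarrow> bowl n (g n (t *\<^sub>R x)) = 0"
    using \<Phi>_locally_finite[OF norm_ge_zero, of "t *\<^sub>R x"] by blast
  have ge: "bowl n (g n (t *\<^sub>R x)) \<ge> 2"
    using t by (intro bowl_ge_2) (simp add: blinfun.bilinear_simps abs_mult)
  then have "n < m" using m(2)[of n] by force
  then have "bowl n (g n (t *\<^sub>R x)) \<le> \<Phi> (t *\<^sub>R x)"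
    unfolding m(1) by (intro member_le_sum) (auto simp: bowl_nonneg)
  with ge t show "\<exists>t>0. t * norm x < 1 \<and> 1 < \<Phi> (t *\<^sub>R x)" by (intro exI[of _ t]) auto
qed

text \<open>The numbers satisfy norm x / \<mu> x < r < 1 and norm x / r < s < \<mu> x. Separating
  \<open>norm y\<close> and \<open>\<mu> y\<close> by the fixed \<open>s\<close> keeps also mixed
  quotients, of one point by the gauge of another, in the ball of radius \<open>r\<close>.\<close>

lemma ex_finitely_determined_nbhd:
  assumes "x \<noteq> 0"
  obtains U m r s where "open U" "x \<in> U" "0 < r" "r < 1" "0 < s"
    "\<And>y. y \<in> U \<Longrightarrow> norm y < r * s" "\<And>y. y \<in> U \<Longrightarrow> s < gauge.\<mu> y"
    "\<And>z. norm z \<le> r \<Longrightarrow> \<Phi> z = (\<Sum>n<m. bowl n (g n z))"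
proof -
  note x = gauge.norm_less_\<mu>[OF assms] gauge.\<mu>_pos[OF assms]
  then have "norm x / gauge.\<mu> x < 1" by simp
  then obtain r where r: "norm x / gauge.\<mu> x < r" "r < 1" using dense by blast
  moreover have "0 \<le> norm x / gauge.\<mu> x" using x by simp
  ultimately have "r > 0" by linarith
  have "norm x / r < gauge.\<mu> x" using r \<open>r > 0\<close> x by (simp add: field_simps)
  then obtain s where s: "norm x / r < s" "s < gauge.\<mu> x" using dense by blast
  have "norm x / r > 0" using assms \<open>r > 0\<close> by simp
  then have "s > 0" using s(1) by linarith
  obtain m where m: "\<forall>z. norm z \<le> r \<longrightarrow> \<Phi> z = (\<Sum>n<m. bowl n (g n z))"
    using \<Phi>_locally_finite[OF less_imp_le[OF \<open>r > 0\<close>] r(2)] by blast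
  define U where "U = {y. norm y < r * s} \<inter> {y. s < gauge.\<mu> y}"
  have "open U"
    unfolding U_def by (intro open_Int open_Collect_less continuous_intros gauge.continuous_on_\<mu>)
  moreover have "x \<in> U" using s \<open>r > 0\<close> by (simp add: U_def field_simps)
  ultimately show thesis
    by (rule that[of U r s m]) (use \<open>r > 0\<close> r(2) \<open>s > 0\<close> m in \<open>auto simp: U_def\<close>)
qed

lemma generated_bowl':
  assumes "generated U F S u"
  shows "generated U F S (\<lambda>x. bowl' n (u x))"
proof -
  note smooth = generated.smooth[of U F S _ bend 1, OF _ DERIV_bend]
  have "generated U F S (\<lambda>x. u x + (- 1))" "generated U F S (\<lambda>x. (- 1) * u x + (- 1))"
    by (rule generated.add[OF assms generated.const]
        generated.add[OF generated.mult[OF generated.const assms] generated.const])+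
  from this[THEN smooth] have "generated U F S (\<lambda>x. height n * (bend 1 (u x + (- 1)) + (- 1) * bend 1 ((- 1) * u x + (- 1))))"
    by (intro generated.add generated.mult generated.const)
  then show ?thesis by (simp add: bowl'_def)
qed

text \<open>A bootstrap: the gradient of the gauge is a quotient of expressions in finitely many
  \<open>g n\<close>, the derivative of \<open>bend\<close>, and the gauge itself. With the gauge as
  the only base function the generated class is thus closed under partial derivatives.\<close>

lemma C_infinity_norm_gauge: "C_infinity_norm gauge.\<mu>"
  unfolding C_infinity_norm_def
proof (rule C_infinity_on_local)
  fix x :: 'a assume "x \<in> UNIV - {0}"
  then have "x \<noteq> 0" by simp
  then obtain U m r s where U: "open U" "x \<in> U" "0 < r" "r < 1" "0 < s"
    "\<And>y. y \<in> U \<Longrightarrow> norm y < r * s" "\<And>y. y \<in> U \<Longrightarrow> s < gauge.\<mu> y"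
    "\<And>z. norm z \<le> r \<Longrightarrow> \<Phi> z = (\<Sum>n<m. bowl n (g n z))"
    by (rule ex_finitely_determined_nbhd) blast
  define F where "F = g ` {..<m}"
  let ?G = "generated U F {gauge.\<mu>}"
  define u where "u n y = g n y * inverse (gauge.\<mu> y)" for n y
  define a where "a n y = bowl' n (u n y)" for n y
  define d where "d y = (\<Sum>n<m. a n y * u n y)" for y
  \<comment> \<open>The sequence \<open>g\<close> may repeat a functional, while coefficients are
    indexed by the set \<open>F\<close>; the indices with the same functional are collected.\<close>
  define A where "A l y = (\<Sum>n | n < m \<and> g n = l. a n y)" for l y
  define c where "c l y = A l y * inverse (d y)" for l y
  have ne: "y \<noteq> 0" "gauge.\<mu> y \<noteq> 0" if "y \<in> U" for y
  proof -
    have "gauge.\<mu> y > 0" using U(5) U(7)[OF that] by linarith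
    then show "gauge.\<mu> y \<noteq> 0" by simp
    then show "y \<noteq> 0" using gauge.\<mu>_0 by auto
  qed
  have \<Phi>': "(\<Phi> has_derivative (\<lambda>v. \<Sum>n<m. a n y * g n v)) (at (y /\<^sub>R gauge.\<mu> y))" if "y \<in> U" for y
  proof -
    have "norm y < r * gauge.\<mu> y"
      using U(6,7)[OF that] mult_strict_left_mono[OF U(7)[OF that] U(3)] by linarith
    moreover have "gauge.\<mu> y > 0" using U(5) U(7)[OF that] by linarith
    ultimately have "norm (y /\<^sub>R gauge.\<mu> y) < r" by (simp add: field_simps)
    from has_derivative_\<Phi>[OF U(8) this] show ?thesis
      by (simp add: a_def u_def blinfun.bilinear_simps mult.commute)
  qed
  have d: "d y = (\<Sum>n<m. a n y * g n (y /\<^sub>R gauge.\<mu> y))" for y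
    by (simp add: d_def u_def blinfun.bilinear_simps mult.commute)
  have d_ge: "d y \<ge> 1" if "y \<in> U" for y
    unfolding d by (rule gauge.\<Phi>_derivative_ge_1[OF \<Phi>'[OF that] ne(1)[OF that]])
  have gen_u: "?G (u n)" if "n < m" for n
    unfolding u_def using that ne
    by (intro generated.mult generated.inverse generated.functional generated.base) (auto simp: F_def)
  have gen_a: "?G (a n)" if "n < m" for n
    unfolding a_def using gen_u[OF that] by (rule generated_bowl')
  have gen_d: "?G d"
    unfolding d_def using gen_u gen_a by (intro generated_sum generated.mult) auto
  have gen_c: "?G (c l)" for l
    unfolding c_def A_def using gen_a gen_d d_ge
    by (intro generated.mult generated.inverse generated_sum) fastforce+
  have "(gauge.\<mu> has_derivative (\<lambda>v. \<Sum>l\<in>F. c l y * blinfun_apply l v)) (at y)" if "y \<in> U" for y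
  proof -
    have "(\<Sum>n<m. a n y * g n v) / d y = (\<Sum>l\<in>F. c l y * blinfun_apply l v)" for v
    proof -
      have "(\<Sum>n<m. a n y * g n v) = (\<Sum>l\<in>F. \<Sum>n | n \<in> {..<m} \<and> g n = l. a n y * g n v)"
        unfolding F_def by (rule sum.image_gen) simp
      also have "\<dots> = (\<Sum>l\<in>F. A l y * blinfun_apply l v)"
        unfolding A_def by (intro sum.cong refl) (auto simp: sum_distrib_right intro!: sum.cong)
      finally show ?thesis
        by (simp add: c_def divide_inverse sum_distrib_left mult.commute[of _ "inverse (d y)"] mult.assoc)
    qed
    then show ?thesis
      using gauge.has_derivative_\<mu>[OF \<Phi>'[OF that] ne(1)[OF that]] by (simp add: d)
  qed
  then have "C_infinity_on U gauge.\<mu>"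
    using gen_c by (intro C_infinity_on_generated[of F "{gauge.\<mu>}"]) (auto simp: F_def intro: generated.base)
  with U(1,2) show "\<exists>W. open W \<and> x \<in> W \<and> C_infinity_on W gauge.\<mu>" by blast
qed

text \<open>Dividing both points by the same number \<open>\<mu> y\<close> preserves the agreement
  of the finitely many functionals, so \<open>z\<close> scaled by the gauge of \<open>y\<close> also
  lies on level 1 of \<open>\<Phi>\<close>. This gives one inequality, and symmetry the
  other.\<close>

lemma LFC_gauge: "LFC gauge.\<mu>"
  unfolding LFC_def
proof (rule ballI)
  fix x assume "x \<in> unit_sphere gauge.\<mu>"
  then have "x \<noteq> 0" using gauge.\<mu>_0 by (auto simp: unit_sphere_def)
  then obtain U m r s where U: "open U" "x \<in> U" "0 < r" "r < 1" "0 < s"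
    "\<And>y. y \<in> U \<Longrightarrow> norm y < r * s" "\<And>y. y \<in> U \<Longrightarrow> s < gauge.\<mu> y"
    "\<And>z. norm z \<le> r \<Longrightarrow> \<Phi> z = (\<Sum>n<m. bowl n (g n z))"
    by (rule ex_finitely_determined_nbhd) blast
  have le: "gauge.\<mu> z \<le> gauge.\<mu> y" if y: "y \<in> U" and z: "z \<in> U" and eq: "\<forall>l\<in>g ` {..<m}. blinfun_apply l y = l z" for y z
  proof -
    have y_pos: "gauge.\<mu> y > 0" "y \<noteq> 0" using U(5) U(7)[OF y] gauge.\<mu>_0 by auto
    have small: "norm (w /\<^sub>R gauge.\<mu> y) \<le> r" if "w \<in> U" for w
    proof -
      have "norm w \<le> r * gauge.\<mu> y"
        using U(6)[OF that] mult_strict_left_mono[OF U(7)[OF y] U(3)] by linarith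
      then show ?thesis using y_pos by (simp add: field_simps)
    qed
    have "\<Phi> (z /\<^sub>R gauge.\<mu> y) = \<Phi> (y /\<^sub>R gauge.\<mu> y)"
      unfolding U(8)[OF small[OF y]] U(8)[OF small[OF z]] using eq by (simp add: blinfun.bilinear_simps)
    also have "\<dots> = 1" by (rule gauge.\<Phi>_\<mu>[OF y_pos(2)])
    finally have "\<Phi> (z /\<^sub>R gauge.\<mu> y) \<le> 1" by simp
    moreover have "norm (z /\<^sub>R gauge.\<mu> y) < 1"
      using small[OF z] U(4) by linarith
    then have "norm z < gauge.\<mu> y" using y_pos by (simp add: field_simps)
    ultimately show ?thesis by (simp add: gauge.\<mu>_le_iff)
  qed
  show "\<exists>U F. open U \<and> x \<in> U \<and> finite (F :: ('a \<Rightarrow>\<^sub>L real) set) \<and>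
      (\<forall>y\<in>U. \<forall>z\<in>U. (\<forall>f\<in>F. blinfun_apply f y = blinfun_apply f z) \<longrightarrow> gauge.\<mu> y = gauge.\<mu> z)"
    using U(1,2) le by (intro exI[of _ U] exI[of _ "g ` {..<m}"]) (auto intro!: antisym)
qed

end

section \<open>Power series with an absolute norm\<close>

text \<open>Fubini for a double series with a summable majorant; it is needed to reorder a series of
  power series by degree.\<close>

lemma double_sums:
  fixes F A :: "nat \<Rightarrow> nat \<Rightarrow> real"
  assumes F_le: "\<And>k n. \<bar>F k n\<bar> \<le> A k n" and A: "\<And>k. summable (A k)" "\<And>k. (\<Sum>n. A k n) \<le> M k"
    and M: "summable M" and s: "\<And>k. F k sums s k"
  shows "summable (\<lambda>k. F k n)" "(\<lambda>n. \<Sum>k. F k n) sums (\<Sum>k. s k)" "summable s"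
proof -
  have A_nonneg: "0 \<le> A k n" for k n using F_le[of k n] by linarith
  have sum_A_le: "(\<Sum>n<N. A k n) \<le> M k" for k N
    by (rule order.trans[OF sum_le_suminf A(2)]) (auto simp: A A_nonneg)
  then have M_nonneg: "0 \<le> M k" for k
    using sum_A_le[of k 0] by simp
  have "(\<lambda>(k, n). A k n) summable_on UNIV \<times> UNIV"
  proof (rule nonneg_bdd_above_summable_on)
    show "bdd_above (sum (\<lambda>(k, n). A k n) ` {X. X \<subseteq> UNIV \<times> UNIV \<and> finite X})"
    proof (rule bdd_aboveI2)
      fix X :: "(nat \<times> nat) set" assume "X \<in> {X. X \<subseteq> UNIV \<times> UNIV \<and> finite X}"
      then have "finite X" by simp
      then obtain K N where "X \<subseteq> {..<K} \<times> {..<N}"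
      proof -
        have "finite (fst ` X)" "finite (snd ` X)" using \<open>finite X\<close> by simp_all
        then obtain K N where "fst ` X \<subseteq> {..<K}" "snd ` X \<subseteq> {..<N}"
          by (meson finite_nat_iff_bounded)
        then have "X \<subseteq> {..<K} \<times> {..<N}" by force
        then show thesis by (rule that)
      qed
      then have "(\<Sum>(k, n)\<in>X. A k n) \<le> (\<Sum>(k, n)\<in>{..<K} \<times> {..<N}. A k n)"
        by (intro sum_mono2) (auto simp: A_nonneg)
      also have "\<dots> = (\<Sum>k<K. \<Sum>n<N. A k n)" by (simp add: sum.cartesian_product)
      also have "\<dots> \<le> (\<Sum>k<K. M k)" by (intro sum_mono sum_A_le)
      also have "\<dots> \<le> suminf M" by (intro sum_le_suminf M) (auto simp: M_nonneg)
      finally show "(\<Sum>(k, n)\<in>X. A k n) \<le> suminf M" .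
    qed
  qed (auto simp: A_nonneg)
  then have "(\<lambda>z. norm (case z of (k, n) \<Rightarrow> F k n)) summable_on UNIV \<times> UNIV"
    by (rule Infinite_Sum.abs_summable_on_comparison_test') (auto simp: F_le)
  then have F: "(\<lambda>(k, n). F k n) summable_on UNIV \<times> UNIV"
    by (rule Infinite_Sum.abs_summable_summable)
  then obtain T where T: "((\<lambda>(k, n). F k n) has_sum T) (UNIV \<times> UNIV)"
    by (auto simp: summable_on_def)
  have "(F k has_sum s k) UNIV" for k
  proof (rule norm_summable_imp_has_sum[OF _ s])
    show "summable (\<lambda>n. norm (F k n))"
      by (rule summable_comparison_test'[OF A(1)[of k], of 0]) (simp add: F_le)
  qed
  then have s_sums: "s sums T"
    using has_sum_SigmaD[OF T, of s] by (auto intro: has_sum_imp_sums)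
  then show "summable s" by (rule sums_summable)
  have T': "((\<lambda>(n, k). F k n) has_sum T) (UNIV \<times> UNIV)"
    using T by (subst (asm) has_sum_swap) simp
  then have "(\<lambda>(n, k). F k n) summable_on UNIV \<times> UNIV"
    by (auto simp: summable_on_def)
  then have col: "(\<lambda>k. F k n) summable_on UNIV" for n
    by (rule summable_on_SigmaD1) simp
  then have col_sums: "(\<lambda>k. F k n) sums (\<Sum>\<^sub>\<infinity>k. F k n)" for n
    by (intro has_sum_imp_sums has_sum_infsum)
  then show "summable (\<lambda>k. F k n)" by (rule sums_summable)
  have "((\<lambda>n. \<Sum>\<^sub>\<infinity>k. F k n) has_sum T) UNIV"
    using col by (intro has_sum_SigmaD[OF T']) (auto intro: has_sum_infsum)
  then have "(\<lambda>n. \<Sum>\<^sub>\<infinity>k. F k n) sums T" by (rule has_sum_imp_sums)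
  moreover have "(\<Sum>\<^sub>\<infinity>k. F k n) = (\<Sum>k. F k n)" for n
    using sums_unique[OF col_sums] .
  ultimately show "(\<lambda>n. \<Sum>k. F k n) sums (\<Sum>k. s k)"
    using sums_unique[OF s_sums] by simp
qed

definition multilinear_le :: "nat \<Rightarrow> ('a::real_normed_vector list \<Rightarrow> real) \<Rightarrow> real \<Rightarrow> bool" where
  "multilinear_le n L a \<longleftrightarrow>
     (\<forall>vs i. length vs = n \<longrightarrow> i < n \<longrightarrow> linear (\<lambda>u. L (vs[i := u]))) \<and>
     (\<forall>vs. length vs = n \<longrightarrow> \<bar>L vs\<bar> \<le> a * prod_list (map norm vs))"

text \<open>Around \<open>x\<close> the function is a power series with absolute norm at most \<open>M\<close> at radius \<open>r\<close>. These
  norms are submultiplicative, as \<open>n\<close>-linear forms need not be symmetric here.\<close>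

definition power_series_le :: "('a::real_normed_vector \<Rightarrow> real) \<Rightarrow> 'a \<Rightarrow> real \<Rightarrow> real \<Rightarrow> bool" where
  "power_series_le f x r M \<longleftrightarrow> 0 < r \<and> (\<exists>L a. (\<forall>n. multilinear_le n (L n) (a n)) \<and> (\<forall>n. 0 \<le> a n) \<and>
     summable (\<lambda>n. a n * r ^ n) \<and> (\<Sum>n. a n * r ^ n) \<le> M \<and>
     (\<forall>h. norm h < r \<longrightarrow> (\<lambda>n. L n (replicate n h)) sums f (x + h)))"

lemma power_series_leI:
  assumes "0 < r" "\<And>n. multilinear_le n (L n) (a n)" "\<And>n. 0 \<le> a n"
     "summable (\<lambda>n. a n * r ^ n)" "(\<Sum>n. a n * r ^ n) \<le> M"
     "\<And>h. norm h < r \<Longrightarrow> (\<lambda>n. L n (replicate n h)) sums f (x + h)"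
  shows "power_series_le f x r M"
  unfolding power_series_le_def using assms by blast

lemma power_series_leE:
  assumes "power_series_le f x r M"
  obtains L a where "0 < r" "\<And>n. multilinear_le n (L n) (a n)" "\<And>n. 0 \<le> a n"
     "summable (\<lambda>n. a n * r ^ n)" "(\<Sum>n. a n * r ^ n) \<le> M"
     "\<And>h. norm h < r \<Longrightarrow> (\<lambda>n. L n (replicate n h)) sums f (x + h)"
proof -
  from assms obtain L a where "0 < r \<and> (\<forall>n. multilinear_le n (L n) (a n)) \<and> (\<forall>n. 0 \<le> a n) \<and>
     summable (\<lambda>n. a n * r ^ n) \<and> (\<Sum>n. a n * r ^ n) \<le> M \<and>
     (\<forall>h. norm h < r \<longrightarrow> (\<lambda>n. L n (replicate n h)) sums f (x + h))"
    unfolding power_series_le_def by (elim conjE exE) simp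
  then show thesis by (intro that[of L a]) simp_all
qed

lemma multilinear_le_replicate:
  assumes "multilinear_le n L a"
  shows "\<bar>L (replicate n h)\<bar> \<le> a * norm h ^ n"
proof -
  have "length (replicate n h) = n" by simp
  then have "\<bar>L (replicate n h)\<bar> \<le> a * prod_list (map norm (replicate n h))"
    using assms unfolding multilinear_le_def by blast
  then show ?thesis by (simp add: map_replicate prod_list_replicate)
qed

lemma power_series_le_cong:
  assumes "power_series_le f x r M" "\<And>y. norm (y - x) < r \<Longrightarrow> f y = g y"
  shows "power_series_le g x r M"
proof -
  obtain L a where La: "0 < r" "\<And>n. multilinear_le n (L n) (a n)" "\<And>n. 0 \<le> a n"
     "summable (\<lambda>n. a n * r ^ n)" "(\<Sum>n. a n * r ^ n) \<le> M"
     "\<And>h. norm h < r \<Longrightarrow> (\<lambda>n. L n (replicate n h)) sums f (x + h)"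
    by (rule power_series_leE[OF assms(1)]) blast
  show ?thesis
    by (rule power_series_leI[of r L a]) (use La assms(2)[of "x + h" for h] in auto)
qed

lemma power_series_le_mono: "power_series_le f x r M \<Longrightarrow> M \<le> M' \<Longrightarrow> power_series_le f x r M'"
  unfolding power_series_le_def by (meson order.trans)

lemma power_series_le_bound:
  assumes "power_series_le f x r M" "norm (y - x) < r"
  shows "\<bar>f y\<bar> \<le> M"
proof -
  obtain L a where La: "0 < r" "\<And>n. multilinear_le n (L n) (a n)" "\<And>n. 0 \<le> a n"
     "summable (\<lambda>n. a n * r ^ n)" "(\<Sum>n. a n * r ^ n) \<le> M"
     "\<And>h. norm h < r \<Longrightarrow> (\<lambda>n. L n (replicate n h)) sums f (x + h)"
    by (rule power_series_leE[OF assms(1)]) blast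
  have le: "norm (L n (replicate n (y - x))) \<le> a n * r ^ n" for n
    using multilinear_le_replicate[OF La(2)[of n], of "y - x"] La(3)[of n]
      mult_left_mono[OF power_mono[of "norm (y - x)" r n], of "a n"] assms(2) by simp
  have "f y = (\<Sum>n. L n (replicate n (y - x)))"
    using La(6)[OF assms(2)] by (simp add: sums_iff)
  also have "norm \<dots> \<le> (\<Sum>n. a n * r ^ n)"
    by (rule norm_suminf_le[OF le La(4)])
  finally show ?thesis using La(5) by simp
qed

text \<open>All terms of positive degree gain a factor \<open>s / r\<close>, so the absolute norm
  approaches the modulus of the constant term. The bound holds for all small radii because several
  functions have to share one radius later.\<close>

lemma power_series_le_shrink:
  assumes f: "power_series_le f x r M" and \<eta>: "\<eta> > 0"
  shows "\<exists>r'>0. r' \<le> r \<and> (\<forall>s. 0 < s \<longrightarrow> s \<le> r' \<longrightarrow> power_series_le f x s (\<bar>f x\<bar> + \<eta>))"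
proof -
  obtain L a where La: "0 < r" "\<And>n. multilinear_le n (L n) (a n)" "\<And>n. 0 \<le> a n"
     "summable (\<lambda>n. a n * r ^ n)" "(\<Sum>n. a n * r ^ n) \<le> M"
     "\<And>h. norm h < r \<Longrightarrow> (\<lambda>n. L n (replicate n h)) sums f (x + h)"
    by (rule power_series_leE[OF f]) blast
  \<comment> \<open>The given constant \<open>a 0\<close> may be larger than needed; the form of
    degree 0 is the number \<open>f x\<close>, whose modulus is the optimal bound.\<close>
  define b where "b n = (if n = 0 then \<bar>f x\<bar> else a n)" for n
  have "(\<lambda>n. L n (replicate n (0::'a))) sums L 0 []"
  proof -
    have "L n (replicate n 0) = 0" if "n \<noteq> 0" for n
      using multilinear_le_replicate[OF La(2)[of n], of 0] that by (simp add: power_0_left)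
    then have "(\<lambda>n. L n (replicate n (0::'a))) sums (\<Sum>n\<in>{0}. L n (replicate n 0))"
      by (intro sums_finite) auto
    then show ?thesis by simp
  qed
  then have L0: "L 0 [] = f x"
    using La(6)[of 0] La(1) by (auto dest: sums_unique2)
  have mb: "multilinear_le n (L n) (b n)" for n
    using La(2)[of n] L0 by (auto simp: b_def multilinear_le_def)
  have b: "b n \<ge> 0" for n using La(3) by (simp add: b_def)
  have a_tail: "summable (\<lambda>n. a (Suc n) * r ^ Suc n)"
    using La(4) by (subst summable_Suc_iff)
  define K where "K = (\<Sum>n. a (Suc n) * r ^ Suc n)"
  have "K \<ge> 0" unfolding K_def by (intro suminf_nonneg a_tail mult_nonneg_nonneg) (use La(1,3) in auto)
  have main: "summable (\<lambda>n. b n * s ^ n) \<and> (\<Sum>n. b n * s ^ n) \<le> \<bar>f x\<bar> + s / r * K" if s: "0 < s" "s \<le> r" for s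
  proof -
    have le: "b (Suc n) * s ^ Suc n \<le> s / r * (a (Suc n) * r ^ Suc n)" for n
    proof -
      have "a (Suc n) * (s * s ^ n) \<le> a (Suc n) * (s * r ^ n)"
        using s La(3) by (intro mult_left_mono power_mono) auto
      then show ?thesis using s La(1) by (simp add: b_def mult.left_commute)
    qed
    have sm: "summable (\<lambda>n. b (Suc n) * s ^ Suc n)"
      by (rule summable_comparison_test'[OF summable_mult[OF a_tail, of "s / r"], of 0])
         (use le b s in \<open>simp add: abs_mult\<close>)
    then have "summable (\<lambda>n. b n * s ^ n)" by (subst (asm) summable_Suc_iff)
    moreover have "(\<Sum>n. b n * s ^ n) = (\<Sum>n. b (Suc n) * s ^ Suc n) + b 0"
      using suminf_split_head[OF \<open>summable (\<lambda>n. b n * s ^ n)\<close>] by simp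
    moreover have "(\<Sum>n. b (Suc n) * s ^ Suc n) \<le> (\<Sum>n. s / r * (a (Suc n) * r ^ Suc n))"
      by (intro suminf_le le sm summable_mult a_tail)
    moreover have "\<dots> = s / r * K" unfolding K_def by (rule suminf_mult[OF a_tail])
    ultimately show ?thesis by (simp add: b_def)
  qed
  \<comment> \<open>This makes \<open>s / r * K\<close> at most \<open>\<eta>\<close>; the 1 avoids
    a division by zero.\<close>
  define r' where "r' = min r (r * \<eta> / (K + 1))"
  have "0 < r'" using La(1) \<eta> \<open>K \<ge> 0\<close> by (simp add: r'_def)
  show ?thesis
  proof (intro exI[of _ r'] conjI allI impI)
    show "0 < r'" by fact
    show "r' \<le> r" by (simp add: r'_def)
    fix s assume s: "0 < s" "s \<le> r'"
    then have "s \<le> r" "s \<le> r * \<eta> / (K + 1)" by (simp_all add: r'_def)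
    have "s * K \<le> r * \<eta> / (K + 1) * K"
      using \<open>s \<le> r * \<eta> / (K + 1)\<close> \<open>K \<ge> 0\<close> by (intro mult_right_mono)
    also have "\<dots> = r * \<eta> * (K / (K + 1))" by simp
    also have "\<dots> \<le> r * \<eta> * 1"
      using La(1) \<eta> \<open>K \<ge> 0\<close> by (intro mult_left_mono) auto
    finally have "s / r * K \<le> \<eta>" using La(1) by (simp add: field_simps)
    with main[OF s(1) \<open>s \<le> r\<close>] show "power_series_le f x s (\<bar>f x\<bar> + \<eta>)"
      using \<open>s \<le> r\<close> La(6) s(1) b mb by (intro power_series_leI[of s L b]) auto
  qed
qed

section \<open>Operations on absolutely convergent power series\<close>

lemma power_series_le_const:
  assumes "0 < r"
  shows "power_series_le (\<lambda>_. c) x r \<bar>c\<bar>"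
proof (rule power_series_leI[of r "\<lambda>n vs. if n = 0 then c else 0" "\<lambda>n. if n = 0 then \<bar>c\<bar> else 0"])
  have "(\<lambda>n. (if n = 0 then \<bar>c\<bar> else 0) * r ^ n) sums (\<Sum>n\<in>{0}. (if n = 0 then \<bar>c\<bar> else 0) * r ^ n)"
    by (rule sums_finite) auto
  then show "summable (\<lambda>n. (if n = 0 then \<bar>c\<bar> else 0) * r ^ n)"
    "(\<Sum>n. (if n = 0 then \<bar>c\<bar> else 0) * r ^ n) \<le> \<bar>c\<bar>"
    by (simp_all add: sums_iff)
  show "(\<lambda>n. if n = 0 then c else 0) sums c"
    using sums_finite[of "{0}" "\<lambda>n. if n = 0 then c else 0"] by simp
qed (use assms in \<open>auto simp: multilinear_le_def linear_iff\<close>)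

lemma power_series_le_functional:
  fixes l :: "'a::real_normed_vector \<Rightarrow>\<^sub>L real"
  assumes "0 < r"
  shows "power_series_le l x r (\<bar>l x\<bar> + r * norm l)"
proof (rule power_series_leI[of r "\<lambda>n vs. if n = 0 then l x else if n = 1 then l (hd vs) else 0"
      "\<lambda>n. if n = 0 then \<bar>l x\<bar> else if n = 1 then norm l else 0"])
  let ?a = "\<lambda>n::nat. if n = 0 then \<bar>l x\<bar> else if n = 1 then norm l else 0"
  have "(\<lambda>n. ?a n * r ^ n) sums (\<Sum>n\<in>{0, 1}. ?a n * r ^ n)"
    by (rule sums_finite) auto
  then show "summable (\<lambda>n. ?a n * r ^ n)" "(\<Sum>n. ?a n * r ^ n) \<le> \<bar>l x\<bar> + r * norm l"
    by (simp_all add: sums_iff mult.commute)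
  fix h
  let ?L = "\<lambda>n::nat. if n = 0 then l x else if n = 1 then l (hd (replicate n h)) else 0"
  have "?L sums (\<Sum>n\<in>{0, 1}. ?L n)"
    by (rule sums_finite) auto
  then show "?L sums l (x + h)" by (simp add: blinfun.bilinear_simps)
next
  fix n
  show "multilinear_le n (\<lambda>vs. if n = 0 then l x else if n = 1 then l (hd vs) else 0)
      (if n = 0 then \<bar>l x\<bar> else if n = 1 then norm l else 0)"
    using norm_blinfun[of l]
    by (auto simp: multilinear_le_def linear_iff blinfun.bilinear_simps length_Suc_conv)
qed (use assms in auto)

lemma power_series_le_add:
  assumes "power_series_le f x r M" "power_series_le g x r N"
  shows "power_series_le (\<lambda>y. f y + g y) x r (M + N)"
proof -
  obtain L a where L: "0 < r" "\<And>n. multilinear_le n (L n) (a n)" "\<And>n. 0 \<le> a n"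
     "summable (\<lambda>n. a n * r ^ n)" "(\<Sum>n. a n * r ^ n) \<le> M"
     "\<And>h. norm h < r \<Longrightarrow> (\<lambda>n. L n (replicate n h)) sums f (x + h)"
    by (rule power_series_leE[OF assms(1)]) blast
  obtain L' b where L': "0 < r" "\<And>n. multilinear_le n (L' n) (b n)" "\<And>n. 0 \<le> b n"
     "summable (\<lambda>n. b n * r ^ n)" "(\<Sum>n. b n * r ^ n) \<le> N"
     "\<And>h. norm h < r \<Longrightarrow> (\<lambda>n. L' n (replicate n h)) sums g (x + h)"
    by (rule power_series_leE[OF assms(2)]) blast
  show ?thesis
  proof (rule power_series_leI[of r "\<lambda>n vs. L n vs + L' n vs" "\<lambda>n. a n + b n"])
    fix n
    show "multilinear_le n (\<lambda>vs. L n vs + L' n vs) (a n + b n)"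
      unfolding multilinear_le_def
    proof (intro conjI allI impI)
      fix vs :: "'a list" assume len: "length vs = n"
      show "\<bar>L n vs + L' n vs\<bar> \<le> (a n + b n) * prod_list (map norm vs)"
      proof -
        have "\<bar>L n vs\<bar> \<le> a n * prod_list (map norm vs)" "\<bar>L' n vs\<bar> \<le> b n * prod_list (map norm vs)"
          using L(2)[of n] L'(2)[of n] len by (auto simp: multilinear_le_def)
        then show ?thesis by (simp add: distrib_right)
      qed
      fix i assume "i < n"
      then show "linear (\<lambda>u. L n (vs[i := u]) + L' n (vs[i := u]))"
        using L(2)[of n] L'(2)[of n] len by (intro linear_compose_add) (auto simp: multilinear_le_def)
    qed
  next
    show "summable (\<lambda>n. (a n + b n) * r ^ n)" "(\<Sum>n. (a n + b n) * r ^ n) \<le> M + N"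
      using suminf_add[OF L(4) L'(4)] summable_add[OF L(4) L'(4)] L(5) L'(5)
      by (simp_all add: distrib_right)
  qed (use L L' in \<open>auto intro: sums_add add_nonneg_nonneg\<close>)
qed

lemma power_series_le_mult:
  assumes "power_series_le f x r M" "power_series_le g x r N"
  shows "power_series_le (\<lambda>y. f y * g y) x r (M * N)"
proof -
  obtain L a where L: "0 < r" "\<And>n. multilinear_le n (L n) (a n)" "\<And>n. 0 \<le> a n"
     "summable (\<lambda>n. a n * r ^ n)" "(\<Sum>n. a n * r ^ n) \<le> M"
     "\<And>h. norm h < r \<Longrightarrow> (\<lambda>n. L n (replicate n h)) sums f (x + h)"
    by (rule power_series_leE[OF assms(1)]) blast
  obtain L' b where L': "0 < r" "\<And>n. multilinear_le n (L' n) (b n)" "\<And>n. 0 \<le> b n"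
     "summable (\<lambda>n. b n * r ^ n)" "(\<Sum>n. b n * r ^ n) \<le> N"
     "\<And>h. norm h < r \<Longrightarrow> (\<lambda>n. L' n (replicate n h)) sums g (x + h)"
    by (rule power_series_leE[OF assms(2)]) blast
  \<comment> \<open>The Cauchy product: the first \<open>i\<close> vectors go to the first form and
    the remaining ones to the second, so that the constants simply convolve.\<close>
  define LL where "LL n vs = (\<Sum>i\<le>n. L i (take i vs) * L' (n - i) (drop i vs))" for n vs
  define c where "c n = (\<Sum>i\<le>n. a i * b (n - i))" for n
  have c_eq: "c n * r ^ n = (\<Sum>i\<le>n. (a i * r ^ i) * (b (n - i) * r ^ (n - i)))" for n
    unfolding c_def sum_distrib_right
    by (intro sum.cong refl) (simp add: mult_ac flip: power_add)
  have c_sums: "(\<lambda>n. c n * r ^ n) sums ((\<Sum>n. a n * r ^ n) * (\<Sum>n. b n * r ^ n))"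
    unfolding c_eq using L L' by (intro Cauchy_product_sums) (simp_all add: abs_mult)
  show ?thesis
  proof (rule power_series_leI[of r LL c])
    fix n
    show "multilinear_le n (LL n) (c n)"
      unfolding multilinear_le_def
    proof (intro conjI allI impI)
      fix vs :: "'a list" assume len: "length vs = n"
      have "\<bar>LL n vs\<bar> \<le> (\<Sum>i\<le>n. (a i * prod_list (map norm (take i vs))) * (b (n - i) * prod_list (map norm (drop i vs))))"
        unfolding LL_def
      proof (intro order.trans[OF sum_abs] sum_mono)
        fix i assume "i \<in> {..n}"
        then have "\<bar>L i (take i vs)\<bar> \<le> a i * prod_list (map norm (take i vs))"
          "\<bar>L' (n - i) (drop i vs)\<bar> \<le> b (n - i) * prod_list (map norm (drop i vs))"
          using L(2)[of i] L'(2)[of "n - i"] len by (auto simp: multilinear_le_def)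
        then show "\<bar>L i (take i vs) * L' (n - i) (drop i vs)\<bar> \<le>
            (a i * prod_list (map norm (take i vs))) * (b (n - i) * prod_list (map norm (drop i vs)))"
          unfolding abs_mult by (intro mult_mono) auto
      qed
      also have "\<dots> = (\<Sum>i\<le>n. a i * b (n - i) * prod_list (map norm vs))"
      proof (intro sum.cong refl)
        fix i
        have "prod_list (map norm vs) = prod_list (map norm (take i vs)) * prod_list (map norm (drop i vs))"
          by (metis append_take_drop_id map_append prod_list.append)
        then show "(a i * prod_list (map norm (take i vs))) * (b (n - i) * prod_list (map norm (drop i vs))) =
            a i * b (n - i) * prod_list (map norm vs)" by simp
      qed
      finally show "\<bar>LL n vs\<bar> \<le> c n * prod_list (map norm vs)"
        by (simp add: c_def sum_distrib_right)
      fix j assume j: "j < n"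
      have "linear (\<lambda>u. L i (take i (vs[j := u])) * L' (n - i) (drop i (vs[j := u])))" if "i \<le> n" for i
      proof (cases "j < i")
        case True
        then have "linear (\<lambda>u. L i ((take i vs)[j := u]))"
          using L(2)[of i] len that by (simp add: multilinear_le_def)
        then show ?thesis using True by (simp add: take_update_swap linear_iff algebra_simps)
      next
        case False
        then have "linear (\<lambda>u. L' (n - i) ((drop i vs)[j - i := u]))"
          using L'(2)[of "n - i"] len that j by (simp add: multilinear_le_def)
        then show ?thesis using False by (simp add: drop_update_swap linear_iff algebra_simps)
      qed
      then show "linear (\<lambda>u. LL n (vs[j := u]))"
        unfolding LL_def by (intro linear_compose_sum) auto
    qed
  next
    show "summable (\<lambda>n. c n * r ^ n)" using c_sums by (rule sums_summable)
    have "(\<Sum>n. c n * r ^ n) = (\<Sum>n. a n * r ^ n) * (\<Sum>n. b n * r ^ n)"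
      using c_sums by (simp add: sums_iff)
    also have "\<dots> \<le> M * N"
      using L L' suminf_nonneg[OF L(4)] suminf_nonneg[OF L'(4)] by (intro mult_mono) auto
    finally show "(\<Sum>n. c n * r ^ n) \<le> M * N" .
    show "0 \<le> c n" for n using L(3) L'(3) by (auto simp: c_def intro!: sum_nonneg)
  next
    fix h :: 'a assume h: "norm h < r"
    have 1: "summable (\<lambda>n. norm (L n (replicate n h)))"
    proof (rule summable_comparison_test'[OF L(4), of 0])
      show "norm (norm (L n (replicate n h))) \<le> a n * r ^ n" for n
        using multilinear_le_replicate[OF L(2)[of n], of h] L(3)[of n]
          mult_left_mono[OF power_mono[of "norm h" r n], of "a n"] h by simp
    qed
    have 2: "summable (\<lambda>n. norm (L' n (replicate n h)))"
    proof (rule summable_comparison_test'[OF L'(4), of 0])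
      show "norm (norm (L' n (replicate n h))) \<le> b n * r ^ n" for n
        using multilinear_le_replicate[OF L'(2)[of n], of h] L'(3)[of n]
          mult_left_mono[OF power_mono[of "norm h" r n], of "b n"] h by simp
    qed
    have "LL n (replicate n h) = (\<Sum>i\<le>n. L i (replicate i h) * L' (n - i) (replicate (n - i) h))" for n
      unfolding LL_def by (intro sum.cong) (auto simp: min_def)
    then show "(\<lambda>n. LL n (replicate n h)) sums (f (x + h) * g (x + h))"
      using Cauchy_product_sums[OF 1 2] L(6)[OF h] L'(6)[OF h] by (simp add: sums_iff)
  qed (rule L(1))
qed

lemma power_series_le_power:
  assumes "power_series_le f x r M"
  shows "power_series_le (\<lambda>y. f y ^ k) x r (M ^ k)"
proof (induction k)
  case 0
  have "0 < r" using assms by (simp add: power_series_le_def)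
  then show ?case using power_series_le_const[of r 1 x] by simp
next
  case (Suc k)
  then show ?case using power_series_le_mult[OF assms] by simp
qed

lemma power_series_le_cmult:
  assumes "power_series_le f x r M"
  shows "power_series_le (\<lambda>y. c * f y) x r (\<bar>c\<bar> * M)"
  using assms power_series_le_mult[OF power_series_le_const assms, of c]
  by (simp add: power_series_le_def)

text \<open>Completeness for the absolute norm: the forms are added degree by degree, and the
  summable bounds \<open>M k\<close> justify exchanging the two summations.\<close>

lemma power_series_le_suminf:
  assumes r: "0 < r" and f: "\<And>k. power_series_le (f k) x r (M k)" and M: "summable M"
  shows "power_series_le (\<lambda>y. \<Sum>k. f k y) x r (\<Sum>k. M k)"
proof -
  have "\<forall>k. \<exists>L a. (\<forall>n. multilinear_le n (L n) (a n)) \<and> (\<forall>n. 0 \<le> a n) \<and>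
     summable (\<lambda>n. a n * r ^ n) \<and> (\<Sum>n. a n * r ^ n) \<le> M k \<and>
     (\<forall>h. norm h < r \<longrightarrow> (\<lambda>n. L n (replicate n h)) sums f k (x + h))"
    using f unfolding power_series_le_def by simp
  then obtain L where "\<forall>k. \<exists>a. (\<forall>n. multilinear_le n (L k n) (a n)) \<and> (\<forall>n. 0 \<le> a n) \<and>
     summable (\<lambda>n. a n * r ^ n) \<and> (\<Sum>n. a n * r ^ n) \<le> M k \<and>
     (\<forall>h. norm h < r \<longrightarrow> (\<lambda>n. L k n (replicate n h)) sums f k (x + h))"
    by (rule choice[THEN exE])
  then obtain a where La: "\<forall>k. (\<forall>n. multilinear_le n (L k n) (a k n)) \<and> (\<forall>n. 0 \<le> a k n) \<and>
     summable (\<lambda>n. a k n * r ^ n) \<and> (\<Sum>n. a k n * r ^ n) \<le> M k \<and>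
     (\<forall>h. norm h < r \<longrightarrow> (\<lambda>n. L k n (replicate n h)) sums f k (x + h))"
    by (rule choice[THEN exE])
  then have lin: "\<And>k n. multilinear_le n (L k n) (a k n)" and nonneg: "\<And>k n. 0 \<le> a k n"
    and sm: "\<And>k. summable (\<lambda>n. a k n * r ^ n)" and le: "\<And>k. (\<Sum>n. a k n * r ^ n) \<le> M k"
    and ser: "\<And>k h. norm h < r \<Longrightarrow> (\<lambda>n. L k n (replicate n h)) sums f k (x + h)"
    by simp_all
  have "\<And>k n. \<bar>a k n * r ^ n\<bar> \<le> a k n * r ^ n" using nonneg r by simp
  note D = double_sums[OF this sm le M summable_sums[OF sm]]
  have a_sm: "summable (\<lambda>k. a k n)" for n
    using summable_divide[OF D(1)[of n], of "r ^ n"] r by simp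
  have sum_eq: "(\<Sum>k. a k n * r ^ n) = (\<Sum>k. a k n) * r ^ n" for n
    using suminf_mult2[OF a_sm] by simp
  have L_sm: "summable (\<lambda>k. L k n vs)" "\<bar>\<Sum>k. L k n vs\<bar> \<le> (\<Sum>k. a k n) * prod_list (map norm vs)"
    if "length vs = n" for n vs
  proof -
    have L_le: "norm (L k n vs) \<le> a k n * prod_list (map norm vs)" for k
      using lin[of n k] that by (simp add: multilinear_le_def)
    have 1: "summable (\<lambda>k. a k n * prod_list (map norm vs))" by (rule summable_mult2[OF a_sm])
    show "summable (\<lambda>k. L k n vs)"
      by (rule summable_comparison_test'[OF 1, of 0]) (rule L_le)
    have "norm (\<Sum>k. L k n vs) \<le> (\<Sum>k. a k n * prod_list (map norm vs))"
      by (rule norm_suminf_le[OF L_le 1])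
    then show "\<bar>\<Sum>k. L k n vs\<bar> \<le> (\<Sum>k. a k n) * prod_list (map norm vs)"
      using suminf_mult2[OF a_sm] by simp
  qed
  show ?thesis
  proof (rule power_series_leI[of r "\<lambda>n vs. \<Sum>k. L k n vs" "\<lambda>n. \<Sum>k. a k n"])
    fix n
    show "multilinear_le n (\<lambda>vs. \<Sum>k. L k n vs) (\<Sum>k. a k n)"
      unfolding multilinear_le_def
    proof (intro conjI allI impI L_sm(2))
      fix vs :: "'a list" and i assume len: "length vs = n" "i < n"
      have l: "linear (\<lambda>u. L k n (vs[i := u]))" for k
        using lin[of n k] len by (simp add: multilinear_le_def)
      have s: "summable (\<lambda>k. L k n (vs[i := u]))" for u
        using L_sm(1)[of "vs[i := u]" n] len by simp
      show "linear (\<lambda>u. \<Sum>k. L k n (vs[i := u]))"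
        by (intro linearI)
          (simp_all add: linear_add[OF l] linear_scale[OF l] suminf_add[OF s s] suminf_mult[OF s])
    qed
    show "0 \<le> (\<Sum>k. a k n)" by (intro suminf_nonneg a_sm nonneg)
  next
    show "summable (\<lambda>n. (\<Sum>k. a k n) * r ^ n)"
      using D(2) by (simp add: sum_eq sums_iff)
    have "(\<Sum>n. (\<Sum>k. a k n) * r ^ n) = (\<Sum>k. \<Sum>n. a k n * r ^ n)"
      using D(2) by (simp add: sum_eq sums_iff)
    also have "\<dots> \<le> (\<Sum>k. M k)"
      by (rule suminf_le[OF le D(3) M])
    finally show "(\<Sum>n. (\<Sum>k. a k n) * r ^ n) \<le> (\<Sum>k. M k)" .
  next
    fix h :: 'a assume h: "norm h < r"
    have "\<bar>L k n (replicate n h)\<bar> \<le> a k n * r ^ n" for k n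
      using multilinear_le_replicate[OF lin[of n k], of h] nonneg[of k n]
          mult_left_mono[OF power_mono[of "norm h" r n], of "a k n"] h by simp
    from double_sums(2)[OF this sm le M ser[OF h]]
    show "(\<lambda>n. \<Sum>k. L k n (replicate n h)) sums (\<Sum>k. f k (x + h))" .
  qed (rule r)
qed

lemma power_series_le_compose:
  assumes "power_series_le f x r M" "summable (\<lambda>k. \<bar>c k\<bar> * M ^ k)"
  shows "power_series_le (\<lambda>y. \<Sum>k. c k * f y ^ k) x r (\<Sum>k. \<bar>c k\<bar> * M ^ k)"
  using assms power_series_le_cmult[OF power_series_le_power[OF assms(1)]]
  by (intro power_series_le_suminf) (auto simp: power_series_le_def)

lemma power_series_le_nonneg: "power_series_le f x r M \<Longrightarrow> 0 \<le> M"
  using power_series_le_bound[of f x r M x] by (auto simp: power_series_le_def)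

lemma power_series_le_inverse:
  assumes f: "power_series_le f x r M" and M: "M < 1"
  shows "power_series_le (\<lambda>y. inverse (1 + f y)) x r (1 / (1 - M))"
proof -
  have M0: "0 \<le> M" by (rule power_series_le_nonneg[OF f])
  have sums: "(\<lambda>k. \<bar>(- 1) ^ k\<bar> * M ^ k) sums (1 / (1 - M))"
    using geometric_sums[of M] M M0 by (simp add: power_abs)
  have "power_series_le (\<lambda>y. \<Sum>k. (- 1) ^ k * f y ^ k) x r (1 / (1 - M))"
    using power_series_le_compose[OF f sums_summable[OF sums]] sums by (simp add: sums_iff)
  then show ?thesis
  proof (rule power_series_le_cong)
    fix y assume "norm (y - x) < r"
    then have "\<bar>f y\<bar> \<le> M" by (rule power_series_le_bound[OF f])
    then have "(\<lambda>k. (- f y) ^ k) sums (1 / (1 - (- f y)))"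
      using M by (intro geometric_sums) auto
    then show "(\<Sum>k. (- 1) ^ k * f y ^ k) = inverse (1 + f y)"
      by (simp add: sums_iff inverse_eq_divide flip: power_mult_distrib)
  qed
qed

text \<open>One factor \<open>f\<close> is taken out of the logarithmic series. The remaining
  coefficients are at most 1 in modulus, so a geometric series bounds the rest.\<close>

lemma power_series_le_ln:
  assumes f: "power_series_le f x r M" and M: "M < 1"
  shows "power_series_le (\<lambda>y. ln (1 + f y)) x r (M / (1 - M))"
proof -
  have M0: "0 \<le> M" by (rule power_series_le_nonneg[OF f])
  define c where "c k = (- 1) ^ k / real (Suc k)" for k
  have sums: "(\<lambda>k. M ^ k) sums (1 / (1 - M))"
    using geometric_sums[of M] M M0 by simp
  have c_le: "\<bar>c k\<bar> * M ^ k \<le> M ^ k" for k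
    using mult_right_mono[of "\<bar>c k\<bar>" 1 "M ^ k"] M0 by (simp add: c_def power_abs)
  have sm: "summable (\<lambda>k. \<bar>c k\<bar> * M ^ k)"
    by (rule summable_comparison_test'[OF sums_summable[OF sums], of 0])
       (use c_le M0 in \<open>simp add: abs_mult\<close>)
  have "(\<Sum>k. \<bar>c k\<bar> * M ^ k) \<le> 1 / (1 - M)"
    using suminf_le[OF c_le sm sums_summable[OF sums]] sums by (simp add: sums_iff)
  with power_series_le_compose[OF f sm] have "power_series_le (\<lambda>y. \<Sum>k. c k * f y ^ k) x r (1 / (1 - M))"
    by (rule power_series_le_mono)
  from power_series_le_mult[OF f this]
  have "power_series_le (\<lambda>y. f y * (\<Sum>k. c k * f y ^ k)) x r (M / (1 - M))" by simp
  then show ?thesis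
  proof (rule power_series_le_cong)
    fix y assume "norm (y - x) < r"
    then have fy: "\<bar>f y\<bar> \<le> M" by (rule power_series_le_bound[OF f])
    have "summable (\<lambda>k. c k * f y ^ k)"
      by (rule summable_comparison_test'[OF sm, of 0])
         (use fy in \<open>auto simp: abs_mult power_abs intro!: mult_left_mono power_mono\<close>)
    then have "f y * (\<Sum>k. c k * f y ^ k) = (\<Sum>k. f y * (c k * f y ^ k))"
      by (rule suminf_mult[symmetric])
    also have "\<dots> = ln (1 + f y)"
      using ln_series[of "1 + f y"] fy M by (simp add: c_def mult_ac)
    finally show "f y * (\<Sum>k. c k * f y ^ k) = ln (1 + f y)" .
  qed
qed

lemma power_series_le_exp:
  assumes f: "power_series_le f x r M"
  shows "power_series_le (\<lambda>y. exp (f y)) x r (exp M)"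
proof -
  have e: "exp (z :: real) = (\<Sum>k. inverse (fact k) * z ^ k)" "summable (\<lambda>k. inverse (fact k) * z ^ k)" for z
    using summable_exp[of z] by (simp_all add: exp_def divide_inverse mult.commute)
  have "power_series_le (\<lambda>y. \<Sum>k. inverse (fact k) * f y ^ k) x r (\<Sum>k. \<bar>inverse (fact k)\<bar> * M ^ k)"
    using e(2)[of M] by (intro power_series_le_compose[OF f]) simp
  then show ?thesis by (simp add: e(1))
qed

text \<open>The quotient minus 1 vanishes at \<open>x\<close>, so shrinking brings its absolute norm
  down to 1/2, within reach of the series for the reciprocal and the logarithm of 1 + u.\<close>

lemma power_series_le_normalize:
  assumes f: "power_series_le f x r M" and "f x \<noteq> 0"
  obtains r' where "0 < r'" "r' \<le> r" "power_series_le (\<lambda>y. f y / f x - 1) x r' (1 / 2)"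
proof -
  let ?u = "\<lambda>y. inverse (f x) * f y + (- 1)"
  have u: "power_series_le ?u x r (\<bar>inverse (f x)\<bar> * M + \<bar>- 1\<bar>)"
    using f by (intro power_series_le_add power_series_le_cmult power_series_le_const)
      (auto simp: power_series_le_def)
  have "(0::real) < 1 / 2" by simp
  from power_series_le_shrink[OF u this] obtain r' where r': "0 < r'" "r' \<le> r"
    and shrunk: "\<forall>s. 0 < s \<longrightarrow> s \<le> r' \<longrightarrow> power_series_le ?u x s (\<bar>?u x\<bar> + 1 / 2)"
    by blast
  have "power_series_le ?u x r' (\<bar>?u x\<bar> + 1 / 2)"
    by (rule shrunk[rule_format, OF r'(1) order_refl])
  moreover have "?u = (\<lambda>y. f y / f x - 1)"
    by (rule ext) (simp only: divide_inverse mult.commute diff_conv_add_uminus)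
  moreover have "\<bar>?u x\<bar> + 1 / 2 = 1 / 2"
    using assms(2) by simp
  ultimately have "power_series_le (\<lambda>y. f y / f x - 1) x r' (1 / 2)"
    by (simp only:)
  with r' show thesis by (rule that)
qed

lemma power_series_le_inverse_at:
  assumes f: "power_series_le f x r M" and ne: "f x \<noteq> 0"
  obtains r' M' where "power_series_le (\<lambda>y. inverse (f y)) x r' M'"
proof -
  obtain r' where "power_series_le (\<lambda>y. f y / f x - 1) x r' (1 / 2)"
    by (rule power_series_le_normalize[OF f ne])
  then have "power_series_le (\<lambda>y. inverse (f x) * inverse (1 + (f y / f x - 1))) x r' (\<bar>inverse (f x)\<bar> * (1 / (1 - 1 / 2)))"
    by (intro power_series_le_cmult power_series_le_inverse) auto
  then show thesis using ne by (intro that) (simp add: field_simps)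
qed

lemma power_series_le_ln_at:
  assumes f: "power_series_le f x r M" and pos: "f x > 0"
  obtains r' M' where "0 < r'" "r' \<le> r" "power_series_le (\<lambda>y. ln (f y)) x r' M'"
proof -
  obtain r' where r': "0 < r'" "r' \<le> r" and u: "power_series_le (\<lambda>y. f y / f x - 1) x r' (1 / 2)"
    by (rule power_series_le_normalize[OF f]) (use pos in auto)
  have "power_series_le (\<lambda>y. ln (f x) + ln (1 + (f y / f x - 1))) x r' (\<bar>ln (f x)\<bar> + 1 / 2 / (1 - 1 / 2))"
    using u r'(1) by (intro power_series_le_add power_series_le_const power_series_le_ln) auto
  then have "power_series_le (\<lambda>y. ln (f y)) x r' (\<bar>ln (f x)\<bar> + 1 / 2 / (1 - 1 / 2))"
  proof (rule power_series_le_cong)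
    fix y assume "norm (y - x) < r'"
    from power_series_le_bound[OF u this] have "f y / f x > 0" by linarith
    then have "f y > 0" using pos by (simp add: zero_less_divide_iff)
    then show "ln (f x) + ln (1 + (f y / f x - 1)) = ln (f y)"
      using pos by (simp add: ln_div)
  qed
  with r' show thesis by (rule that)
qed

lemma real_analytic_on_power_series_le:
  assumes "\<And>x. x \<in> U \<Longrightarrow> \<exists>r M. power_series_le f x r M"
  shows "real_analytic_on U f"
  unfolding real_analytic_on_def
proof (rule ballI)
  fix x assume "x \<in> U"
  then obtain r M where "power_series_le f x r M" using assms by blast
  then obtain L a where La: "0 < r" "\<And>n. multilinear_le n (L n) (a n)" "\<And>n. 0 \<le> a n"
     "summable (\<lambda>n. a n * r ^ n)" "(\<Sum>n. a n * r ^ n) \<le> M"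
     "\<And>h. norm h < r \<Longrightarrow> (\<lambda>n. L n (replicate n h)) sums f (x + h)"
    by (rule power_series_leE) blast
  have "uniform_limit (ball 0 r) (\<lambda>m h. \<Sum>n<m. L n (replicate n h)) (\<lambda>h. \<Sum>n. L n (replicate n h)) sequentially"
  proof (rule Weierstrass_m_test[OF _ La(4)])
    show "norm (L n (replicate n h)) \<le> a n * r ^ n" if "h \<in> ball 0 r" for n h
      using multilinear_le_replicate[OF La(2)[of n], of h] La(3)[of n]
        mult_left_mono[OF power_mono[of "norm h" r n], of "a n"] that by simp
  qed
  moreover have "(\<Sum>n. L n (replicate n h)) = f (x + h)" if "h \<in> ball 0 r" for h
    using La(6)[of h] that by (simp add: sums_iff)
  ultimately have "uniform_limit (ball 0 r) (\<lambda>m h. \<Sum>n<m. L n (replicate n h)) (\<lambda>h. f (x + h)) sequentially"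
    by (subst (asm) uniform_limit_cong'[where g = "\<lambda>m h. \<Sum>n<m. L n (replicate n h)" and i = "\<lambda>h. f (x + h)"]) auto
  moreover have "bounded_multilinear n (L n)" for n
    using La(2)[of n] by (auto simp: bounded_multilinear_def multilinear_le_def)
  ultimately show "\<exists>r>0. \<exists>L :: nat \<Rightarrow> 'a list \<Rightarrow> real. (\<forall>n. bounded_multilinear n (L n)) \<and>
        uniform_limit (ball 0 r) (\<lambda>m h. \<Sum>n<m. L n (replicate n h)) (\<lambda>h. f (x + h)) sequentially"
    using La(1) by blast
qed

section \<open>Analytic norms\<close>

text \<open>Minkowski's inequality in the plane from convexity of the p-th power: (u + v) / (A + B)
  is a convex combination of u / A and v / B with the same weights in both coordinates, and the
  bounds add up to 1.\<close>

lemma root_minkowski_le: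
  fixes a b c d :: real
  assumes p: "even p" "p > 0" and nonneg: "0 \<le> a" "0 \<le> b" "0 \<le> c" "0 \<le> d"
  shows "root p ((a + b) ^ p + (c + d) ^ p) \<le> root p (a ^ p + c ^ p) + root p (b ^ p + d ^ p)"
proof -
  define A B where "A = root p (a ^ p + c ^ p)" and "B = root p (b ^ p + d ^ p)"
  have AB: "A \<ge> 0" "B \<ge> 0" "A ^ p = a ^ p + c ^ p" "B ^ p = b ^ p + d ^ p"
    using p nonneg by (simp_all add: A_def B_def)
  show ?thesis
  proof (cases "A = 0 \<or> B = 0")
    case True
    then have "a = 0 \<and> c = 0 \<or> b = 0 \<and> d = 0"
    proof
      assume "A = 0"
      then have "a ^ p + c ^ p = 0" using AB(3) p(2) by (simp add: zero_power)
      then show ?thesis using nonneg p(2) by (simp add: add_nonneg_eq_0_iff)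
    next
      assume "B = 0"
      then have "b ^ p + d ^ p = 0" using AB(4) p(2) by (simp add: zero_power)
      then show ?thesis using nonneg p(2) by (simp add: add_nonneg_eq_0_iff)
    qed
    then show ?thesis using p nonneg by auto
  next
    case False
    then have pos: "A > 0" "B > 0" using AB by simp_all
    define t where "t = B / (A + B)"
    have t: "0 \<le> t" "t \<le> 1" using pos by (simp_all add: t_def)
    have conv: "((u + v) / (A + B)) ^ p \<le> (1 - t) * (u ^ p / A ^ p) + t * (v ^ p / B ^ p)" for u v
    proof -
      have "(1 - t) *\<^sub>R (u / A) + t *\<^sub>R (v / B) = (u + v) / (A + B)"
      proof -
        have "1 - t = A / (A + B)" using pos by (simp add: t_def field_simps)
        then show ?thesis using pos by (simp add: t_def add_divide_distrib)
      qed
      then show ?thesis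
        using convex_onD[OF convex_power_even[OF p(1)], of t "u / A" "v / B"] t
        by (simp add: power_divide)
    qed
    have "((a + b) ^ p + (c + d) ^ p) / (A + B) ^ p = ((a + b) / (A + B)) ^ p + ((c + d) / (A + B)) ^ p"
      unfolding power_divide by (rule add_divide_distrib)
    also have "\<dots> \<le> ((1 - t) * (a ^ p / A ^ p) + t * (b ^ p / B ^ p)) + ((1 - t) * (c ^ p / A ^ p) + t * (d ^ p / B ^ p))"
      by (intro add_mono conv)
    also have "\<dots> = (1 - t) * ((a ^ p + c ^ p) / A ^ p) + t * ((b ^ p + d ^ p) / B ^ p)"
      by (simp add: add_divide_distrib distrib_left)
    also have "\<dots> = 1" using pos by (simp flip: AB(3,4))
    finally have "(a + b) ^ p + (c + d) ^ p \<le> (A + B) ^ p" using pos by (simp add: divide_le_eq)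
    then have "root p ((a + b) ^ p + (c + d) ^ p) \<le> root p ((A + B) ^ p)"
      using p(2) by (rule real_root_le_mono[rotated])
    also have "\<dots> = A + B" using p(2) pos by (intro real_root_power_cancel) auto
    finally show ?thesis by (simp add: A_def B_def)
  qed
qed

section \<open>Nested means and their limit\<close>

text \<open>The shift \<open>m\<close> makes the total distortion of all means tend to 1, and the
  successor makes every exponent even, so that absolute values disappear from the powers.\<close>

definition expo :: "nat \<Rightarrow> nat \<Rightarrow> nat" where "expo m n = 2 ^ Suc (n + m)"

lemma expo_pos: "expo m n > 0" and expo_even: "even (expo m n)" and expo_Suc: "expo m (Suc n) = expo m n * 2"
  by (simp_all add: expo_def)

context boundary
begin

text \<open>Iterated \<open>p\<close>-norms of two numbers with rapidly increasing exponents. That each exponent divides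
  the next one makes suitable powers of the partial norms polynomial.\<close>

fun nested_mean :: "nat \<Rightarrow> nat \<Rightarrow> 'a \<Rightarrow> real" where
  "nested_mean m 0 y = \<bar>g 0 y\<bar>"
| "nested_mean m (Suc n) y =
    root (expo m (Suc n)) (nested_mean m n y ^ expo m (Suc n) + \<bar>g (Suc n) y\<bar> ^ expo m (Suc n))"

lemma nested_mean_nonneg: "0 \<le> nested_mean m n y"
  by (induction n) (simp_all add: expo_pos)

lemma nested_mean_power_Suc:
  "nested_mean m (Suc n) y ^ expo m (Suc n) = nested_mean m n y ^ expo m (Suc n) + \<bar>g (Suc n) y\<bar> ^ expo m (Suc n)"
  by (simp add: expo_pos nested_mean_nonneg)

lemma nested_mean_mono_Suc: "nested_mean m n y \<le> nested_mean m (Suc n) y"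
proof -
  have "nested_mean m n y ^ expo m (Suc n) \<le> nested_mean m (Suc n) y ^ expo m (Suc n)"
    unfolding nested_mean_power_Suc by simp
  then show ?thesis
    by (simp only: power_mono_iff[OF nested_mean_nonneg nested_mean_nonneg expo_pos])
qed

lemma nested_mean_mono: "n \<le> k \<Longrightarrow> nested_mean m n y \<le> nested_mean m k y"
  by (rule lift_Suc_mono_le[of "\<lambda>n. nested_mean m n y"]) (auto simp: nested_mean_mono_Suc simp del: nested_mean.simps)

lemma abs_g_le_nested_mean: "\<bar>g n y\<bar> \<le> nested_mean m n y"
proof (cases n)
  case (Suc k)
  have "\<bar>g (Suc k) y\<bar> ^ expo m (Suc k) \<le> nested_mean m (Suc k) y ^ expo m (Suc k)"
    unfolding nested_mean_power_Suc by (simp add: nested_mean_nonneg)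
  then have "\<bar>g (Suc k) y\<bar> \<le> nested_mean m (Suc k) y"
    by (simp only: power_mono_iff[OF abs_ge_zero nested_mean_nonneg expo_pos])
  then show ?thesis by (simp only: Suc)
qed simp

text \<open>Each mean costs at most a factor 2^(1 / p). As the exponents double, 1 / p_{n+1} equals
  1 / p_n - 1 / p_{n+1}, so the accumulated exponent of 2 telescopes.\<close>

lemma nested_mean_le:
  "nested_mean m n y \<le> (1 + \<delta>) * norm y * 2 powr (1 / 2 ^ m - 1 / real (expo m n))"
proof (induction n)
  case 0
  have "1 / (2::real) ^ m - 1 / real (expo m 0) \<ge> 0" by (simp add: expo_def)
  then have "1 \<le> 2 powr (1 / 2 ^ m - 1 / real (expo m 0))" by (simp add: ge_one_powr_ge_zero)
  then have "(1 + \<delta>) * norm y * 1 \<le> (1 + \<delta>) * norm y * 2 powr (1 / 2 ^ m - 1 / real (expo m 0))"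
    using \<delta>_pos by (intro mult_left_mono) auto
  then show ?case using abs_g_le_bound[of 0 y] by simp
next
  case (Suc n)
  define K where "K = (1 + \<delta>) * norm y * 2 powr (1 / 2 ^ m - 1 / real (expo m n))"
  let ?p = "expo m (Suc n)"
  have "(2::real) ^ m \<le> 2 ^ Suc (n + m)" by (intro power_increasing) auto
  then have "1 / (2::real) ^ Suc (n + m) \<le> 1 / 2 ^ m" by (intro frac_le) auto
  then have "1 / (2::real) ^ m - 1 / real (expo m n) \<ge> 0" by (simp add: expo_def)
  then have "1 \<le> 2 powr (1 / 2 ^ m - 1 / real (expo m n))" by (simp add: ge_one_powr_ge_zero)
  then have "(1 + \<delta>) * norm y * 1 \<le> K"
    unfolding K_def using \<delta>_pos by (intro mult_left_mono) auto
  then have gK: "\<bar>g (Suc n) y\<bar> \<le> K" using abs_g_le_bound[of "Suc n" y] by simp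
  then have "K \<ge> 0" by linarith
  have "nested_mean m (Suc n) y \<le> root ?p (K ^ ?p + K ^ ?p)"
    using Suc gK expo_pos[of m "Suc n"] unfolding nested_mean.simps
    by (intro real_root_le_mono add_mono power_mono) (auto simp: K_def nested_mean_nonneg)
  also have "\<dots> = root ?p 2 * K"
    using expo_pos[of m "Suc n"] \<open>K \<ge> 0\<close> by (simp add: real_root_mult real_root_power_cancel flip: mult_2)
  also have "root ?p 2 = 2 powr (1 / real ?p)"
    using expo_pos[of m "Suc n"] by (intro root_powr_inverse) auto
  also have "2 powr (1 / real ?p) * K = (1 + \<delta>) * norm y * 2 powr (1 / real ?p + (1 / 2 ^ m - 1 / real (expo m n)))"
    by (simp add: K_def powr_add)
  also have "1 / real ?p + (1 / 2 ^ m - 1 / real (expo m n)) = 1 / 2 ^ m - 1 / real ?p"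
    using expo_pos[of m n] by (simp add: expo_Suc)
  finally show ?case .
qed

lemma nested_mean_le_bound: "nested_mean m n y \<le> (1 + \<delta>) * 2 powr (1 / 2 ^ m) * norm y"
proof -
  have "2 powr (1 / 2 ^ m - 1 / real (expo m n)) \<le> (2::real) powr (1 / 2 ^ m)"
    by (intro powr_mono) auto
  then have "(1 + \<delta>) * norm y * 2 powr (1 / 2 ^ m - 1 / real (expo m n)) \<le> (1 + \<delta>) * norm y * 2 powr (1 / 2 ^ m)"
    using \<delta>_pos by (intro mult_left_mono) auto
  then show ?thesis using nested_mean_le[of m n y] by (simp add: mult_ac)
qed

lemma nested_mean_scaleR: "nested_mean m n (a *\<^sub>R y) = \<bar>a\<bar> * nested_mean m n y"
proof (induction n)
  case (Suc n)
  have "nested_mean m (Suc n) (a *\<^sub>R y) = root (expo m (Suc n)) (\<bar>a\<bar> ^ expo m (Suc n) *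
      (nested_mean m n y ^ expo m (Suc n) + \<bar>g (Suc n) y\<bar> ^ expo m (Suc n)))"
    by (simp add: Suc blinfun.bilinear_simps abs_mult power_mult_distrib distrib_left)
  also have "\<dots> = \<bar>a\<bar> * nested_mean m (Suc n) y"
    by (simp add: real_root_mult real_root_power_cancel expo_pos)
  finally show ?case .
qed (simp add: blinfun.bilinear_simps abs_mult)

lemma nested_mean_triangle: "nested_mean m n (y + z) \<le> nested_mean m n y + nested_mean m n z"
proof (induction n)
  case (Suc n)
  have "nested_mean m (Suc n) (y + z) \<le> root (expo m (Suc n))
     ((nested_mean m n y + nested_mean m n z) ^ expo m (Suc n) + (\<bar>g (Suc n) y\<bar> + \<bar>g (Suc n) z\<bar>) ^ expo m (Suc n))"
    unfolding nested_mean.simps using Suc expo_pos[of m "Suc n"]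
    by (intro real_root_le_mono add_mono power_mono) (auto simp: blinfun.bilinear_simps nested_mean_nonneg)
  also have "\<dots> \<le> nested_mean m (Suc n) y + nested_mean m (Suc n) z"
    unfolding nested_mean.simps
    by (intro root_minkowski_le expo_even expo_pos nested_mean_nonneg) auto
  finally show ?case .
qed (simp add: blinfun.bilinear_simps)

definition mean_norm :: "nat \<Rightarrow> 'a \<Rightarrow> real" where
  "mean_norm m y = (SUP n. nested_mean m n y)"

lemma bdd_above_nested_mean: "bdd_above (range (\<lambda>n. nested_mean m n y))"
  using nested_mean_le_bound by (intro bdd_aboveI2) auto

lemma nested_mean_le_mean_norm: "nested_mean m n y \<le> mean_norm m y"
  unfolding mean_norm_def by (rule cSUP_upper[OF _ bdd_above_nested_mean]) simp

lemma mean_norm_le: "mean_norm m y \<le> (1 + \<delta>) * 2 powr (1 / 2 ^ m) * norm y"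
  unfolding mean_norm_def by (rule cSUP_least) (auto simp: nested_mean_le_bound)

lemma nested_mean_tendsto: "(\<lambda>n. nested_mean m n y) \<longlonglongrightarrow> mean_norm m y"
  unfolding mean_norm_def
  by (rule LIMSEQ_incseq_SUP[OF bdd_above_nested_mean]) (auto simp: incseq_def nested_mean_mono)

lemma norm_le_mean_norm: "norm y \<le> mean_norm m y"
proof -
  obtain n where "\<bar>g n y\<bar> = (1 + e n) * norm y" by (rule g_attains)
  moreover have "norm y \<le> (1 + e n) * norm y" using e_pos[of n] by (simp add: distrib_right)
  ultimately show ?thesis
    using abs_g_le_nested_mean[of n y m] nested_mean_le_mean_norm[of m n y] by linarith
qed

lemma equivalent_norm_mean_norm: "equivalent_norm (mean_norm m)"
  unfolding equivalent_norm_def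
proof (intro conjI allI)
  show scale: "mean_norm m (a *\<^sub>R y) = \<bar>a\<bar> * mean_norm m y" for a y
    using LIMSEQ_unique[OF nested_mean_tendsto[of m "a *\<^sub>R y"]]
      tendsto_mult_left[OF nested_mean_tendsto[of m y], of "\<bar>a\<bar>"] by (simp add: nested_mean_scaleR)
  show "mean_norm m y = 0 \<longleftrightarrow> y = 0" for y
    using norm_le_mean_norm[of y m] scale[of 0 0] by auto
  show "mean_norm m (y + z) \<le> mean_norm m y + mean_norm m z" for y z
    by (rule LIMSEQ_le[OF nested_mean_tendsto tendsto_add[OF nested_mean_tendsto nested_mean_tendsto]])
       (auto intro: nested_mean_triangle)
  show "\<exists>c>0. \<exists>C>0. \<forall>y. c * norm y \<le> mean_norm m y \<and> mean_norm m y \<le> C * norm y"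
    using norm_le_mean_norm mean_norm_le \<delta>_pos
    by (intro exI[of _ 1] exI[of _ "(1 + \<delta>) * 2 powr (1 / 2 ^ m)"] conjI) auto
qed

lemma norm_g_le: "norm (g n) \<le> 1 + \<delta>"
  using abs_g_le_bound[of n] \<delta>_pos by (intro norm_blinfun_bound) auto

section \<open>Analyticity through the logarithms of the nested means\<close>

definition mean_poly :: "nat \<Rightarrow> nat \<Rightarrow> 'a \<Rightarrow> real" where
  "mean_poly m n y = nested_mean m n y ^ expo m n"

lemma mean_poly_0: "mean_poly m 0 y = g 0 y ^ expo m 0"
  by (simp add: mean_poly_def power_even_abs expo_even)

lemma mean_poly_Suc: "mean_poly m (Suc n) y = mean_poly m n y ^ 2 + g (Suc n) y ^ expo m (Suc n)"
proof -
  have "nested_mean m n y ^ expo m (Suc n) = mean_poly m n y ^ 2"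
    by (simp add: mean_poly_def expo_Suc power_mult)
  then show ?thesis
    unfolding mean_poly_def[of m "Suc n"] nested_mean_power_Suc by (simp add: power_even_abs expo_even)
qed

lemma power_series_le_g: "0 < r \<Longrightarrow> power_series_le (g n) x r (\<bar>g n x\<bar> + r * (1 + \<delta>))"
  using norm_g_le[of n] by (intro power_series_le_mono[OF power_series_le_functional]) auto

lemma power_series_le_mean_poly:
  assumes "0 < r" shows "\<exists>M. power_series_le (mean_poly m n) x r M"
proof (induction n)
  case 0
  show ?case unfolding mean_poly_0[abs_def]
    using power_series_le_power[OF power_series_le_g[OF assms]] by blast
next
  case (Suc n)
  then obtain M where "power_series_le (mean_poly m n) x r M" ..
  then show ?case unfolding mean_poly_Suc[abs_def]
    using power_series_le_add[OF power_series_le_power power_series_le_power[OF power_series_le_g[OF assms]]]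
    by blast
qed

text \<open>The quotient of the two summands in \<open>mean_poly_Suc\<close>: passing to the next
  mean multiplies the squared polynomial by 1 + \<open>mean_ratio\<close>.\<close>

definition mean_ratio :: "nat \<Rightarrow> nat \<Rightarrow> 'a \<Rightarrow> real" where
  "mean_ratio m n y = g (Suc n) y ^ expo m (Suc n) * inverse (mean_poly m n y) ^ 2"

lemma mean_poly_pos: "nested_mean m n y > 0 \<Longrightarrow> mean_poly m n y > 0"
  by (simp add: mean_poly_def)

lemma mean_ratio_nonneg: "0 \<le> mean_ratio m n y"
  by (simp add: mean_ratio_def zero_le_even_power expo_even)

lemma mean_poly_Suc_eq:
  "nested_mean m n y > 0 \<Longrightarrow> mean_poly m (Suc n) y = mean_poly m n y ^ 2 * (1 + mean_ratio m n y)"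
  using mean_poly_pos[of m n y] by (simp add: mean_poly_Suc mean_ratio_def field_simps)

lemma ln_nested_mean:
  assumes "nested_mean m n y > 0"
  shows "ln (nested_mean m n y) = ln (mean_poly m n y) / real (expo m n)"
  using assms expo_pos[of m n] by (simp add: mean_poly_def ln_realpow)

lemma ln_nested_mean_Suc:
  assumes "nested_mean m n y > 0"
  shows "ln (nested_mean m (Suc n) y) = ln (nested_mean m n y) + ln (1 + mean_ratio m n y) / real (expo m (Suc n))"
proof -
  have pos: "nested_mean m (Suc n) y > 0"
    using assms nested_mean_mono_Suc[of m n y] by (simp del: nested_mean.simps)
  have "ln (mean_poly m (Suc n) y) = 2 * ln (mean_poly m n y) + ln (1 + mean_ratio m n y)"
    unfolding mean_poly_Suc_eq[OF assms]
    using mean_poly_pos[OF assms] mean_ratio_nonneg[of m n y] by (simp add: ln_mult ln_realpow)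
  then show ?thesis
    unfolding ln_nested_mean[OF pos] ln_nested_mean[OF assms]
    using expo_pos[of m n] by (simp add: expo_Suc add_divide_distrib)
qed

lemma ln_nested_mean_add:
  assumes "nested_mean m k y > 0"
  shows "ln (nested_mean m (k + i) y) =
    ln (nested_mean m k y) + (\<Sum>j<i. ln (1 + mean_ratio m (k + j) y) / real (expo m (Suc (k + j))))"
proof (induction i)
  case (Suc i)
  have "nested_mean m (k + i) y > 0"
    using assms nested_mean_mono[of k "k + i" m y] by simp
  from ln_nested_mean_Suc[OF this] Suc show ?case by (simp del: nested_mean.simps)
qed simp

text \<open>Logarithms turn the infinite product of correction factors into a telescoping series, to
  which the closure of power series under infinite sums applies.\<close>

lemma mean_norm_eq_exp:
  assumes pos: "nested_mean m k y > 0"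
  shows "mean_norm m y = exp (ln (mean_poly m k y) / real (expo m k)
    + (\<Sum>j. ln (1 + mean_ratio m (k + j) y) / real (expo m (Suc (k + j)))))"
proof -
  have N: "mean_norm m y > 0"
    using pos nested_mean_le_mean_norm[of m k y] by linarith
  have "(\<lambda>i. ln (nested_mean m (i + k) y)) \<longlonglongrightarrow> ln (mean_norm m y)"
    using LIMSEQ_ignore_initial_segment[OF nested_mean_tendsto[of m y], of k] N by (intro tendsto_intros) auto
  then have "(\<lambda>i. ln (nested_mean m (k + i) y) - ln (nested_mean m k y)) \<longlonglongrightarrow> ln (mean_norm m y) - ln (nested_mean m k y)"
    by (intro tendsto_diff tendsto_const) (simp add: add.commute)
  then have "(\<lambda>j. ln (1 + mean_ratio m (k + j) y) / real (expo m (Suc (k + j)))) sums (ln (mean_norm m y) - ln (nested_mean m k y))"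
    unfolding sums_def ln_nested_mean_add[OF pos] by simp
  then show ?thesis
    using N by (simp add: sums_iff ln_nested_mean[OF pos])
qed

text \<open>The invariant is that T G^p is at most 1/2, where \<open>T\<close> bounds the reciprocal
  of the current polynomial. The ratio then has bound (T G^p)^2, at most 1/4, and the next
  reciprocal has bound T^2 * 4/3. Its product with G^(2p) is at most (1/2)^2 * 4/3 = 1/3, so the
  invariant reproduces itself and the radius stays the same throughout.\<close>

lemma power_series_le_mean_ratio:
  assumes r: "0 < r" and G: "\<And>n. n > k \<Longrightarrow> power_series_le (g n) x r G"
    and T: "power_series_le (\<lambda>y. inverse (mean_poly m k y)) x r T" "T * G ^ expo m k \<le> 1 / 2"
    and pos: "\<And>y. norm (y - x) < r \<Longrightarrow> nested_mean m k y > 0"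
  shows "power_series_le (mean_ratio m (k + i)) x r (1 / 4)"
proof -
  have "power_series_le (g (Suc k)) x r G" by (rule G) simp
  then have G0: "0 \<le> G" by (rule power_series_le_nonneg)
  have step: "power_series_le (mean_ratio m n) x r (1 / 4)"
    if "n \<ge> k" and inv: "power_series_le (\<lambda>y. inverse (mean_poly m n y)) x r T" "T * G ^ expo m n \<le> 1 / 2" for n T
  proof -
    have "power_series_le (g (Suc n)) x r G" using that(1) by (intro G) simp
    then have *: "power_series_le (mean_ratio m n) x r (G ^ expo m (Suc n) * T ^ 2)"
      unfolding mean_ratio_def using inv(1) by (intro power_series_le_mult power_series_le_power)
    have "0 \<le> T" by (rule power_series_le_nonneg[OF inv(1)])
    have "G ^ expo m (Suc n) * T ^ 2 = (T * G ^ expo m n) ^ 2"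
      by (simp add: expo_Suc power_mult power_mult_distrib)
    also have "\<dots> \<le> (1 / 2) ^ 2"
      using inv(2) G0 \<open>0 \<le> T\<close> by (intro power_mono) auto
    also have "(1 / 2 :: real) ^ 2 = 1 / 4"
      by (simp add: power2_eq_square)
    finally show ?thesis
      by (rule power_series_le_mono[OF *])
  qed
  have "\<exists>T. power_series_le (\<lambda>y. inverse (mean_poly m (k + i) y)) x r T \<and> T * G ^ expo m (k + i) \<le> 1 / 2"
  proof (induction i)
    case 0
    then show ?case using T by auto
  next
    case (Suc i)
    then obtain T where inv: "power_series_le (\<lambda>y. inverse (mean_poly m (k + i) y)) x r T"
      "T * G ^ expo m (k + i) \<le> 1 / 2" by blast
    have T0: "0 \<le> T" by (rule power_series_le_nonneg[OF inv(1)])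
    have ratio: "power_series_le (mean_ratio m (k + i)) x r (1 / 4)"
      by (rule step[OF _ inv]) simp
    have "power_series_le (\<lambda>y. inverse (mean_poly m (k + i) y) ^ 2 * inverse (1 + mean_ratio m (k + i) y)) x r
       (T ^ 2 * (1 / (1 - 1 / 4)))"
      by (intro power_series_le_mult power_series_le_power power_series_le_inverse inv ratio) simp
    then have "power_series_le (\<lambda>y. inverse (mean_poly m (Suc (k + i)) y)) x r (T ^ 2 * (1 / (1 - 1 / 4)))"
    proof (rule power_series_le_cong)
      fix y assume "norm (y - x) < r"
      then have "nested_mean m (k + i) y > 0"
        using pos[of y] nested_mean_mono[of k "k + i" m y] by simp
      then show "inverse (mean_poly m (k + i) y) ^ 2 * inverse (1 + mean_ratio m (k + i) y) =
          inverse (mean_poly m (Suc (k + i)) y)"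
        by (simp add: mean_poly_Suc_eq power_inverse)
    qed
    moreover have "T ^ 2 * (1 / (1 - 1 / 4)) * G ^ expo m (Suc (k + i)) \<le> 1 / 2"
    proof -
      have "T ^ 2 * (1 / (1 - 1 / 4)) * G ^ expo m (Suc (k + i)) = (T * G ^ expo m (k + i)) ^ 2 * (4 / 3)"
        by (simp add: expo_Suc power_mult power_mult_distrib)
      also have "\<dots> \<le> (1 / 2) ^ 2 * (4 / 3)"
        using inv(2) T0 G0 by (intro mult_right_mono power_mono) auto
      finally show ?thesis by (simp add: power2_eq_square)
    qed
    ultimately show ?case by auto
  qed
  then show ?thesis using step[of "k + i"] by auto
qed

lemma analytic_norm_mean_norm: "analytic_norm (mean_norm m)"
  unfolding analytic_norm_def
proof (rule real_analytic_on_power_series_le)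
  fix x :: 'a assume "x \<in> UNIV - {0}"
  then have x: "norm x > 0" by simp
  obtain j where j: "\<bar>g j x\<bar> = (1 + e j) * norm x" by (rule g_attains)
  \<comment> \<open>At \<open>x\<close> the functional \<open>g j\<close> has modulus
    \<open>A\<close>, while all late functionals stay below \<open>B\<close>. The level
    \<open>C\<close> in between bounds the late ones, and is reached by \<open>g j\<close>, on a
    whole ball around \<open>x\<close>.\<close>
  define A B C where "A = (1 + e j) * norm x" and "B = (1 + e j / 2) * norm x"
    and "C = (1 + e j * 3 / 4) * norm x"
  have ABC: "0 < B" "B < C" "C < A"
    using x e_pos[of j] by (simp_all add: A_def B_def C_def)
  have "\<forall>\<^sub>F n in sequentially. e n < e j / 2"
    using e_pos[of j] by (intro order_tendstoD[OF e_tendsto_0]) simp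
  then obtain k0 where k0: "\<And>n. n \<ge> k0 \<Longrightarrow> e n < e j / 2"
    by (auto simp: eventually_sequentially)
  have "(\<lambda>n. (C / A) ^ n) \<longlonglongrightarrow> 0"
    using ABC by (intro LIMSEQ_realpow_zero) auto
  then have "\<forall>\<^sub>F n in sequentially. (C / A) ^ n < 1 / 4"
    by (intro order_tendstoD) auto
  then obtain k1 where k1: "\<And>n. n \<ge> k1 \<Longrightarrow> (C / A) ^ n < 1 / 4"
    by (auto simp: eventually_sequentially)
  define k where "k = max j (max k0 k1)"
  have k: "j \<le> k" "k0 \<le> k" "k1 \<le> k" by (auto simp: k_def)
  define p where "p = expo m k"
  \<comment> \<open>The exponent exceeds its index, so choosing \<open>k\<close> large also makes
    the power of \<open>C / A\<close> small.\<close>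
  have "k < p"
    using less_exp[of "Suc (k + m)"] by (simp add: p_def expo_def)
  then have small: "(C / A) ^ p < 1 / 4" using k1[of p] k(3) by simp
  have Rx: "A \<le> nested_mean m k x"
    using abs_g_le_nested_mean[of j x m] nested_mean_mono[OF k(1), of m x] j by (simp add: A_def)
  then have Rx_pos: "nested_mean m k x > 0" using ABC by linarith
  obtain M where poly: "power_series_le (mean_poly m k) x 1 M"
    using power_series_le_mean_poly[OF zero_less_one] by blast
  have poly_pos: "mean_poly m k x > 0" by (rule mean_poly_pos[OF Rx_pos])
  have Ap: "A ^ p \<le> mean_poly m k x"
    unfolding mean_poly_def p_def using Rx ABC by (intro power_mono) auto
  obtain r1 M1 where "power_series_le (\<lambda>y. inverse (mean_poly m k y)) x r1 M1"
    by (rule power_series_le_inverse_at[OF poly]) (use poly_pos in auto)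
  \<comment> \<open>Of the admissible 1/2 for T C^p, one quarter is covered by the value of the
    reciprocal at \<open>x\<close>, at most \<open>(C / A) ^ p\<close>, and one quarter by the error
    \<open>\<eta>\<close> of shrinking.\<close>
  moreover define \<eta> where "\<eta> = 1 / 4 / C ^ p"
  moreover have "\<eta> > 0" using ABC by (simp add: \<eta>_def)
  ultimately obtain r2 where r2: "0 < r2" "\<forall>s. 0 < s \<longrightarrow> s \<le> r2 \<longrightarrow>
      power_series_le (\<lambda>y. inverse (mean_poly m k y)) x s (\<bar>inverse (mean_poly m k x)\<bar> + \<eta>)"
    using power_series_le_shrink by blast
  obtain r3 M3 where r3: "0 < r3" "power_series_le (\<lambda>y. ln (mean_poly m k y)) x r3 M3"
    by (rule power_series_le_ln_at[OF poly poly_pos])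
  obtain r4 where r4: "0 < r4" "\<forall>s. 0 < s \<longrightarrow> s \<le> r4 \<longrightarrow>
      power_series_le (\<lambda>y. ln (mean_poly m k y)) x s (\<bar>ln (mean_poly m k x)\<bar> + 1)"
    using power_series_le_shrink[OF r3(2) zero_less_one] by blast
  \<comment> \<open>Besides the two expansions, the radius respects the distances of
    \<open>C\<close> to \<open>B\<close> and \<open>A\<close>, divided by the common bound
    \<open>1 + \<delta>\<close> of the norms of the \<open>g n\<close>.\<close>
  define r where "r = min (min r2 r4) (min ((C - B) / (1 + \<delta>)) ((A - C) / (1 + \<delta>)))"
  have r: "0 < r" "r \<le> r2" "r \<le> r4" "r \<le> (C - B) / (1 + \<delta>)" "r \<le> (A - C) / (1 + \<delta>)"
    using r2(1) r4(1) ABC \<delta>_pos by (auto simp: r_def)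
  then have r': "r * (1 + \<delta>) \<le> C - B" "r * (1 + \<delta>) \<le> A - C"
    using \<delta>_pos by (simp_all add: le_divide_eq)
  have G: "power_series_le (g n) x r C" if "n > k" for n
  proof (rule power_series_le_mono[OF power_series_le_g[OF r(1)]])
    have "(1 + e n) * norm x \<le> B"
      unfolding B_def using k0[of n] that k(2) x by (intro mult_right_mono) auto
    then show "\<bar>g n x\<bar> + r * (1 + \<delta>) \<le> C" using abs_g_le[of n x] r' by linarith
  qed
  have pos: "nested_mean m k y > 0" if "norm (y - x) < r" for y
  proof -
    have "\<bar>g j (y - x)\<bar> \<le> (1 + \<delta>) * norm (y - x)" by (rule abs_g_le_bound)
    also have "\<dots> \<le> (1 + \<delta>) * r" using that \<delta>_pos by (intro mult_left_mono) auto
    also have "\<dots> \<le> A - C" using r' by (simp add: mult.commute)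
    finally have "C \<le> \<bar>g j y\<bar>" using j by (simp add: A_def blinfun.bilinear_simps)
    then show ?thesis
      using abs_g_le_nested_mean[of j y m] nested_mean_mono[OF k(1), of m y] ABC by linarith
  qed
  define T where "T = \<bar>inverse (mean_poly m k x)\<bar> + \<eta>"
  have inv: "power_series_le (\<lambda>y. inverse (mean_poly m k y)) x r T"
    unfolding T_def using r2(2) r(1,2) by blast
  have "T * C ^ expo m k \<le> 1 / 2"
  proof -
    have "inverse (mean_poly m k x) * C ^ p \<le> inverse (A ^ p) * C ^ p"
      using Ap ABC by (intro mult_right_mono le_imp_inverse_le) auto
    also have "\<dots> = (C / A) ^ p" by (simp add: divide_inverse power_mult_distrib power_inverse)
    finally have "inverse (mean_poly m k x) * C ^ p \<le> 1 / 4" using small by simp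
    moreover have "\<eta> * C ^ p = 1 / 4" using ABC by (simp add: \<eta>_def)
    ultimately show ?thesis using poly_pos by (simp add: T_def distrib_right flip: p_def)
  qed
  note ratio = power_series_le_mean_ratio[OF r(1) G inv this pos]
  have term_j: "power_series_le (\<lambda>y. ln (1 + mean_ratio m (k + j) y) / real (expo m (Suc (k + j)))) x r ((1 / 2) ^ j)" for j
  proof -
    have *: "power_series_le (\<lambda>y. (1 / real (expo m (Suc (k + j)))) * ln (1 + mean_ratio m (k + j) y)) x r
        (\<bar>1 / real (expo m (Suc (k + j)))\<bar> * (1 / 4 / (1 - 1 / 4)))"
      by (intro power_series_le_cmult power_series_le_ln ratio) simp_all
    have "\<bar>1 / real (expo m (Suc (k + j)))\<bar> * (1 / 4 / (1 - 1 / 4)) \<le> (1 / 2) ^ j"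
    proof -
      have "(2::real) ^ j \<le> 2 ^ Suc (Suc (k + j) + m)" by (intro power_increasing) auto
      then have "1 / real (expo m (Suc (k + j))) \<le> 1 / 2 ^ j"
        by (simp add: expo_def frac_le)
      moreover have "\<bar>1 / real (expo m (Suc (k + j)))\<bar> * (1 / 4 / (1 - 1 / 4)) \<le> \<bar>1 / real (expo m (Suc (k + j)))\<bar> * 1"
        by (intro mult_left_mono) auto
      ultimately show ?thesis by (simp add: power_one_over)
    qed
    from power_series_le_mono[OF * this] show ?thesis by simp
  qed
  have "power_series_le (\<lambda>y. \<Sum>j. ln (1 + mean_ratio m (k + j) y) / real (expo m (Suc (k + j)))) x r (\<Sum>j. (1 / 2) ^ j)"
    by (intro power_series_le_suminf r(1) term_j summable_geometric) simp
  moreover have "power_series_le (\<lambda>y. ln (mean_poly m k y)) x r (\<bar>ln (mean_poly m k x)\<bar> + 1)"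
    using r4(2) r(1,3) by blast
  then have "power_series_le (\<lambda>y. (1 / real (expo m k)) * ln (mean_poly m k y)) x r
      (\<bar>1 / real (expo m k)\<bar> * (\<bar>ln (mean_poly m k x)\<bar> + 1))"
    by (rule power_series_le_cmult)
  ultimately have "power_series_le (\<lambda>y. exp ((1 / real (expo m k)) * ln (mean_poly m k y) +
      (\<Sum>j. ln (1 + mean_ratio m (k + j) y) / real (expo m (Suc (k + j)))))) x r
      (exp (\<bar>1 / real (expo m k)\<bar> * (\<bar>ln (mean_poly m k x)\<bar> + 1) + (\<Sum>j. (1 / 2) ^ j)))"
    by (intro power_series_le_exp power_series_le_add)
  then have "power_series_le (mean_norm m) x r
      (exp (\<bar>1 / real (expo m k)\<bar> * (\<bar>ln (mean_poly m k x)\<bar> + 1) + (\<Sum>j. (1 / 2) ^ j)))"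
    by (rule power_series_le_cong) (simp add: mean_norm_eq_exp[OF pos])
  then show "\<exists>r M. power_series_le (mean_norm m) x r M" by blast
qed

end

theorem corollary3p6:
  assumes "separable_space (euclidean :: 'a::real_normed_vector topology)"
    and "VI_polyhedral (norm :: 'a \<Rightarrow> real)"
    and "property_Delta (norm :: 'a \<Rightarrow> real)"
  shows "(\<exists>N :: 'a \<Rightarrow> real. equivalent_norm N \<and> IV_polyhedral N) \<and>
         approximated_by (IV_polyhedral :: ('a \<Rightarrow> real) \<Rightarrow> bool) \<and>
         approximated_by (\<lambda>N :: 'a \<Rightarrow> real. C_infinity_norm N \<and> LFC N) \<and>
         approximated_by (analytic_norm :: ('a \<Rightarrow> real) \<Rightarrow> bool)"
proof -
  obtain f :: "nat \<Rightarrow> 'a \<Rightarrow>\<^sub>L real"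
    where f: "\<And>n x. \<bar>f n x\<bar> \<le> norm x" "\<And>x. \<exists>n. \<bar>f n x\<bar> = norm x"
    by (rule countable_boundary[OF assms]) blast
  have bd: "boundary f \<delta>" if "\<delta> > 0" for \<delta>
    using f that by unfold_locales
  \<comment> \<open>All three constructions only enlarge the norm, so just the upper estimates
    depend on the construction.\<close>
  have lower: "(1 - \<epsilon>) * norm x \<le> N" if "\<epsilon> > 0" "norm x \<le> N" for \<epsilon> N and x :: 'a
    using that mult_right_mono[of "1 - \<epsilon>" 1 "norm x"] by simp
  have IV: "approximated_by (IV_polyhedral :: ('a \<Rightarrow> real) \<Rightarrow> bool)"
    unfolding approximated_by_def
  proof (intro allI impI)
    fix \<epsilon> :: real assume \<epsilon>: "\<epsilon> > 0"
    interpret B: boundary f \<epsilon> by (rule bd[OF \<epsilon>])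
    have "B.tail_norm 0 x \<le> (1 + \<epsilon>) * norm x" for x
      using B.tail_norm_le[of 0 x] by (simp add: B.e_def)
    then show "\<exists>N. equivalent_norm N \<and> IV_polyhedral N \<and>
        (\<forall>x. (1 - \<epsilon>) * norm x \<le> N x \<and> N x \<le> (1 + \<epsilon>) * norm (x :: 'a))"
      using B.equivalent_norm_tail_norm B.IV_polyhedral_tail_norm B.norm_le_tail_norm lower[OF \<epsilon>]
      by (intro exI[of _ "B.tail_norm 0"] conjI allI) auto
  qed
  then have "\<exists>N :: 'a \<Rightarrow> real. equivalent_norm N \<and> IV_polyhedral N"
    unfolding approximated_by_def using zero_less_one by blast
  moreover note IV
  moreover have "approximated_by (\<lambda>N :: 'a \<Rightarrow> real. C_infinity_norm N \<and> LFC N)"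
    unfolding approximated_by_def
  proof (intro allI impI)
    fix \<epsilon> :: real assume \<epsilon>: "\<epsilon> > 0"
    interpret B: boundary f \<epsilon> by (rule bd[OF \<epsilon>])
    have "B.gauge.\<mu> x \<le> (1 + \<epsilon>) * norm x" for x
      using B.gauge.\<mu>_le[of x] by (simp add: mult.commute)
    then show "\<exists>N. equivalent_norm N \<and> (C_infinity_norm N \<and> LFC N) \<and>
        (\<forall>x. (1 - \<epsilon>) * norm x \<le> N x \<and> N x \<le> (1 + \<epsilon>) * norm (x :: 'a))"
      using B.gauge.equivalent_norm_\<mu> B.C_infinity_norm_gauge B.LFC_gauge B.gauge.norm_le_\<mu> lower[OF \<epsilon>]
      by (intro exI[of _ B.gauge.\<mu>] conjI allI) auto
  qed
  moreover have "approximated_by (analytic_norm :: ('a \<Rightarrow> real) \<Rightarrow> bool)"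
    unfolding approximated_by_def
  proof (intro allI impI)
    fix \<epsilon> :: real assume \<epsilon>: "\<epsilon> > 0"
    \<comment> \<open>The distortion has two sources, the weights and the means, each at most
      \<open>1 + \<delta>\<close>; for \<delta> at most 1 the product is at most 1 + 3
      \<delta>.\<close>
    define \<delta> where "\<delta> = min \<epsilon> 1 / 3"
    have \<delta>: "\<delta> > 0" "\<delta> \<le> 1 / 3" "3 * \<delta> \<le> \<epsilon>" using \<epsilon> by (auto simp: \<delta>_def)
    interpret B: boundary f \<delta> by (rule bd[OF \<delta>(1)])
    have "(\<lambda>m. 2 powr ((1 / 2) ^ m)) \<longlonglongrightarrow> 2 powr (0 :: real)"
      by (intro tendsto_intros LIMSEQ_realpow_zero) auto
    then have "\<forall>\<^sub>F m in sequentially. 2 powr ((1 / 2) ^ m) < 1 + \<delta>"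
      using \<delta> by (intro order_tendstoD) auto
    then obtain m :: nat where m: "2 powr (1 / 2 ^ m) < 1 + \<delta>"
      by (auto simp: eventually_sequentially power_one_over)
    have "B.mean_norm m x \<le> (1 + \<epsilon>) * norm x" for x
    proof -
      have "(1 + \<delta>) * 2 powr (1 / 2 ^ m) \<le> (1 + \<delta>) * (1 + \<delta>)"
        using m \<delta> by (intro mult_left_mono) auto
      also have "\<dots> = 1 + 2 * \<delta> + \<delta> * \<delta>" by (simp add: algebra_simps)
      also have "\<dots> \<le> 1 + \<epsilon>"
        using \<delta> mult_right_mono[of \<delta> 1 \<delta>] by linarith
      finally have "(1 + \<delta>) * 2 powr (1 / 2 ^ m) * norm x \<le> (1 + \<epsilon>) * norm x"
        by (rule mult_right_mono) simp
      then show ?thesis using B.mean_norm_le[of m x] by linarith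
    qed
    then show "\<exists>N. equivalent_norm N \<and> analytic_norm N \<and>
        (\<forall>x. (1 - \<epsilon>) * norm x \<le> N x \<and> N x \<le> (1 + \<epsilon>) * norm (x :: 'a))"
      using B.equivalent_norm_mean_norm B.analytic_norm_mean_norm B.norm_le_mean_norm lower[OF \<epsilon>]
      by (intro exI[of _ "B.mean_norm m"] conjI allI) auto
  qed
  ultimately show ?thesis by blast
qed

end
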